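(* Let $(\mathcal{A}, \mathbb{E}, \mathbb{F}, \varepsilon)$ be a $\mathcal{B}$-$\mathcal{B}$-non-commutative probability space with a pair of $(\mathcal{B}, \mathcal{D})$-valued expectations, let $\chi: \{1, \dots, n\} \to \{\ell, r\}$ with $n \geq 2$, and let $Z_k \in \mathcal{A}_{\chi(k)}$ for $1\le k\le n$. If there exist $q \in \{1, \dots, n\}$ and $b \in \mathcal{B}$ such that $Z_q = L_b$ if $\chi(q) = \ell$ or $Z_q = R_b$ if $\chi(q) = r$, then $$\kappa_{1_\chi}(Z_1, \dots, Z_n) = \mathcal{K}_{1_\chi}(Z_1, \dots, Z_n) = 0.$$
   Context: All algebras are over $\mathbb{C}$. Spaces. A $\mathcal{B}$-$\mathcal{B}$-non-commutative probability space with a pair of $(\mathcal{B},\mathcal{D})$-valued expectations is a quadruple $(\mathcal{A},\mathbb{E},\mathbb{F},\varepsilon)$ where $\mathcal{A},\mathcal{B},\mathcal{D}$ are unital algebras with $1:=1_{\mathcal{D}}\in\mathcal{B}\subset\mathcal{D}$, $\varepsilon:\mathcal{B}\otimes\mathcal{B}^{\mathrm{op}}\to\mathcal{A}$ is a unital homomorphism whose restrictions to $\mathcal{B}\otimes 1$ and $1\otimes\mathcal{B}^{\mathrm{op}}$ are injective, and $\mathbb{E}:\mathcal{A}\to\mathcal{B}$, $\mathbb{F}:\mathcal{A}\to\mathcal{D}$ are unital linear maps such that, writing $L_b=\varepsilon(b\otimes 1)$ and $R_b=\varepsilon(1\otimes b)$, for all $b_1,b_2,b\in\mathcal{B}$ and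 $Z\in\mathcal{A}$: $\mathbb{E}(L_{b_1}R_{b_2}Z)=b_1\mathbb{E}(Z)b_2$, $\mathbb{E}(ZL_b)=\mathbb{E}(ZR_b)$, $\mathbb{F}(L_{b_1}R_{b_2}Z)=b_1\mathbb{F}(Z)b_2$, $\mathbb{F}(ZL_b)=\mathbb{F}(ZR_b)$. Set $\mathcal{A}_\ell=\{Z\in\mathcal{A}: ZR_b=R_bZ\ \forall b\in\mathcal{B}\}$ and $\mathcal{A}_r=\{Z\in\mathcal{A}: ZL_b=L_bZ\ \forall b\in\mathcal{B}\}$. Bi-non-crossing partitions. For $\chi:\{1,\dots,n\}\to\{\ell,r\}$ with $\chi^{-1}(\ell)=\{i_1<\dots<i_p\}$ and $\chi^{-1}(r)=\{j_1<\dots<j_{n-p}\}$, $\prec_\chi$ is the total order $i_1\prec_\chi\dots\prec_\chi i_p\prec_\chi j_{n-p}\prec_\chi\dots\prec_\chi j_1$. A $\chi$-interval is an interval for $\prec_\chi$. $\mathcal{BNC}(\chi)$ is the lattice (under refinement) of partitions of $\{1,\dots,n\}$ that are non-crossing with respect to $\prec_\chi$; $1_\chi$ is the one-block partition and $\mu_{\mathcal{BNC}}$ the Möbius function of this lattice. Restrictions $\pi|_V$, $(Z_1,\dots,Z_n)|_V$ keep the indices in $V$, relabelled in increasing order. $\min(V)$ is for the usual order; $\min_{\prec_\chi},\max_{\prec_\chi}$ for $\prec_\chi$. Bi-free moments and cumulants. For $\pi\in\mathcal{BNC}(\chi)$ and $Z_1,\dots,Z_n\in\mathcal{A}$ define $\mathcal{E}_\pi(Z_1,\dots,Z_n)\in\mathcal{B}$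 recursively. If $\pi=1_\chi$, it is $\mathbb{E}(Z_1\cdots Z_n)$. Otherwise let $V=\{v_1<\dots<v_s\}$ be the block with the largest $\min(V)$, $m=\min(V)$, $b=\mathbb{E}(Z_{v_1}\cdots Z_{v_s})$, and $T_b=L_b$ if $\chi(m)=\ell$, $T_b=R_b$ if $\chi(m)=r$. If $V=\{m,\dots,n\}$, then $\mathcal{E}_\pi(Z_1,\dots,Z_n)=\mathcal{E}_{\pi|_{V^\complement}}(Z_1,\dots,Z_{m-2},Z_{m-1}T_b)$. Otherwise let $W$ be the block containing the $\prec_\chi$-smallest (if $\chi(m)=\ell$) or $\prec_\chi$-largest (if $\chi(m)=r$) element of $\{m+1,\dots,n\}\setminus V$ (the block whose spine is adjacent to $\min(V)$ in the diagram of $\pi$), let $k=\min\{j\in W: j>m\}$, and set $\mathcal{E}_\pi(Z_1,\dots,Z_n)=\mathcal{E}_{\pi|_{V^\complement}}((Z_1,\dots,Z_{k-1},T_bZ_k,Z_{k+1},\dots,Z_n)|_{V^\complement})$. The operator-valued bi-free cumulant function is $\kappa_\pi(Z_1,\dots,Z_n)=\sum_{\sigma\in\mathcal{BNC}(\chi),\,\sigma\le\pi}\mathcal{E}_\sigma(Z_1,\dots,Z_n)\mu_{\mathcal{BNC}}(\sigma,\pi)$ for $Z_k\in\mathcal{A}_{\chi(k)}$. Conditionally bi-free cumulants. For $\pi\in\mathcal{BNC}(\chi)$ and $Z_k\in\mathcal{A}_{\chi(k)}$, $\mathcal{K}_\pi(Z_1,\dots,Z_n)\in\mathcal{D}$ is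 defined recursively on $n$. If $n=1$, $\mathcal{K}_{1_\chi}(Z)=\mathbb{F}(Z)$. If $n\ge2$ and $\pi\ne1_\chi$, let $V_1,\dots,V_t$ (ordered by $\prec_\chi$) be the unique partition of $\{1,\dots,n\}$ into $\chi$-intervals, each a union of blocks of $\pi$, such that $\min_{\prec_\chi}(V_i)$ and $\max_{\prec_\chi}(V_i)$ lie in a common block $V_i'$ of $\pi$ for each $i$; then $\mathcal{K}_\pi(Z_1,\dots,Z_n)=\mathcal{K}_{\pi|_{V_1}}((Z_1,\dots,Z_n)|_{V_1})\cdots\mathcal{K}_{\pi|_{V_t}}((Z_1,\dots,Z_n)|_{V_t})$, where each factor is reduced as follows until only the block $V_i'$ remains: let $V\subset V_i\setminus V_i'$ be the block of $\pi$ with the largest $\min(V)$, let $p=\max_{\prec_\chi}\{j\in V_i: j\prec_\chi\min_{\prec_\chi}(V)\}$ and $c=\kappa_{\pi|_V}((Z_1,\dots,Z_n)|_V)$; then $\mathcal{K}_{\pi|_{V_i}}((Z_1,\dots,Z_n)|_{V_i})$ equals $\mathcal{K}_{\pi|_{V_i\setminus V}}$ evaluated at $(Z_1,\dots,Z_n)|_{V_i\setminus V}$ with $Z_p$ replaced by $Z_pL_c$ if $\chi(p)=\ell$ and by $R_cZ_p$ if $\chi(p)=r$. Finally, $\mathcal{K}_{1_\chi}(Z_1,\dots,Z_n)=\mathbb{F}(Z_1\cdots Z_n)-\sum_{\pi\in\mathcal{BNC}(\chi),\,\pi\ne1_\chi}\mathcal{K}_\pi(Z_1,\dots,Z_n)$.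 *)

theory Defs
  imports Complex_Main "HOL-Library.Disjoint_Sets"
begin

section \<open>Complex unital algebras and the tensor product \<open>B \<otimes> B\<^sup>o\<^sup>p\<close>\<close>

text \<open>The sort \<open>{ring, monoid_mult}\<close> is that of rings with unit in which \<open>0 = 1\<close> is not excluded.\<close>

locale complex_algebra = vector_space scale
  for scale :: "complex \<Rightarrow> 'a::{ring, monoid_mult} \<Rightarrow> 'a" +
  assumes scale_mult_left: "scale c x * y = scale c (x * y)"
    and scale_mult_right: "x * scale c y = scale c (x * y)"

definition unital_subalgebra :: "(complex \<Rightarrow> 'a::{ring, monoid_mult} \<Rightarrow> 'a) \<Rightarrow> 'a set \<Rightarrow> bool" where
  "unital_subalgebra scale B \<longleftrightarrow>
     module.subspace scale B \<and> 1 \<in> B \<and> (\<forall>x\<in>B. \<forall>y\<in>B. x * y \<in> B)"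

text \<open>The algebra on the type \<open>'t\<close>, together with the map \<open>(b, c) \<mapsto> tens b c\<close> on \<open>B \<times> B\<close>, is
  the algebraic tensor product of the algebra \<open>B\<close> with its opposite. The assumptions
  \<open>tens_span\<close> and \<open>tens_faithful\<close> say that the linear map from the vector space tensor product of
  \<open>B\<close> with itself to \<open>'t\<close> induced by the bilinear map \<open>tens\<close> is surjective and injective
  (every tensor is a finite sum of \<open>s \<otimes> u s\<close> with linearly independent \<open>s\<close>, and such a sum is
  zero only if all \<open>u s\<close> are). The values of \<open>tens\<close> outside \<open>B \<times> B\<close> are irrelevant.\<close>

locale tensor_opposite =
  D: complex_algebra scaleD + T: complex_algebra scaleT
  for scaleD :: "complex \<Rightarrow> 'd::{ring, monoid_mult} \<Rightarrow> 'd"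
    and scaleT :: "complex \<Rightarrow> 't::{ring, monoid_mult} \<Rightarrow> 't" +
  fixes B :: "'d set" and tens :: "'d \<Rightarrow> 'd \<Rightarrow> 't"
  assumes B_subalgebra: "unital_subalgebra scaleD B"
    and tens_add_left: "\<lbrakk>b \<in> B; b' \<in> B; c \<in> B\<rbrakk> \<Longrightarrow> tens (b + b') c = tens b c + tens b' c"
    and tens_add_right: "\<lbrakk>b \<in> B; c \<in> B; c' \<in> B\<rbrakk> \<Longrightarrow> tens b (c + c') = tens b c + tens b c'"
    and tens_scale_left: "\<lbrakk>b \<in> B; c \<in> B\<rbrakk> \<Longrightarrow> tens (scaleD z b) c = scaleT z (tens b c)"
    and tens_scale_right: "\<lbrakk>b \<in> B; c \<in> B\<rbrakk> \<Longrightarrow> tens b (scaleD z c) = scaleT z (tens b c)"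
    and tens_span: "T.span {tens b c | b c. b \<in> B \<and> c \<in> B} = UNIV"
    and tens_faithful: "\<lbrakk>finite S; S \<subseteq> B; D.independent S; \<And>s. s \<in> S \<Longrightarrow> u s \<in> B;
            (\<Sum>s\<in>S. tens s (u s)) = 0; s \<in> S\<rbrakk> \<Longrightarrow> u s = 0"
    and tens_mult: "\<lbrakk>b \<in> B; c \<in> B; b' \<in> B; c' \<in> B\<rbrakk> \<Longrightarrow>
            tens b c * tens b' c' = tens (b * b') (c' * c)"
    and tens_one: "tens 1 1 = 1"


section \<open>Non-commutative probability spaces with a pair of expectations\<close>

text \<open>The algebras \<open>\<A>\<close> and \<open>\<D>\<close> are the types \<open>'a\<close> and \<open>'d\<close>, \<open>\<B>\<close> is the set \<open>ncs_B\<close>, and \<open>'t\<close>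
  carries \<open>\<B> \<otimes> \<B>\<^sup>o\<^sup>p\<close>.\<close>

record ('a, 'd, 't) ncs =
  scA :: "complex \<Rightarrow> 'a \<Rightarrow> 'a"
  scD :: "complex \<Rightarrow> 'd \<Rightarrow> 'd"
  scT :: "complex \<Rightarrow> 't \<Rightarrow> 't"
  ncs_B :: "'d set"
  tens :: "'d \<Rightarrow> 'd \<Rightarrow> 't"
  eps :: "'t \<Rightarrow> 'a"
  EE :: "'a \<Rightarrow> 'd"
  FF :: "'a \<Rightarrow> 'd"

definition Lop :: "('a, 'd::monoid_mult, 't) ncs \<Rightarrow> 'd \<Rightarrow> 'a" where
  "Lop X b = eps X (tens X b 1)"

definition Rop :: "('a, 'd::monoid_mult, 't) ncs \<Rightarrow> 'd \<Rightarrow> 'a" where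
  "Rop X b = eps X (tens X 1 b)"

locale ncs_pair =
  A: complex_algebra "scA X" +
  tensor_opposite "scD X" "scT X" "ncs_B X" "tens X" +
  eps: Vector_Spaces.linear "scT X" "scA X" "eps X" +
  E: Vector_Spaces.linear "scA X" "scD X" "EE X" +
  F: Vector_Spaces.linear "scA X" "scD X" "FF X"
  for X :: "('a::{ring, monoid_mult}, 'd::{ring, monoid_mult}, 't::{ring, monoid_mult}) ncs" +
  assumes eps_mult: "eps X (s * t) = eps X s * eps X t"
    and eps_one: "eps X 1 = 1"
    and eps_inj_left: "inj_on (eps X) {tens X b 1 | b. b \<in> ncs_B X}"
    and eps_inj_right: "inj_on (eps X) {tens X 1 b | b. b \<in> ncs_B X}"
    and E_range: "EE X Y \<in> ncs_B X"
    and E_one: "EE X 1 = 1"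
    and F_one: "FF X 1 = 1"
    and E_bimodule: "\<lbrakk>b1 \<in> ncs_B X; b2 \<in> ncs_B X\<rbrakk> \<Longrightarrow>
            EE X (Lop X b1 * Rop X b2 * Y) = b1 * EE X Y * b2"
    and E_right: "b \<in> ncs_B X \<Longrightarrow> EE X (Y * Lop X b) = EE X (Y * Rop X b)"
    and F_bimodule: "\<lbrakk>b1 \<in> ncs_B X; b2 \<in> ncs_B X\<rbrakk> \<Longrightarrow>
            FF X (Lop X b1 * Rop X b2 * Y) = b1 * FF X Y * b2"
    and F_right: "b \<in> ncs_B X \<Longrightarrow> FF X (Y * Lop X b) = FF X (Y * Rop X b)"

datatype side = Lft | Rgt

definition side_op :: "('a, 'd::monoid_mult, 't) ncs \<Rightarrow> side \<Rightarrow> 'd \<Rightarrow> 'a" where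
  "side_op X s b = (case s of Lft \<Rightarrow> Lop X b | Rgt \<Rightarrow> Rop X b)"

definition face :: "('a::times, 'd::monoid_mult, 't) ncs \<Rightarrow> side \<Rightarrow> 'a set" where
  "face X s = (case s of
      Lft \<Rightarrow> {Y. \<forall>b\<in>ncs_B X. Y * Rop X b = Rop X b * Y}
    | Rgt \<Rightarrow> {Y. \<forall>b\<in>ncs_B X. Y * Lop X b = Lop X b * Y})"


section \<open>Bi-non-crossing partitions\<close>

text \<open>Index sets are arbitrary finite sets \<open>S\<close> of natural numbers instead of \<open>{1..n}\<close> only. Hence
  restricting to \<open>V \<subseteq> S\<close> means replacing \<open>S\<close> by \<open>V\<close> while keeping \<open>\<chi>\<close> and the family \<open>Z\<close>, and no
  relabelling is needed. A partition of \<open>S\<close> is the set of its blocks, so that \<open>1\<^sub>\<chi>\<close> is \<open>{S}\<close>.\<close>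

definition chi_less :: "(nat \<Rightarrow> side) \<Rightarrow> nat \<Rightarrow> nat \<Rightarrow> bool" where
  "chi_less \<chi> i j \<longleftrightarrow>
     (\<chi> i = Lft \<and> \<chi> j = Lft \<and> i < j) \<or> (\<chi> i = Lft \<and> \<chi> j = Rgt) \<or>
     (\<chi> i = Rgt \<and> \<chi> j = Rgt \<and> j < i)"

definition chi_min :: "(nat \<Rightarrow> side) \<Rightarrow> nat set \<Rightarrow> nat" where
  "chi_min \<chi> U = (THE i. i \<in> U \<and> (\<forall>j\<in>U. j \<noteq> i \<longrightarrow> chi_less \<chi> i j))"

definition chi_max :: "(nat \<Rightarrow> side) \<Rightarrow> nat set \<Rightarrow> nat" where
  "chi_max \<chi> U = (THE i. i \<in> U \<and> (\<forall>j\<in>U. j \<noteq> i \<longrightarrow> chi_less \<chi> j i))"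

definition chi_interval :: "(nat \<Rightarrow> side) \<Rightarrow> nat set \<Rightarrow> nat set \<Rightarrow> bool" where
  "chi_interval \<chi> S U \<longleftrightarrow> U \<subseteq> S \<and>
     (\<forall>a\<in>U. \<forall>c\<in>U. \<forall>b\<in>S. chi_less \<chi> a b \<and> chi_less \<chi> b c \<longrightarrow> b \<in> U)"

definition chi_noncrossing :: "(nat \<Rightarrow> side) \<Rightarrow> nat set set \<Rightarrow> bool" where
  "chi_noncrossing \<chi> \<pi> \<longleftrightarrow>
     \<not> (\<exists>V\<in>\<pi>. \<exists>W\<in>\<pi>. V \<noteq> W \<and> (\<exists>a\<in>V. \<exists>b\<in>W. \<exists>c\<in>V. \<exists>d\<in>W.
          chi_less \<chi> a b \<and> chi_less \<chi> b c \<and> chi_less \<chi> c d))"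

definition BNC :: "(nat \<Rightarrow> side) \<Rightarrow> nat set \<Rightarrow> nat set set set" where
  "BNC \<chi> S = {\<pi>. partition_on S \<pi> \<and> chi_noncrossing \<chi> \<pi>}"

lemma finite_BNC: "finite S \<Longrightarrow> finite (BNC \<chi> S)"
  by (rule finite_subset[OF _ finitely_many_partition_on[of S]]) (auto simp: BNC_def)

text \<open>The Moebius function of the lattice \<open>BNC \<chi> S\<close>.\<close>

function moebius :: "(nat \<Rightarrow> side) \<Rightarrow> nat set \<Rightarrow> nat set set \<Rightarrow> nat set set \<Rightarrow> int" where
  "moebius \<chi> S \<sigma> \<pi> =
     (if \<not> (finite S \<and> \<sigma> \<in> BNC \<chi> S \<and> \<pi> \<in> BNC \<chi> S \<and> refines S \<sigma> \<pi>) then 0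
      else if \<sigma> = \<pi> then 1
      else - (\<Sum>\<tau> | \<tau> \<in> BNC \<chi> S \<and> refines S \<sigma> \<tau> \<and> refines S \<tau> \<pi> \<and> \<tau> \<noteq> \<pi>. moebius \<chi> S \<sigma> \<tau>))"
  by pat_completeness auto
termination
proof (relation "measure (\<lambda>(\<chi>, S, \<sigma>, \<pi>). card {\<tau> \<in> BNC \<chi> S. refines S \<tau> \<pi>})", goal_cases)
  case (2 \<chi> S \<sigma> \<pi> \<tau>)
  have \<tau>: "\<tau> \<in> BNC \<chi> S" "refines S \<tau> \<pi>" "\<tau> \<noteq> \<pi>" and \<pi>: "\<pi> \<in> BNC \<chi> S" and S: "finite S"
    using 2 by simp_all
  have "{\<rho> \<in> BNC \<chi> S. refines S \<rho> \<tau>} \<subseteq> {\<rho> \<in> BNC \<chi> S. refines S \<rho> \<pi>}"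
    using refines_trans[OF _ \<tau>(2)] by blast
  moreover have "refines S \<pi> \<pi>"
    using \<pi> by (intro refines_refl) (simp add: BNC_def)
  moreover have "\<not> refines S \<pi> \<tau>"
    using refines_asym[OF \<tau>(2)] \<tau>(3) by blast
  ultimately have "{\<rho> \<in> BNC \<chi> S. refines S \<rho> \<tau>} \<subset> {\<rho> \<in> BNC \<chi> S. refines S \<rho> \<pi>}"
    using \<pi> by blast
  then have "card {\<rho> \<in> BNC \<chi> S. refines S \<rho> \<tau>} < card {\<rho> \<in> BNC \<chi> S. refines S \<rho> \<pi>}"
    by (rule psubset_card_mono[rotated]) (simp add: finite_BNC S)
  then show ?case by simp
qed auto

declare moebius.simps [simp del]


section \<open>Bi-free moments and cumulants\<close>

definition oprod :: "(nat \<Rightarrow> 'a::monoid_mult) \<Rightarrow> nat set \<Rightarrow> 'a" where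
  "oprod Z S = prod_list (map Z (sorted_list_of_set S))"

definition block_of :: "nat set set \<Rightarrow> nat \<Rightarrow> nat set" where
  "block_of \<pi> i = (THE V. V \<in> \<pi> \<and> i \<in> V)"

definition last_block :: "nat set set \<Rightarrow> nat set" where
  "last_block \<pi> = arg_max_on Min \<pi>"

lemma last_block_in:
  assumes "finite \<pi>" "\<pi> \<noteq> {}"
  shows "last_block \<pi> \<in> \<pi>"
proof -
  obtain V where "V \<in> \<pi>" using assms by blast
  then show ?thesis
    using arg_max_nat_lemma[of "\<lambda>V. V \<in> \<pi>" V Min "Suc (Max (Min ` \<pi>))"] assms(1)
    unfolding last_block_def arg_max_on_def
    by (auto simp: less_Suc_eq_le)
qed

lemma last_block_shrinks:
  assumes "finite S" "partition_on S \<pi>" "\<rho> \<subseteq> \<pi>" "\<rho> \<noteq> {}"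
  shows "card (S - last_block \<rho>) < card S"
proof -
  have "finite \<rho>"
    using assms finite_elements[of S \<pi>] finite_subset by blast
  then have "last_block \<rho> \<in> \<pi>"
    using last_block_in[of \<rho>] assms by blast
  then have "last_block \<rho> \<subseteq> S" "last_block \<rho> \<noteq> {}"
    using assms(2) by (auto simp: partition_on_def)
  then show ?thesis
    using assms(1) by (intro psubset_card_mono) auto
qed

text \<open>\<open>moment\<close>, \<open>cumulant\<close> and \<open>ccumulant\<close> are \<open>\<E>\<^sub>\<pi>\<close>, \<open>\<kappa>\<^sub>\<pi>\<close> and \<open>\<K>\<^sub>\<pi>\<close>.
  Outside the domain given by the first test (which the recursion never leaves) the value of
  \<open>moment\<close> is irrelevant; the same applies to \<open>ccumulant\<close> below. In the second branch the block
  \<open>V\<close> consists of all indices from \<open>m\<close> on, and the index preceding \<open>m\<close> absorbs \<open>b\<close>.\<close>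

function moment :: "('a::monoid_mult, 'd::{zero, monoid_mult}, 't) ncs \<Rightarrow> (nat \<Rightarrow> side) \<Rightarrow>
    nat set \<Rightarrow> (nat \<Rightarrow> 'a) \<Rightarrow> nat set set \<Rightarrow> 'd" where
  "moment X \<chi> S Z \<pi> =
     (if \<not> (finite S \<and> S \<noteq> {} \<and> \<pi> \<in> BNC \<chi> S) then 0
      else if \<pi> = {S} then EE X (oprod Z S)
      else let V = last_block \<pi>; m = Min V; b = EE X (oprod Z V); T = side_op X (\<chi> m) b in
        if V = {i \<in> S. m \<le> i} then
          (let p = Max {i \<in> S. i < m} in moment X \<chi> (S - V) (Z(p := Z p * T)) (\<pi> - {V}))
        else
          (let J = {i \<in> S. m < i} - V;
               W = block_of \<pi> (case \<chi> m of Lft \<Rightarrow> chi_min \<chi> J | Rgt \<Rightarrow> chi_max \<chi> J);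
               k = Min {i \<in> W. m < i}
           in moment X \<chi> (S - V) (Z(k := T * Z k)) (\<pi> - {V})))"
  by pat_completeness auto
termination
proof (relation "measure (\<lambda>(X, \<chi>, S, Z, \<pi>). card S)", goal_cases)
  case (2 X \<chi> S Z \<pi> V)
  have dom: "finite S" "S \<noteq> {}" "\<pi> \<in> BNC \<chi> S" and V: "V = last_block \<pi>"
    using 2(1,3) by blast+
  then have "partition_on S \<pi>" "\<pi> \<noteq> {}" by (auto simp: BNC_def partition_on_def)
  then have "card (S - V) < card S"
    unfolding V using dom by (intro last_block_shrinks) auto
  then show ?case by simp
next
  case (3 X \<chi> S Z \<pi> V)
  have dom: "finite S" "S \<noteq> {}" "\<pi> \<in> BNC \<chi> S" and V: "V = last_block \<pi>"
    using 3(1,3) by blast+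
  then have "partition_on S \<pi>" "\<pi> \<noteq> {}" by (auto simp: BNC_def partition_on_def)
  then have "card (S - V) < card S"
    unfolding V using dom by (intro last_block_shrinks) auto
  then show ?case by simp
qed auto

declare moment.simps [simp del]

definition cumulant :: "('a::monoid_mult, 'd::{comm_monoid_add, monoid_mult}, 't) ncs \<Rightarrow>
    (nat \<Rightarrow> side) \<Rightarrow> nat set \<Rightarrow> (nat \<Rightarrow> 'a) \<Rightarrow> nat set set \<Rightarrow> 'd" where
  "cumulant X \<chi> S Z \<pi> =
     (\<Sum>\<sigma> | \<sigma> \<in> BNC \<chi> S \<and> refines S \<sigma> \<pi>.
        scD X (of_int (moebius \<chi> S \<sigma> \<pi>)) (moment X \<chi> S Z \<sigma>))"


section \<open>Conditionally bi-free cumulants\<close>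

definition is_outer_decomp ::
    "(nat \<Rightarrow> side) \<Rightarrow> nat set \<Rightarrow> nat set set \<Rightarrow> nat set list \<Rightarrow> bool" where
  "is_outer_decomp \<chi> S \<pi> Us \<longleftrightarrow>
     partition_on S (set Us) \<and>
     sorted_wrt (\<lambda>U U'. \<forall>x\<in>U. \<forall>y\<in>U'. chi_less \<chi> x y) Us \<and>
     (\<forall>U\<in>set Us. chi_interval \<chi> S U \<and> (\<exists>\<rho>\<subseteq>\<pi>. U = \<Union>\<rho>) \<and>
        (\<exists>W\<in>\<pi>. chi_min \<chi> U \<in> W \<and> chi_max \<chi> U \<in> W))"

definition outer_decomp :: "(nat \<Rightarrow> side) \<Rightarrow> nat set \<Rightarrow> nat set set \<Rightarrow> nat set list" where
  "outer_decomp \<chi> S \<pi> = (THE Us. is_outer_decomp \<chi> S \<pi> Us)"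

lemma chi_less_irrefl [simp]: "\<not> chi_less \<chi> i i"
  by (auto simp: chi_less_def)

lemma chi_less_trans: "chi_less \<chi> i j \<Longrightarrow> chi_less \<chi> j k \<Longrightarrow> chi_less \<chi> i k"
  by (auto simp: chi_less_def)

lemma chi_less_total: "i \<noteq> j \<Longrightarrow> chi_less \<chi> i j \<or> chi_less \<chi> j i"
  by (cases "\<chi> i"; cases "\<chi> j") (auto simp: chi_less_def)

lemma chi_less_asym: "chi_less \<chi> i j \<Longrightarrow> \<not> chi_less \<chi> j i"
  by (auto simp: chi_less_def)

lemma chi_min_eqI: "i \<in> U \<Longrightarrow> (\<And>j. j \<in> U \<Longrightarrow> j \<noteq> i \<Longrightarrow> chi_less \<chi> i j) \<Longrightarrow> chi_min \<chi> U = i"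
  unfolding chi_min_def by (rule the_equality) (simp, metis chi_less_asym)

lemma chi_max_eqI: "i \<in> U \<Longrightarrow> (\<And>j. j \<in> U \<Longrightarrow> j \<noteq> i \<Longrightarrow> chi_less \<chi> j i) \<Longrightarrow> chi_max \<chi> U = i"
  unfolding chi_max_def by (rule the_equality) (simp, metis chi_less_asym)

lemma chi_min_ex:
  "finite U \<Longrightarrow> U \<noteq> {} \<Longrightarrow> \<exists>i\<in>U. \<forall>j\<in>U. j \<noteq> i \<longrightarrow> chi_less \<chi> i j"
proof (induction U rule: finite_ne_induct)
  case (insert x U)
  then obtain i where i: "i \<in> U" "\<forall>j\<in>U. j \<noteq> i \<longrightarrow> chi_less \<chi> i j" by blast
  have "x \<noteq> i" using i insert by auto
  then consider "chi_less \<chi> x i" | "chi_less \<chi> i x" using chi_less_total[of x i \<chi>] by blast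
  then show ?case
  proof cases
    case 1
    then have "\<forall>j\<in>insert x U. j \<noteq> x \<longrightarrow> chi_less \<chi> x j"
      using i by (metis chi_less_trans insert_iff)
    then show ?thesis by blast
  next
    case 2
    then show ?thesis using i by blast
  qed
qed auto

lemma chi_max_ex:
  "finite U \<Longrightarrow> U \<noteq> {} \<Longrightarrow> \<exists>i\<in>U. \<forall>j\<in>U. j \<noteq> i \<longrightarrow> chi_less \<chi> j i"
proof (induction U rule: finite_ne_induct)
  case (insert x U)
  then obtain i where i: "i \<in> U" "\<forall>j\<in>U. j \<noteq> i \<longrightarrow> chi_less \<chi> j i" by blast
  have "x \<noteq> i" using i insert by auto
  then consider "chi_less \<chi> i x" | "chi_less \<chi> x i" using chi_less_total[of x i \<chi>] by blast
  then show ?case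
  proof cases
    case 1
    then have "\<forall>j\<in>insert x U. j \<noteq> x \<longrightarrow> chi_less \<chi> j x"
      using i by (metis chi_less_trans insert_iff)
    then show ?thesis by blast
  next
    case 2
    then show ?thesis using i by blast
  qed
qed auto

lemma
  assumes "finite U" "U \<noteq> {}"
  shows chi_min_in: "chi_min \<chi> U \<in> U"
    and chi_min_less: "j \<in> U \<Longrightarrow> j \<noteq> chi_min \<chi> U \<Longrightarrow> chi_less \<chi> (chi_min \<chi> U) j"
    and chi_max_in: "chi_max \<chi> U \<in> U"
    and chi_max_greater: "j \<in> U \<Longrightarrow> j \<noteq> chi_max \<chi> U \<Longrightarrow> chi_less \<chi> j (chi_max \<chi> U)"
proof -
  obtain i where i: "i \<in> U" "\<forall>j\<in>U. j \<noteq> i \<longrightarrow> chi_less \<chi> i j"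
    using chi_min_ex[OF assms] by blast
  then have "chi_min \<chi> U = i" by (intro chi_min_eqI) auto
  with i show "chi_min \<chi> U \<in> U" "j \<in> U \<Longrightarrow> j \<noteq> chi_min \<chi> U \<Longrightarrow> chi_less \<chi> (chi_min \<chi> U) j"
    by auto
  obtain k where k: "k \<in> U" "\<forall>j\<in>U. j \<noteq> k \<longrightarrow> chi_less \<chi> j k"
    using chi_max_ex[OF assms] by blast
  then have "chi_max \<chi> U = k" by (intro chi_max_eqI) auto
  with k show "chi_max \<chi> U \<in> U" "j \<in> U \<Longrightarrow> j \<noteq> chi_max \<chi> U \<Longrightarrow> chi_less \<chi> j (chi_max \<chi> U)"
    by auto
qed

lemma chi_noncrossingD:
  assumes "chi_noncrossing \<chi> \<pi>" "V \<in> \<pi>" "W \<in> \<pi>" "a \<in> V" "b \<in> W" "c \<in> V" "d \<in> W"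
    "chi_less \<chi> a b" "chi_less \<chi> b c" "chi_less \<chi> c d"
  shows "V = W"
proof (rule ccontr)
  assume neq: "V \<noteq> W"
  have "\<exists>V\<in>\<pi>. \<exists>W\<in>\<pi>. V \<noteq> W \<and> (\<exists>a\<in>V. \<exists>b\<in>W. \<exists>c\<in>V. \<exists>d\<in>W.
      chi_less \<chi> a b \<and> chi_less \<chi> b c \<and> chi_less \<chi> c d)"
    by (rule bexI[of _ V], rule bexI[of _ W], rule conjI, rule neq, rule bexI[of _ a],
        rule bexI[of _ b], rule bexI[of _ c], rule bexI[of _ d],
        simp_all only: assms simp_thms)
  then show False using assms(1) unfolding chi_noncrossing_def by (rule notE[rotated])
qed

lemma chi_noncrossing_subset:
  assumes "chi_noncrossing \<chi> \<pi>" "\<rho> \<subseteq> \<pi>"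
  shows "chi_noncrossing \<chi> \<rho>"
  unfolding chi_noncrossing_def
proof (intro notI, elim bexE conjE)
  fix V W a b c d
  assume *: "V \<in> \<rho>" "W \<in> \<rho>" "a \<in> V" "b \<in> W" "c \<in> V" "d \<in> W"
    "chi_less \<chi> a b" "chi_less \<chi> b c" "chi_less \<chi> c d" and "V \<noteq> W"
  have "V \<in> \<pi>" "W \<in> \<pi>" using * assms(2) by auto
  from chi_noncrossingD[OF assms(1) this *(3-9)] \<open>V \<noteq> W\<close> show False by simp
qed

text \<open>The first member of the decomposition is the \<open>\<chi>\<close>-interval from the \<open>\<chi>\<close>-minimum \<open>a\<close> of \<open>S\<close> to
  the \<open>\<chi>\<close>-maximum of the block of \<open>a\<close>.\<close>

lemma is_outer_decomp_ex1:
  "finite S \<Longrightarrow> \<pi> \<in> BNC \<chi> S \<Longrightarrow> \<exists>!Us. is_outer_decomp \<chi> S \<pi> Us"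
proof (induction "card S" arbitrary: S \<pi> rule: less_induct)
  case less
  show ?case
  proof (cases "S = {}")
    case True
    then show ?thesis
      by (intro ex1I[of _ "[]"]) (auto simp: is_outer_decomp_def partition_on_empty)
  next
    case False
    have part: "partition_on S \<pi>" and nc: "chi_noncrossing \<chi> \<pi>"
      using less.prems by (auto simp: BNC_def)
    define a where "a = chi_min \<chi> S"
    have aS: "a \<in> S" and a_less: "\<And>j. j \<in> S \<Longrightarrow> j \<noteq> a \<Longrightarrow> chi_less \<chi> a j"
      unfolding a_def using chi_min_in[of S] chi_min_less[of S] less.prems False by auto
    obtain W where W: "W \<in> \<pi>" "a \<in> W" using part aS by (auto simp: partition_on_def)
    have WS: "W \<subseteq> S" using part W by (auto simp: partition_on_def)
    have finW: "finite W" "W \<noteq> {}" using WS W less.prems finite_subset by auto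
    define M where "M = chi_max \<chi> W"
    have MW: "M \<in> W" and M_gr: "\<And>j. j \<in> W \<Longrightarrow> j \<noteq> M \<Longrightarrow> chi_less \<chi> j M"
      unfolding M_def using chi_max_in[of W] chi_max_greater[of W] finW by auto
    define U where "U = {x \<in> S. \<not> chi_less \<chi> M x}"
    have WU: "W \<subseteq> U"
    proof
      fix x assume "x \<in> W"
      then show "x \<in> U"
        using WS M_gr[of x] chi_less_asym[of \<chi> x M] unfolding U_def by (cases "x = M") auto
    qed
    have aU: "a \<in> U" "M \<in> U" using WU W MW by auto
    have U_up: "chi_less \<chi> x y" if "x \<in> U" "y \<in> S - U" for x y
      using that chi_less_trans[of \<chi> x M y] chi_less_total[of x M \<chi>] unfolding U_def by auto
    have disj: "V = V'" if "V \<in> \<pi>" "V' \<in> \<pi>" "x \<in> V" "x \<in> V'" for V V' x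
      using part that by (auto simp: partition_on_def disjoint_def)
    have sat: "V \<subseteq> U \<or> V \<subseteq> S - U" if V: "V \<in> \<pi>" for V
    proof (rule ccontr)
      assume neg: "\<not> ?thesis"
      have VS: "V \<subseteq> S" using part V by (auto simp: partition_on_def)
      then obtain x y where xy: "x \<in> V" "x \<in> U" "y \<in> V" "y \<in> S - U" using neg by blast
      have "V \<noteq> W" using xy WU by auto
      then have "x \<noteq> a" "x \<noteq> M" using disj[OF V W(1), of x] W MW xy by auto
      then have "chi_less \<chi> a x" "chi_less \<chi> x M"
        using a_less[of x] xy chi_less_total[of x M \<chi>] unfolding U_def by auto
      moreover have "chi_less \<chi> M y" using U_up[of M y] aU xy by blast
      ultimately show False
        using chi_noncrossingD[OF nc W(1) V W(2) xy(1) MW xy(3)] \<open>V \<noteq> W\<close> by blast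
    qed
    define \<pi>' where "\<pi>' = {V \<in> \<pi>. V \<subseteq> S - U}"
    have part': "partition_on (S - U) \<pi>'"
    proof (rule partition_onI)
      show "\<Union> \<pi>' = S - U"
      proof (intro equalityI subsetI)
        fix x assume x: "x \<in> S - U"
        then obtain V where "V \<in> \<pi>" "x \<in> V" using part by (auto simp: partition_on_def)
        then show "x \<in> \<Union> \<pi>'" using sat[of V] x unfolding \<pi>'_def by auto
      qed (auto simp: \<pi>'_def)
      show "disjnt p q" if "p \<in> \<pi>'" "q \<in> \<pi>'" "p \<noteq> q" for p q
        using that disj[of p q] unfolding \<pi>'_def disjnt_def by auto
      show "{} \<notin> \<pi>'" using part by (auto simp: \<pi>'_def partition_on_def)
    qed
    have bnc': "\<pi>' \<in> BNC \<chi> (S - U)"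
      using part' chi_noncrossing_subset[OF nc, of \<pi>'] unfolding BNC_def \<pi>'_def by auto
    have "card (S - U) < card S" using aS aU less.prems by (intro psubset_card_mono) auto
    then have ex1: "\<exists>!Us. is_outer_decomp \<chi> (S - U) \<pi>' Us"
      using less.hyps[of "S - U" \<pi>'] bnc' less.prems by auto
    have minU: "chi_min \<chi> U = a" using aU a_less U_def by (intro chi_min_eqI) auto
    have maxU: "chi_max \<chi> U = M" using aU chi_less_total[of _ M \<chi>] U_def by (intro chi_max_eqI) auto
    have U_Union: "U = \<Union>{V \<in> \<pi>. V \<subseteq> U}"
    proof -
      have "x \<in> \<Union>{V \<in> \<pi>. V \<subseteq> U}" if "x \<in> U" for x
      proof -
        have "x \<in> S" using that U_def by auto
        then obtain V where "V \<in> \<pi>" "x \<in> V" using part by (auto simp: partition_on_def)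
        then show ?thesis using sat[of V] that by blast
      qed
      then show ?thesis by (intro equalityI subsetI) (assumption, blast)
    qed
    have US: "U \<subseteq> S" by (auto simp: U_def)
    have step: "is_outer_decomp \<chi> S \<pi> (U # Us) \<longleftrightarrow> is_outer_decomp \<chi> (S - U) \<pi>' Us" for Us
    proof
      assume dec: "is_outer_decomp \<chi> S \<pi> (U # Us)"
      have srt: "\<And>U' x y. U' \<in> set Us \<Longrightarrow> x \<in> U \<Longrightarrow> y \<in> U' \<Longrightarrow> chi_less \<chi> x y"
        using dec by (auto simp: is_outer_decomp_def)
      have dj: "U' \<inter> U = {}" if "U' \<in> set Us" for U'
        using srt[OF that] by (meson chi_less_irrefl disjoint_iff)
      have p: "partition_on S (insert U (set Us))" using dec by (auto simp: is_outer_decomp_def)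
      have "partition_on (S - U) (set Us)"
        unfolding partition_on_def
      proof (intro conjI)
        show "\<Union> (set Us) = S - U" using p dj unfolding partition_on_def by auto
        show "disjoint (set Us)" using p unfolding partition_on_def disjoint_def by blast
        show "{} \<notin> set Us" using p unfolding partition_on_def by blast
      qed
      moreover have "chi_interval \<chi> (S - U) U' \<and> (\<exists>\<rho>\<subseteq>\<pi>'. U' = \<Union>\<rho>) \<and>
          (\<exists>W\<in>\<pi>'. chi_min \<chi> U' \<in> W \<and> chi_max \<chi> U' \<in> W)" if U': "U' \<in> set Us" for U'
      proof (intro conjI)
        have sub: "U' \<subseteq> S - U" using dj[OF U'] p U' by (auto simp: partition_on_def)
        have old: "chi_interval \<chi> S U'" "\<exists>\<rho>\<subseteq>\<pi>. U' = \<Union>\<rho>"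
            "\<exists>W\<in>\<pi>. chi_min \<chi> U' \<in> W \<and> chi_max \<chi> U' \<in> W"
          using dec U' by (auto simp: is_outer_decomp_def)
        show "chi_interval \<chi> (S - U) U'"
          using old(1) sub unfolding chi_interval_def by blast
        obtain \<rho> where \<rho>: "\<rho> \<subseteq> \<pi>" "U' = \<Union>\<rho>" using old(2) by blast
        then have "\<rho> \<subseteq> \<pi>'" using sub unfolding \<pi>'_def by blast
        then show "\<exists>\<rho>\<subseteq>\<pi>'. U' = \<Union>\<rho>" using \<rho> by blast
        obtain W' where W': "W' \<in> \<pi>" "chi_min \<chi> U' \<in> W'" "chi_max \<chi> U' \<in> W'" using old(3) by blast
        have "finite U'" "U' \<noteq> {}" using sub less.prems finite_subset p U'
          by (auto simp: partition_on_def)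
        then have "chi_min \<chi> U' \<in> S - U" using chi_min_in sub by blast
        then have "W' \<in> \<pi>'" using W' sat[of W'] unfolding \<pi>'_def by blast
        then show "\<exists>W\<in>\<pi>'. chi_min \<chi> U' \<in> W \<and> chi_max \<chi> U' \<in> W" using W' by blast
      qed
      ultimately show "is_outer_decomp \<chi> (S - U) \<pi>' Us"
        using dec by (auto simp: is_outer_decomp_def)
    next
      assume dec: "is_outer_decomp \<chi> (S - U) \<pi>' Us"
      have p: "partition_on (S - U) (set Us)" using dec by (auto simp: is_outer_decomp_def)
      have sub: "U' \<subseteq> S - U" if "U' \<in> set Us" for U'
        using p that by (auto simp: partition_on_def)
      have "partition_on S (set (U # Us))"
        unfolding partition_on_def
      proof (intro conjI)
        show "\<Union> (set (U # Us)) = S" using p US unfolding partition_on_def by auto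
        show "{} \<notin> set (U # Us)" using p aU unfolding partition_on_def by auto
        have "U \<inter> U' = {}" if "U' \<in> set Us" for U' using sub[OF that] by blast
        then show "disjoint (set (U # Us))"
          using p unfolding partition_on_def disjoint_def by (auto simp: Int_commute)
      qed
      moreover have "sorted_wrt (\<lambda>U U'. \<forall>x\<in>U. \<forall>y\<in>U'. chi_less \<chi> x y) (U # Us)"
        using dec sub U_up unfolding is_outer_decomp_def sorted_wrt.simps by blast
      moreover have "chi_interval \<chi> S U"
        unfolding chi_interval_def
      proof (intro conjI ballI impI)
        fix x z y assume "x \<in> U" "z \<in> U" "y \<in> S" "chi_less \<chi> x y \<and> chi_less \<chi> y z"
        then show "y \<in> U" using U_up[of z y] chi_less_asym[of \<chi> y z] by auto
      qed (rule US)
      moreover have "\<exists>\<rho>\<subseteq>\<pi>. U = \<Union>\<rho>"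
        by (rule exI[of _ "{V \<in> \<pi>. V \<subseteq> U}"]) (rule conjI[OF _ U_Union], blast)
      moreover have "\<exists>W\<in>\<pi>. chi_min \<chi> U \<in> W \<and> chi_max \<chi> U \<in> W" using minU maxU W MW by metis
      moreover have "chi_interval \<chi> S U' \<and> (\<exists>\<rho>\<subseteq>\<pi>. U' = \<Union>\<rho>) \<and>
          (\<exists>W\<in>\<pi>. chi_min \<chi> U' \<in> W \<and> chi_max \<chi> U' \<in> W)" if U': "U' \<in> set Us" for U'
      proof (intro conjI)
        have old: "chi_interval \<chi> (S - U) U'" "\<exists>\<rho>\<subseteq>\<pi>'. U' = \<Union>\<rho>"
            "\<exists>W\<in>\<pi>'. chi_min \<chi> U' \<in> W \<and> chi_max \<chi> U' \<in> W"
          using dec U' by (auto simp: is_outer_decomp_def)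
        show "chi_interval \<chi> S U'"
          unfolding chi_interval_def
        proof (intro conjI ballI impI)
          fix x z y
          assume as: "x \<in> U'" "z \<in> U'" "y \<in> S" "chi_less \<chi> x y \<and> chi_less \<chi> y z"
          have "y \<notin> U" using U_up[of y x] as sub[OF U'] chi_less_asym[of \<chi> x y] by blast
          then show "y \<in> U'" using old(1) as unfolding chi_interval_def by blast
        qed (use sub[OF U'] in auto)
        show "\<exists>\<rho>\<subseteq>\<pi>. U' = \<Union>\<rho>" using old(2) unfolding \<pi>'_def by blast
        show "\<exists>W\<in>\<pi>. chi_min \<chi> U' \<in> W \<and> chi_max \<chi> U' \<in> W" using old(3) unfolding \<pi>'_def by blast
      qed
      ultimately show "is_outer_decomp \<chi> S \<pi> (U # Us)"
        by (simp add: is_outer_decomp_def)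
    qed
    have head: "\<exists>Us'. Us = U # Us'" if dec: "is_outer_decomp \<chi> S \<pi> Us" for Us
    proof -
      have p: "partition_on S (set Us)" using dec by (auto simp: is_outer_decomp_def)
      then obtain U1 Us' where Us: "Us = U1 # Us'"
        using False by (cases Us) (auto simp: partition_on_def)
      have srt: "\<And>U' x y. U' \<in> set Us' \<Longrightarrow> x \<in> U1 \<Longrightarrow> y \<in> U' \<Longrightarrow> chi_less \<chi> x y"
        using dec Us by (auto simp: is_outer_decomp_def)
      have U1: "U1 \<subseteq> S" "U1 \<noteq> {}" using p Us by (auto simp: partition_on_def)
      have fin1: "finite U1" using U1 less.prems finite_subset by blast
      have a1: "a \<in> U1"
      proof (rule ccontr)
        assume "a \<notin> U1"
        moreover have "a \<in> \<Union> (set Us)" using p aS by (auto simp: partition_on_def)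
        ultimately obtain U' where "U' \<in> set Us'" "a \<in> U'" using Us by auto
        moreover obtain x where "x \<in> U1" using U1 by blast
        ultimately have "chi_less \<chi> x a" using srt by blast
        moreover have "x \<in> S" "x \<noteq> a" using U1 \<open>x \<in> U1\<close> \<open>a \<notin> U1\<close> by auto
        ultimately show False using a_less[of x] chi_less_asym[of \<chi> x a] by blast
      qed
      have min1: "chi_min \<chi> U1 = a" using a1 a_less U1 by (intro chi_min_eqI) auto
      have int1: "chi_interval \<chi> S U1" and un1: "\<exists>\<rho>\<subseteq>\<pi>. U1 = \<Union>\<rho>"
        and blk1: "\<exists>W\<in>\<pi>. chi_min \<chi> U1 \<in> W \<and> chi_max \<chi> U1 \<in> W"
        using dec Us by (auto simp: is_outer_decomp_def)
      have max1W: "chi_max \<chi> U1 \<in> W" using blk1 min1 disj W by metis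
      have W1: "W \<subseteq> U1" using un1 a1 W disj by blast
      have max1: "chi_max \<chi> U1 = M"
        using chi_max_greater[OF fin1 U1(2), of M \<chi>] M_gr[OF max1W] W1 MW
          chi_less_asym[of \<chi> M "chi_max \<chi> U1"] by blast
      have "U1 = U"
      proof
        show "U1 \<subseteq> U"
        proof
          fix x assume "x \<in> U1"
          then show "x \<in> U"
            using chi_max_greater[OF fin1 U1(2), of x \<chi>] max1 U1 chi_less_asym[of \<chi> x M]
            unfolding U_def by (cases "x = M") auto
        qed
        show "U \<subseteq> U1"
        proof
          fix x assume x: "x \<in> U"
          show "x \<in> U1"
          proof (cases "x = a \<or> x = M")
            case True
            then show ?thesis using a1 W1 MW by blast
          next
            case False
            then have "chi_less \<chi> a x" "chi_less \<chi> x M"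
              using x a_less[of x] chi_less_total[of x M \<chi>] unfolding U_def by auto
            then show ?thesis using int1 a1 W1 MW x US unfolding chi_interval_def by blast
          qed
        qed
      qed
      then show ?thesis using Us by blast
    qed
    show ?thesis using ex1 step head by metis
  qed
qed

lemma outer_decomp_is_outer_decomp:
  "finite S \<Longrightarrow> \<pi> \<in> BNC \<chi> S \<Longrightarrow> is_outer_decomp \<chi> S \<pi> (outer_decomp \<chi> S \<pi>)"
  unfolding outer_decomp_def by (rule theI') (rule is_outer_decomp_ex1)

lemma outer_decomp_shrinks:
  assumes "finite S" "\<pi> \<in> BNC \<chi> S" "length (outer_decomp \<chi> S \<pi>) \<noteq> 1" "U \<in> set (outer_decomp \<chi> S \<pi>)"
  shows "card U < card S"
proof -
  let ?Us = "outer_decomp \<chi> S \<pi>"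
  have dec: "is_outer_decomp \<chi> S \<pi> ?Us" using assms outer_decomp_is_outer_decomp by blast
  have p: "partition_on S (set ?Us)" using dec by (auto simp: is_outer_decomp_def)
  obtain i where i: "i < length ?Us" "U = ?Us ! i" using assms(4) by (auto simp: in_set_conv_nth)
  define j where "j = (if i = 0 then 1 else 0 :: nat)"
  have j: "j < length ?Us" "j \<noteq> i" using i assms(3) by (auto simp: j_def)
  have srt: "\<forall>x \<in> ?Us ! k. \<forall>y \<in> ?Us ! l. chi_less \<chi> x y" if "k < l" "l < length ?Us" for k l
    using dec that unfolding is_outer_decomp_def by (auto simp: sorted_wrt_iff_nth_less)
  have ne: "?Us ! j \<noteq> {}" "?Us ! j \<subseteq> S" "U \<subseteq> S"
    using p j(1) assms(4) nth_mem[of j ?Us] unfolding partition_on_def by (metis, blast, blast)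
  then obtain y where y: "y \<in> ?Us ! j" by blast
  have "y \<notin> U"
    using srt[of i j] srt[of j i] i j y by (metis chi_less_irrefl nat_neq_iff)
  then show ?thesis using ne y assms(1) by (intro psubset_card_mono) auto
qed

text \<open>In the third branch the decomposition of \<open>S\<close> is trivial, and an inner block is removed. In the
  last branch \<open>{W \<in> \<pi>. W \<subseteq> U}\<close> is the restriction of \<open>\<pi>\<close> to the union of blocks \<open>U\<close>. For a
  one-element set \<open>S\<close> the sum in the second branch is empty.\<close>

function ccumulant :: "('a::monoid_mult, 'd::{ab_group_add, monoid_mult}, 't) ncs \<Rightarrow>
    (nat \<Rightarrow> side) \<Rightarrow> nat set \<Rightarrow> (nat \<Rightarrow> 'a) \<Rightarrow> nat set set \<Rightarrow> 'd" where
  "ccumulant X \<chi> S Z \<pi> =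
     (if \<not> (finite S \<and> S \<noteq> {} \<and> \<pi> \<in> BNC \<chi> S) then 0
      else if \<pi> = {S} then
        FF X (oprod Z S) - (\<Sum>\<sigma>\<in>BNC \<chi> S - {{S}}. ccumulant X \<chi> S Z \<sigma>)
      else if length (outer_decomp \<chi> S \<pi>) = 1 then
        (let V = last_block (\<pi> - {block_of \<pi> (chi_min \<chi> S)});
             p = chi_max \<chi> {j \<in> S. chi_less \<chi> j (chi_min \<chi> V)};
             c = cumulant X \<chi> V Z {V}
         in ccumulant X \<chi> (S - V)
              (Z(p := (case \<chi> p of Lft \<Rightarrow> Z p * Lop X c | Rgt \<Rightarrow> Rop X c * Z p))) (\<pi> - {V}))
      else prod_list (map (\<lambda>U. ccumulant X \<chi> U Z {W \<in> \<pi>. W \<subseteq> U}) (outer_decomp \<chi> S \<pi>)))"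
  by pat_completeness auto
termination
proof (relation "measures [\<lambda>(X, \<chi>, S, Z, \<pi>). card S, \<lambda>(X, \<chi>, S, Z, \<pi>). if \<pi> = {S} then 1 else 0]",
    goal_cases)
  case (3 X \<chi> S Z \<pi> V)
  have dom: "finite S" "S \<noteq> {}" "\<pi> \<in> BNC \<chi> S" "\<pi> \<noteq> {S}"
    and V: "V = last_block (\<pi> - {block_of \<pi> (chi_min \<chi> S)})"
    using 3(1,2,4) by blast+
  then have part: "partition_on S \<pi>" by (simp add: BNC_def)
  have "\<pi> - {block_of \<pi> (chi_min \<chi> S)} \<noteq> {}"
  proof
    assume "\<pi> - {block_of \<pi> (chi_min \<chi> S)} = {}"
    then have "\<pi> = {} \<or> (\<exists>W. \<pi> = {W})" by blast
    then show False using part dom by (auto simp: partition_on_def)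
  qed
  then have "card (S - V) < card S"
    unfolding V using dom part by (intro last_block_shrinks) auto
  then show ?case by simp
next
  case (4 X \<chi> S Z \<pi> U)
  then have "card U < card S" by (intro outer_decomp_shrinks[of S \<pi> \<chi> U]) blast+
  then show ?case by simp
qed auto

declare ccumulant.simps [simp del]

end

theory Submission
  imports Defs
begin

text \<open>
  Seen along the order \<open>\<prec>\<^sub>\<chi>\<close>, the entries behave like elements of \<open>\<B>\<close>-bimodules: \<open>b\<close> acts from the
  left on \<open>Z\<close> by \<open>L\<^sub>b Z\<close> or \<open>Z R\<^sub>b\<close> and from the right by \<open>Z L\<^sub>b\<close> or \<open>R\<^sub>b Z\<close>, according to the side of
  \<open>Z\<close>. Moments and both kinds of cumulants are balanced over \<open>\<B>\<close>: an element of \<open>\<B>\<close> may be moved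
  from the right of an entry to the left of its \<open>\<prec>\<^sub>\<chi>\<close>-successor, and out at both ends. Since
  \<open>L\<^sub>b = L\<^sub>b 1\<close> and \<open>R\<^sub>b = 1 R\<^sub>b\<close>, it suffices to treat an entry \<open>Z\<^sub>q = 1\<close>.

  For such an entry \<open>\<E>\<^sub>\<sigma>\<close> does not change when \<open>q\<close> is isolated from its block. This is an interior
  operator on \<open>\<B>\<N>\<C>(\<chi>)\<close> that moves \<open>1\<^sub>\<chi>\<close>, so the sum of \<open>\<mu>(\<sigma>, 1\<^sub>\<chi>)\<close> over each of its fibres
  is zero, and \<open>\<kappa>\<close> vanishes. For \<open>\<K>\<close> one inducts on the number of entries: in
  \<open>\<F>(Z\<^sub>1 \<cdots> Z\<^sub>n) = \<Sum>\<^sub>\<pi> \<K>\<^sub>\<pi>\<close> the terms with \<open>\<pi> \<noteq> 1\<^sub>\<chi>\<close> in which \<open>{q}\<close> is not a block vanish, and those in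
  which it is a block add up to the same moment with the entry \<open>Z\<^sub>q = 1\<close> left out, which leaves
  \<open>\<K>\<close> of \<open>1\<^sub>\<chi>\<close> equal to zero.
\<close>

section \<open>Balanced functionals\<close>

text \<open>The recursions in the statement are not visibly compatible with these actions.
  \<open>moment\<close> picks blocks by their usual minimum and may multiply an entry by an operator
  of the opposite side, after which the entry can lie outside its face; \<open>ccumulant\<close>
  lets a cumulant act on a predecessor. Both are therefore expressed by one operation,
  \<open>graft\<close>: remove a \<open>chi_less\<close>-interval and let its value act on the
  successor. Balance identifies the two neighbours of the gap, so acting on the predecessor gives
  the same, and removals of disjoint intervals commute. The latter is needed because deleting
  \<open>q\<close> from a block may raise its minimum and so change the order of removal. Values
  that act on entries must lie in \<B>: moments and bi-free cumulants do, while conditional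
  cumulants, which are only \<D>-valued, occur just as factors of products. Since
  \<open>balanced\<close> says nothing about sums of entries, vanishing at a zero entry is also
  derived by moving: the element 0 of \<B> is passed on until it leaves as a factor.\<close>

definition lact :: "('a::times, 'd::monoid_mult, 't) ncs \<Rightarrow> side \<Rightarrow> 'd \<Rightarrow> 'a \<Rightarrow> 'a" where
  "lact X s b z = (case s of Lft \<Rightarrow> Lop X b * z | Rgt \<Rightarrow> z * Rop X b)"

definition ract :: "('a::times, 'd::monoid_mult, 't) ncs \<Rightarrow> side \<Rightarrow> 'a \<Rightarrow> 'd \<Rightarrow> 'a" where
  "ract X s z b = (case s of Lft \<Rightarrow> z * Lop X b | Rgt \<Rightarrow> Rop X b * z)"

definition faces :: "('a::times, 'd::monoid_mult, 't) ncs \<Rightarrow> (nat \<Rightarrow> side) \<Rightarrow> nat set \<Rightarrow> (nat \<Rightarrow> 'a) set" where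
  "faces X \<chi> S = {Z. \<forall>i\<in>S. Z i \<in> face X (\<chi> i)}"

definition is_first :: "(nat \<Rightarrow> side) \<Rightarrow> nat set \<Rightarrow> nat \<Rightarrow> bool" where
  "is_first \<chi> S p \<longleftrightarrow> p \<in> S \<and> (\<forall>x\<in>S. x \<noteq> p \<longrightarrow> chi_less \<chi> p x)"

definition is_last :: "(nat \<Rightarrow> side) \<Rightarrow> nat set \<Rightarrow> nat \<Rightarrow> bool" where
  "is_last \<chi> S p \<longleftrightarrow> p \<in> S \<and> (\<forall>x\<in>S. x \<noteq> p \<longrightarrow> chi_less \<chi> x p)"

definition adjacent :: "(nat \<Rightarrow> side) \<Rightarrow> nat set \<Rightarrow> nat \<Rightarrow> nat \<Rightarrow> bool" where
  "adjacent \<chi> S p p' \<longleftrightarrow> p \<in> S \<and> p' \<in> S \<and> chi_less \<chi> p p' \<and>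
     (\<forall>x\<in>S. \<not> (chi_less \<chi> p x \<and> chi_less \<chi> x p'))"

text \<open>This is the balance condition of a bimodule map on the tensor product over \<B> of the
  faces, taken in the order \<open>chi_less\<close>. The first clause makes entries outside
  \<open>S\<close> irrelevant, so that a family can be kept while blocks are removed. All clauses
  are restricted to \<open>faces\<close>, since \<open>moment\<close> is under control only there.
  For \<open>S = {}\<close> exactly the constant maps qualify.\<close>

definition balanced :: "('a::times, 'd::monoid_mult, 't) ncs \<Rightarrow> (nat \<Rightarrow> side) \<Rightarrow> nat set \<Rightarrow>
    ((nat \<Rightarrow> 'a) \<Rightarrow> 'd) \<Rightarrow> bool" where
  "balanced X \<chi> S \<Phi> \<longleftrightarrow>
     (\<forall>Z\<in>faces X \<chi> S. \<forall>Z'. (\<forall>i\<in>S. Z i = Z' i) \<longrightarrow> \<Phi> Z = \<Phi> Z') \<and>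
     (\<forall>Z\<in>faces X \<chi> S. \<forall>b\<in>ncs_B X. \<forall>p p'. adjacent \<chi> S p p' \<longrightarrow>
        \<Phi> (Z(p := ract X (\<chi> p) (Z p) b)) = \<Phi> (Z(p' := lact X (\<chi> p') b (Z p')))) \<and>
     (\<forall>Z\<in>faces X \<chi> S. \<forall>b\<in>ncs_B X. \<forall>p. is_first \<chi> S p \<longrightarrow>
        \<Phi> (Z(p := lact X (\<chi> p) b (Z p))) = b * \<Phi> Z) \<and>
     (\<forall>Z\<in>faces X \<chi> S. \<forall>b\<in>ncs_B X. \<forall>p. is_last \<chi> S p \<longrightarrow>
        \<Phi> (Z(p := ract X (\<chi> p) (Z p) b)) = \<Phi> Z * b)"

lemma balanced_cong:
  "balanced X \<chi> S \<Phi> \<Longrightarrow> Z \<in> faces X \<chi> S \<Longrightarrow> (\<And>i. i \<in> S \<Longrightarrow> Z i = Z' i) \<Longrightarrow> \<Phi> Z = \<Phi> Z'"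
  unfolding balanced_def by blast

lemma balanced_adjacent:
  "balanced X \<chi> S \<Phi> \<Longrightarrow> Z \<in> faces X \<chi> S \<Longrightarrow> b \<in> ncs_B X \<Longrightarrow> adjacent \<chi> S p p' \<Longrightarrow>
    \<Phi> (Z(p := ract X (\<chi> p) (Z p) b)) = \<Phi> (Z(p' := lact X (\<chi> p') b (Z p')))"
  unfolding balanced_def by blast

lemma balanced_first:
  "balanced X \<chi> S \<Phi> \<Longrightarrow> Z \<in> faces X \<chi> S \<Longrightarrow> b \<in> ncs_B X \<Longrightarrow> is_first \<chi> S p \<Longrightarrow>
    \<Phi> (Z(p := lact X (\<chi> p) b (Z p))) = b * \<Phi> Z"
  unfolding balanced_def by blast

lemma balanced_last:
  "balanced X \<chi> S \<Phi> \<Longrightarrow> Z \<in> faces X \<chi> S \<Longrightarrow> b \<in> ncs_B X \<Longrightarrow> is_last \<chi> S p \<Longrightarrow>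
    \<Phi> (Z(p := ract X (\<chi> p) (Z p) b)) = \<Phi> Z * b"
  unfolding balanced_def by blast

lemma balancedI:
  assumes "\<And>Z Z'. Z \<in> faces X \<chi> S \<Longrightarrow> (\<And>i. i \<in> S \<Longrightarrow> Z i = Z' i) \<Longrightarrow> \<Phi> Z = \<Phi> Z'"
    and "\<And>Z b p p'. Z \<in> faces X \<chi> S \<Longrightarrow> b \<in> ncs_B X \<Longrightarrow> adjacent \<chi> S p p' \<Longrightarrow>
      \<Phi> (Z(p := ract X (\<chi> p) (Z p) b)) = \<Phi> (Z(p' := lact X (\<chi> p') b (Z p')))"
    and "\<And>Z b p. Z \<in> faces X \<chi> S \<Longrightarrow> b \<in> ncs_B X \<Longrightarrow> is_first \<chi> S p \<Longrightarrow>
      \<Phi> (Z(p := lact X (\<chi> p) b (Z p))) = b * \<Phi> Z"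
    and "\<And>Z b p. Z \<in> faces X \<chi> S \<Longrightarrow> b \<in> ncs_B X \<Longrightarrow> is_last \<chi> S p \<Longrightarrow>
      \<Phi> (Z(p := ract X (\<chi> p) (Z p) b)) = \<Phi> Z * b"
  shows "balanced X \<chi> S \<Phi>"
  unfolding balanced_def using assms by blast

text \<open>Every clause of \<open>balanced\<close> also evaluates the functional at families with
  one entry acted upon, so these have to stay in the faces. This is the assumption
  \<open>act\<close>; the module laws behind it are available only inside the locale.\<close>

lemma balanced_eq_on_faces:
  assumes "balanced X \<chi> S \<Psi>" "\<And>Z. Z \<in> faces X \<chi> S \<Longrightarrow> \<Phi> Z = \<Psi> Z"
    and act: "\<And>Z b p. Z \<in> faces X \<chi> S \<Longrightarrow> b \<in> ncs_B X \<Longrightarrow>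
      Z(p := lact X (\<chi> p) b (Z p)) \<in> faces X \<chi> S \<and> Z(p := ract X (\<chi> p) (Z p) b) \<in> faces X \<chi> S"
  shows "balanced X \<chi> S \<Phi>"
proof (rule balancedI)
  fix Z Z' assume Z: "Z \<in> faces X \<chi> S" "\<And>i. i \<in> S \<Longrightarrow> Z i = Z' i"
  then have "Z' \<in> faces X \<chi> S" by (simp add: faces_def)
  then show "\<Phi> Z = \<Phi> Z'" using assms(2) Z balanced_cong[OF assms(1) Z] by simp
qed (simp_all add: assms(2) act balanced_adjacent[OF assms(1)] balanced_first[OF assms(1)]
    balanced_last[OF assms(1)])

lemma facesD: "Z \<in> faces X \<chi> S \<Longrightarrow> i \<in> S \<Longrightarrow> Z i \<in> face X (\<chi> i)"
  by (simp add: faces_def)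

lemma faces_mono: "Z \<in> faces X \<chi> S \<Longrightarrow> T \<subseteq> S \<Longrightarrow> Z \<in> faces X \<chi> T"
  by (auto simp: faces_def)

lemma faces_upd: "Z \<in> faces X \<chi> S \<Longrightarrow> (p \<in> S \<Longrightarrow> z \<in> face X (\<chi> p)) \<Longrightarrow> Z(p := z) \<in> faces X \<chi> S"
  by (auto simp: faces_def)

lemma is_first_chi_min: "is_first \<chi> S p \<Longrightarrow> chi_min \<chi> S = p"
  unfolding is_first_def by (intro chi_min_eqI) auto

lemma is_last_chi_max: "is_last \<chi> S p \<Longrightarrow> chi_max \<chi> S = p"
  unfolding is_last_def by (intro chi_max_eqI) auto

lemma chi_min_is_first: "finite S \<Longrightarrow> S \<noteq> {} \<Longrightarrow> is_first \<chi> S (chi_min \<chi> S)"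
  unfolding is_first_def by (simp add: chi_min_in chi_min_less)

lemma chi_max_is_last: "finite S \<Longrightarrow> S \<noteq> {} \<Longrightarrow> is_last \<chi> S (chi_max \<chi> S)"
  unfolding is_last_def by (simp add: chi_max_in chi_max_greater)

lemma adjacent_subset:
  "adjacent \<chi> S p p' \<Longrightarrow> T \<subseteq> S \<Longrightarrow> p \<in> T \<Longrightarrow> p' \<in> T \<Longrightarrow> adjacent \<chi> T p p'"
  by (auto simp: adjacent_def)

lemma is_first_subset: "is_first \<chi> S p \<Longrightarrow> T \<subseteq> S \<Longrightarrow> p \<in> T \<Longrightarrow> is_first \<chi> T p"
  by (auto simp: is_first_def)

lemma is_last_subset: "is_last \<chi> S p \<Longrightarrow> T \<subseteq> S \<Longrightarrow> p \<in> T \<Longrightarrow> is_last \<chi> T p"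
  by (auto simp: is_last_def)

section \<open>Ordered products\<close>

lemma oprod_cong: "(\<And>i. i \<in> S \<Longrightarrow> Z i = Z' i) \<Longrightarrow> oprod Z S = oprod Z' S"
  unfolding oprod_def by (rule arg_cong[of _ _ prod_list], cases "finite S") (simp_all cong: map_cong)

lemma oprod_empty [simp]: "oprod Z {} = 1"
  by (simp add: oprod_def)

lemma oprod_singleton [simp]: "oprod Z {i} = Z i"
  by (simp add: oprod_def)

lemma oprod_Un:
  assumes "finite A" "finite C" "\<And>x y. x \<in> A \<Longrightarrow> y \<in> C \<Longrightarrow> x < y"
  shows "oprod Z (A \<union> C) = oprod Z A * oprod Z C"
proof -
  have "A \<inter> C = {}" using assms(3) by fastforce
  then have "sorted_list_of_set (A \<union> C) = sorted_list_of_set A @ sorted_list_of_set C"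
    using assms by (intro sorted_distinct_set_unique) (auto simp: sorted_append intro: less_imp_le)
  then show ?thesis by (simp add: oprod_def)
qed

lemma oprod_split:
  assumes "finite S" "p \<in> S"
  shows "oprod Z S = oprod Z {i\<in>S. i < p} * (Z p * oprod Z {i\<in>S. p < i})"
proof -
  have "S = {i\<in>S. i < p} \<union> ({p} \<union> {i\<in>S. p < i})" using assms by auto
  then have "oprod Z S = oprod Z ({i\<in>S. i < p} \<union> ({p} \<union> {i\<in>S. p < i}))" by simp
  also have "\<dots> = oprod Z {i\<in>S. i < p} * (oprod Z {p} * oprod Z {i\<in>S. p < i})"
    using assms by (subst oprod_Un; (subst oprod_Un)?) auto
  finally show ?thesis by simp
qed

lemma oprod_split_upd:
  assumes "finite S" "p \<in> S"
  shows "oprod (Z(p := z)) S = oprod Z {i\<in>S. i < p} * (z * oprod Z {i\<in>S. p < i})"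
proof -
  have "oprod (Z(p := z)) {i\<in>S. i < p} = oprod Z {i\<in>S. i < p}"
    and "oprod (Z(p := z)) {i\<in>S. p < i} = oprod Z {i\<in>S. p < i}"
    by (rule oprod_cong, simp)+
  then show ?thesis by (simp add: oprod_split[OF assms])
qed

lemma oprod_split_upd_greater:
  assumes "finite S" "p \<in> S" "p < p'"
  shows "oprod (Z(p' := z)) S = oprod Z {i\<in>S. i < p} * (Z p * oprod (Z(p' := z)) {i\<in>S. p < i})"
proof -
  have "oprod (Z(p' := z)) {i\<in>S. i < p} = oprod Z {i\<in>S. i < p}"
    using assms(3) by (intro oprod_cong) simp
  then show ?thesis using assms(3) by (simp add: oprod_split[OF assms(1,2)])
qed

lemma oprod_remove_one:
  assumes "finite S" "p \<in> S" "Z p = 1"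
  shows "oprod Z S = oprod Z (S - {p})"
proof -
  have "S - {p} = {i\<in>S. i < p} \<union> {i\<in>S. p < i}" by auto
  then have "oprod Z (S - {p}) = oprod Z {i\<in>S. i < p} * oprod Z {i\<in>S. p < i}"
    by (subst \<open>S - {p} = _\<close>, intro oprod_Un) (use assms in auto)
  then show ?thesis using oprod_split[OF assms(1,2), of Z] assms(3) by simp
qed

lemma oprod_commute:
  fixes Z :: "nat \<Rightarrow> 'a::monoid_mult"
  assumes "finite S" "\<And>i. i \<in> S \<Longrightarrow> x * Z i = Z i * x"
  shows "x * oprod Z S = oprod Z S * x"
proof -
  have "x * prod_list (map Z xs) = prod_list (map Z xs) * x" if "set xs \<subseteq> S" for xs
    using that
  proof (induction xs)
    case (Cons i xs)
    then have "x * (Z i * prod_list (map Z xs)) = Z i * (x * prod_list (map Z xs))"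
      using assms(2)[of i] by (metis mult.assoc list.set_intros(1) subset_iff)
    moreover have "x * prod_list (map Z xs) = prod_list (map Z xs) * x" using Cons by simp
    ultimately show ?case by (simp only: list.map prod_list.Cons mult.assoc)
  qed simp
  then show ?thesis using assms(1) by (simp add: oprod_def)
qed

text \<open>The axiom \<phi>(Y L_b) = \<phi>(Y R_b) exchanges operators only at the right end of a
  product. Two tails related in this way may differ in the algebra, yet \<phi> cannot tell them
  apart behind any common front factor.\<close>

definition same_tail :: "('a::times \<Rightarrow> 'd) \<Rightarrow> 'a \<Rightarrow> 'a \<Rightarrow> bool" where
  "same_tail \<phi> P P' \<longleftrightarrow> (\<forall>Q. \<phi> (Q * P) = \<phi> (Q * P'))"

lemma same_tail_refl [simp]: "same_tail \<phi> P P"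
  by (simp add: same_tail_def)

lemma same_tail_trans: "same_tail \<phi> P P' \<Longrightarrow> same_tail \<phi> P' P'' \<Longrightarrow> same_tail \<phi> P P''"
  by (simp add: same_tail_def)

lemma same_tail_mult: "same_tail \<phi> P P' \<Longrightarrow> same_tail \<phi> (Q * P) (Q * (P'::'a::semigroup_mult))"
  by (simp add: same_tail_def flip: mult.assoc)

lemma same_tailD: "same_tail \<phi> P (P'::'a::monoid_mult) \<Longrightarrow> \<phi> P = \<phi> P'"
  unfolding same_tail_def by (metis mult_1)


section \<open>The two actions of \<B> on the faces, and balance of the expectations\<close>

context ncs_pair
begin

abbreviation B where "B \<equiv> ncs_B X"

lemma B_sub: "D.subspace B" and B_one: "1 \<in> B" and B_mult: "x \<in> B \<Longrightarrow> y \<in> B \<Longrightarrow> x * y \<in> B"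
  using B_subalgebra by (auto simp: unital_subalgebra_def)

lemma B_zero: "0 \<in> B"
  using B_sub by (simp add: D.subspace_0)

lemma Lop_mult: "b \<in> B \<Longrightarrow> c \<in> B \<Longrightarrow> Lop X b * Lop X c = Lop X (b * c)"
  using B_one by (simp add: Lop_def tens_mult flip: eps_mult)

lemma Rop_mult: "b \<in> B \<Longrightarrow> c \<in> B \<Longrightarrow> Rop X b * Rop X c = Rop X (c * b)"
  using B_one by (simp add: Rop_def tens_mult flip: eps_mult)

lemma Lop_Rop: "b \<in> B \<Longrightarrow> c \<in> B \<Longrightarrow> Lop X b * Rop X c = Rop X c * Lop X b"
  using B_one by (simp add: Lop_def Rop_def tens_mult flip: eps_mult)

lemma Lop_one [simp]: "Lop X 1 = 1" and Rop_one [simp]: "Rop X 1 = 1"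
  by (simp_all add: Lop_def Rop_def tens_one eps_one)

lemma Lop_zero [simp]: "Lop X 0 = 0"
  using tens_add_left[of 0 0 1] B_one B_zero by (simp add: Lop_def)

lemma Rop_zero [simp]: "Rop X 0 = 0"
  using tens_add_right[of 1 0 0] B_one B_zero by (simp add: Rop_def)

lemma lact_one [simp]: "lact X s 1 z = z" and ract_one [simp]: "ract X s z 1 = z"
  by (simp_all add: lact_def ract_def split: side.split)

text \<open>For a right entry two reversals cancel: \<open>Rop\<close> reverses products, and the
  left action multiplies on the right. So both sides carry a genuine left module structure.\<close>

lemma lact_lact: "b \<in> B \<Longrightarrow> c \<in> B \<Longrightarrow> lact X s b (lact X s c z) = lact X s (b * c) z"
  by (simp add: lact_def Lop_mult Rop_mult mult.assoc split: side.split) (simp add: Lop_mult flip: mult.assoc)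

lemma ract_ract: "b \<in> B \<Longrightarrow> c \<in> B \<Longrightarrow> ract X s (ract X s z b) c = ract X s z (b * c)"
  by (simp add: ract_def Lop_mult Rop_mult mult.assoc split: side.split) (simp add: Rop_mult flip: mult.assoc)

lemma lact_ract: "lact X s b (ract X s z c) = ract X s (lact X s b z) c"
  by (simp add: lact_def ract_def mult.assoc split: side.split)

text \<open>The special entry of the theorem is the unit acted upon from either side, so its element
  of \<B> can be sent to the predecessor as well as to the successor.\<close>

lemma side_op_lact: "side_op X s b = lact X s b 1" and side_op_ract: "side_op X s b = ract X s 1 b"
  by (simp_all add: side_op_def lact_def ract_def split: side.split)

lemma faceD_Lft: "z \<in> face X Lft \<Longrightarrow> b \<in> B \<Longrightarrow> Rop X b * z = z * Rop X b"
  by (simp add: face_def)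

lemma faceD_Rgt: "z \<in> face X Rgt \<Longrightarrow> b \<in> B \<Longrightarrow> Lop X b * z = z * Lop X b"
  by (simp add: face_def)

lemma face_one: "1 \<in> face X s"
  by (simp add: face_def split: side.split)

lemma face_lact:
  assumes "b \<in> B" "z \<in> face X s"
  shows "lact X s b z \<in> face X s"
proof (cases s)
  case Lft
  then have "Lop X b * z * Rop X c = Rop X c * (Lop X b * z)" if "c \<in> B" for c
    using assms that by (simp add: mult.assoc flip: faceD_Lft) (simp add: Lop_Rop flip: mult.assoc)
  then show ?thesis using Lft by (simp add: face_def lact_def)
next
  case Rgt
  then have "z * Rop X b * Lop X c = Lop X c * (z * Rop X b)" if "c \<in> B" for c
    using assms that by (simp add: mult.assoc flip: Lop_Rop) (simp add: faceD_Rgt flip: mult.assoc)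
  then show ?thesis using Rgt by (simp add: face_def lact_def)
qed

lemma face_ract:
  assumes "b \<in> B" "z \<in> face X s"
  shows "ract X s z b \<in> face X s"
proof (cases s)
  case Lft
  then have "z * Lop X b * Rop X c = Rop X c * (z * Lop X b)" if "c \<in> B" for c
    using assms that by (simp add: mult.assoc Lop_Rop) (simp add: faceD_Lft flip: mult.assoc)
  then show ?thesis using Lft by (simp add: face_def ract_def)
next
  case Rgt
  then have "Rop X b * z * Lop X c = Lop X c * (Rop X b * z)" if "c \<in> B" for c
    using assms that by (simp add: mult.assoc flip: faceD_Rgt) (simp add: Lop_Rop flip: mult.assoc)
  then show ?thesis using Rgt by (simp add: face_def ract_def)
qed

lemma faces_lact: "Z \<in> faces X \<chi> S \<Longrightarrow> b \<in> B \<Longrightarrow> Z(p := lact X (\<chi> p) b (Z p)) \<in> faces X \<chi> S"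
  by (auto intro!: faces_upd face_lact dest: facesD)

lemma faces_ract: "Z \<in> faces X \<chi> S \<Longrightarrow> b \<in> B \<Longrightarrow> Z(p := ract X (\<chi> p) (Z p) b) \<in> faces X \<chi> S"
  by (auto intro!: faces_upd face_ract dest: facesD)

lemma oprod_Lop_Rgt:
  assumes "finite T" "Z \<in> faces X \<chi> T" "\<And>i. i \<in> T \<Longrightarrow> \<chi> i = Rgt" "b \<in> B"
  shows "Lop X b * oprod Z T = oprod Z T * Lop X b"
  using assms(1) by (rule oprod_commute) (use assms facesD[OF assms(2)] faceD_Rgt in metis)

lemma oprod_Rop_Lft:
  assumes "finite T" "Z \<in> faces X \<chi> T" "\<And>i. i \<in> T \<Longrightarrow> \<chi> i = Lft" "b \<in> B"
  shows "Rop X b * oprod Z T = oprod Z T * Rop X b"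
  using assms(1) by (rule oprod_commute) (use assms facesD[OF assms(2)] faceD_Lft in metis)

text \<open>Entries in front of \<open>p\<close> in the usual order are right entries, because
  \<open>p\<close> is \<open>chi_less\<close>-first, and L_b commutes with them. If \<open>p\<close>
  is on the left, L_b has then reached its place. If \<open>p\<close> is on the right, it is the
  largest index of \<open>T\<close>, so L_b commutes past \<open>Z p\<close> as well and turns into
  R_b at the right end. The result is stated with \<open>same_tail\<close> so that it applies to the
  tail of a longer product.\<close>

lemma move_Lop:
  fixes \<phi> :: "'a \<Rightarrow> 'd"
  assumes \<phi>: "\<And>b Y. b \<in> B \<Longrightarrow> \<phi> (Y * Lop X b) = \<phi> (Y * Rop X b)"
    and T: "finite T" "Z \<in> faces X \<chi> T" "is_first \<chi> T p" and b: "b \<in> B"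
  shows "same_tail \<phi> (Lop X b * oprod Z T) (oprod (Z(p := lact X (\<chi> p) b (Z p))) T)"
proof -
  let ?A = "{i\<in>T. i < p}" and ?C = "{i\<in>T. p < i}"
  have p: "p \<in> T" and first: "\<And>x. x \<in> T \<Longrightarrow> x \<noteq> p \<Longrightarrow> chi_less \<chi> p x"
    using T(3) by (auto simp: is_first_def)
  have "\<chi> i = Rgt" if "i \<in> ?A" for i
    using first[of i] that by (cases "\<chi> i") (auto simp: chi_less_def)
  then have A: "Lop X b * oprod Z ?A = oprod Z ?A * Lop X b"
    using T b by (intro oprod_Lop_Rgt[of _ _ \<chi>]) (auto intro: faces_mono)
  have spl: "Lop X b * oprod Z T = oprod Z ?A * (Lop X b * (Z p * oprod Z ?C))"
    using A by (subst oprod_split[OF T(1) p]) (simp flip: mult.assoc)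
  show ?thesis
  proof (cases "\<chi> p")
    case Lft
    then have "Lop X b * oprod Z T = oprod (Z(p := lact X (\<chi> p) b (Z p))) T"
      unfolding spl by (subst oprod_split_upd[OF T(1) p]) (simp add: lact_def mult.assoc)
    then show ?thesis by simp
  next
    case Rgt
    have "?C = {}" using first Rgt by (fastforce simp: chi_less_def)
    moreover have "Lop X b * Z p = Z p * Lop X b"
      using facesD[OF T(2) p] Rgt b by (simp add: faceD_Rgt)
    ultimately have "Lop X b * oprod Z T = oprod Z ?A * Z p * Lop X b"
      and "oprod (Z(p := lact X (\<chi> p) b (Z p))) T = oprod Z ?A * Z p * Rop X b"
      unfolding spl oprod_split_upd[OF T(1) p] using Rgt
      by (simp_all only: oprod_empty mult_1_right mult.assoc lact_def side.case)
    then show ?thesis using \<phi>[OF b] by (simp add: same_tail_def flip: mult.assoc)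
  qed
qed

text \<open>Mirror image of \<open>move_Lop\<close>: in front of the \<open>chi_less\<close>-last
  index there are only left entries.\<close>

lemma move_Rop:
  fixes \<phi> :: "'a \<Rightarrow> 'd"
  assumes \<phi>: "\<And>b Y. b \<in> B \<Longrightarrow> \<phi> (Y * Lop X b) = \<phi> (Y * Rop X b)"
    and T: "finite T" "Z \<in> faces X \<chi> T" "is_last \<chi> T p" and b: "b \<in> B"
  shows "same_tail \<phi> (Rop X b * oprod Z T) (oprod (Z(p := ract X (\<chi> p) (Z p) b)) T)"
proof -
  let ?A = "{i\<in>T. i < p}" and ?C = "{i\<in>T. p < i}"
  have p: "p \<in> T" and last: "\<And>x. x \<in> T \<Longrightarrow> x \<noteq> p \<Longrightarrow> chi_less \<chi> x p"
    using T(3) by (auto simp: is_last_def)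
  have "\<chi> i = Lft" if "i \<in> ?A" for i
    using last[of i] that by (cases "\<chi> i") (auto simp: chi_less_def)
  then have A: "Rop X b * oprod Z ?A = oprod Z ?A * Rop X b"
    using T b by (intro oprod_Rop_Lft[of _ _ \<chi>]) (auto intro: faces_mono)
  have spl: "Rop X b * oprod Z T = oprod Z ?A * (Rop X b * (Z p * oprod Z ?C))"
    using A by (subst oprod_split[OF T(1) p]) (simp flip: mult.assoc)
  show ?thesis
  proof (cases "\<chi> p")
    case Rgt
    then have "Rop X b * oprod Z T = oprod (Z(p := ract X (\<chi> p) (Z p) b)) T"
      unfolding spl by (subst oprod_split_upd[OF T(1) p]) (simp add: ract_def mult.assoc)
    then show ?thesis by simp
  next
    case Lft
    have "?C = {}" using last Lft by (fastforce simp: chi_less_def)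
    moreover have "Rop X b * Z p = Z p * Rop X b"
      using facesD[OF T(2) p] Lft b by (simp add: faceD_Lft)
    ultimately have "Rop X b * oprod Z T = oprod Z ?A * Z p * Rop X b"
      and "oprod (Z(p := ract X (\<chi> p) (Z p) b)) T = oprod Z ?A * Z p * Lop X b"
      unfolding spl oprod_split_upd[OF T(1) p] using Lft
      by (simp_all only: oprod_empty mult_1_right mult.assoc ract_def side.case)
    then show ?thesis using \<phi>[OF b] by (simp add: same_tail_def flip: mult.assoc)
  qed
qed

text \<open>Stated for a general \<open>\<phi>\<close> because E and F share these two axioms.
  Between neighbours on the same side the operator is carried through the tail behind the smaller
  index; at the turning point from left to right both operators reach the right end of the whole
  product.\<close>

lemma balanced_oprod:
  fixes \<phi> :: "'a \<Rightarrow> 'd"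
  assumes bi: "\<And>b c Y. b \<in> B \<Longrightarrow> c \<in> B \<Longrightarrow> \<phi> (Lop X b * Rop X c * Y) = b * \<phi> Y * c"
    and \<phi>: "\<And>b Y. b \<in> B \<Longrightarrow> \<phi> (Y * Lop X b) = \<phi> (Y * Rop X b)"
    and S: "finite S"
  shows "balanced X \<chi> S (\<lambda>Z. \<phi> (oprod Z S))"
proof (rule balancedI)
  fix Z Z' :: "nat \<Rightarrow> 'a" assume "\<And>i. i \<in> S \<Longrightarrow> Z i = Z' i"
  then show "\<phi> (oprod Z S) = \<phi> (oprod Z' S)" by (metis oprod_cong)
next
  fix Z b p assume "Z \<in> faces X \<chi> S" "b \<in> B" "is_first \<chi> S p"
  from same_tailD[OF move_Lop[OF \<phi> S this(1,3,2)]]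
  show "\<phi> (oprod (Z(p := lact X (\<chi> p) b (Z p))) S) = b * \<phi> (oprod Z S)"
    using bi[OF \<open>b \<in> B\<close> B_one] by simp
next
  fix Z b p assume "Z \<in> faces X \<chi> S" "b \<in> B" "is_last \<chi> S p"
  from same_tailD[OF move_Rop[OF \<phi> S this(1,3,2)]]
  show "\<phi> (oprod (Z(p := ract X (\<chi> p) (Z p) b)) S) = \<phi> (oprod Z S) * b"
    using bi[OF B_one \<open>b \<in> B\<close>] by simp
next
  fix Z b p p' assume Z: "Z \<in> faces X \<chi> S" and b: "b \<in> B" and adj: "adjacent \<chi> S p p'"
  have p: "p \<in> S" "p' \<in> S" and less: "chi_less \<chi> p p'"
    and btw: "\<And>x. x \<in> S \<Longrightarrow> \<not> (chi_less \<chi> p x \<and> chi_less \<chi> x p')"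
    using adj by (auto simp: adjacent_def)
  let ?C = "{i\<in>S. p < i}" and ?C' = "{i\<in>S. p' < i}"
  consider "\<chi> p = Lft" "\<chi> p' = Lft" "p < p'" | "\<chi> p = Rgt" "\<chi> p' = Rgt" "p' < p" | "\<chi> p = Lft" "\<chi> p' = Rgt"
    using less by (auto simp: chi_less_def)
  then show "\<phi> (oprod (Z(p := ract X (\<chi> p) (Z p) b)) S) = \<phi> (oprod (Z(p' := lact X (\<chi> p') b (Z p'))) S)"
  proof cases
    case 1
    \<comment> \<open>In the tail behind \<open>p\<close> no left index precedes \<open>p'\<close>,
      by adjacency, and right indices come later in \<open>chi_less\<close>.\<close>
    have "is_first \<chi> ?C p'"
      unfolding is_first_def
    proof (intro conjI ballI impI)
      fix x assume "x \<in> ?C" "x \<noteq> p'"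
      then show "chi_less \<chi> p' x" using btw[of x] 1 by (cases "\<chi> x") (auto simp: chi_less_def)
    qed (use p 1 in auto)
    from move_Lop[OF \<phi> _ _ this b, of Z]
    have "same_tail \<phi> (Lop X b * oprod Z ?C) (oprod (Z(p' := lact X (\<chi> p') b (Z p'))) ?C)"
      using S Z by (auto intro: faces_mono)
    then have st: "same_tail \<phi> (oprod Z {i\<in>S. i < p} * (Z p * (Lop X b * oprod Z ?C)))
        (oprod Z {i\<in>S. i < p} * (Z p * oprod (Z(p' := lact X (\<chi> p') b (Z p'))) ?C))"
      by (intro same_tail_mult)
    have l: "oprod (Z(p' := lact X (\<chi> p') b (Z p'))) S =
        oprod Z {i\<in>S. i < p} * (Z p * oprod (Z(p' := lact X (\<chi> p') b (Z p'))) ?C)"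
      using 1 by (intro oprod_split_upd_greater S p)
    have r: "oprod (Z(p := ract X (\<chi> p) (Z p) b)) S =
        oprod Z {i\<in>S. i < p} * (Z p * (Lop X b * oprod Z ?C))"
      using 1 by (simp add: oprod_split_upd[OF S p(1)] ract_def mult.assoc)
    show ?thesis unfolding l r by (rule same_tailD[OF st])
  next
    case 2
    have "is_last \<chi> ?C' p"
      unfolding is_last_def
    proof (intro conjI ballI impI)
      fix x assume "x \<in> ?C'" "x \<noteq> p"
      then show "chi_less \<chi> x p" using btw[of x] 2 by (cases "\<chi> x") (auto simp: chi_less_def)
    qed (use p 2 in auto)
    from move_Rop[OF \<phi> _ _ this b, of Z]
    have "same_tail \<phi> (Rop X b * oprod Z ?C') (oprod (Z(p := ract X (\<chi> p) (Z p) b)) ?C')"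
      using S Z by (auto intro: faces_mono)
    then have st: "same_tail \<phi> (oprod Z {i\<in>S. i < p'} * (Z p' * (Rop X b * oprod Z ?C')))
        (oprod Z {i\<in>S. i < p'} * (Z p' * oprod (Z(p := ract X (\<chi> p) (Z p) b)) ?C'))"
      by (intro same_tail_mult)
    have r: "oprod (Z(p := ract X (\<chi> p) (Z p) b)) S =
        oprod Z {i\<in>S. i < p'} * (Z p' * oprod (Z(p := ract X (\<chi> p) (Z p) b)) ?C')"
      using 2 by (intro oprod_split_upd_greater S p)
    have l: "oprod (Z(p' := lact X (\<chi> p') b (Z p'))) S =
        oprod Z {i\<in>S. i < p'} * (Z p' * (Rop X b * oprod Z ?C'))"
      using 2 by (simp add: oprod_split_upd[OF S p(2)] lact_def mult.assoc)
    show ?thesis unfolding l r by (rule same_tailD[OF st, symmetric])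
  next
    case 3
    \<comment> \<open>Adjacency makes \<open>p\<close> the largest left index and \<open>p'\<close>
      the largest right index. Behind \<open>p\<close> there are thus only right entries, which
      commute with L_b, and behind \<open>p'\<close> only left entries, which commute with
      R_b.\<close>
    have "\<chi> i = Rgt" if "i \<in> ?C" for i
      using btw[of i] that 3 by (cases "\<chi> i") (auto simp: chi_less_def)
    then have C: "Lop X b * oprod Z ?C = oprod Z ?C * Lop X b"
      using S Z b by (intro oprod_Lop_Rgt[of _ _ \<chi>]) (auto intro: faces_mono)
    have "\<chi> i = Lft" if "i \<in> ?C'" for i
      using btw[of i] that 3 by (cases "\<chi> i") (auto simp: chi_less_def)
    then have C': "Rop X b * oprod Z ?C' = oprod Z ?C' * Rop X b"
      using S Z b by (intro oprod_Rop_Lft[of _ _ \<chi>]) (auto intro: faces_mono)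
    have "oprod (Z(p := ract X (\<chi> p) (Z p) b)) S = oprod Z S * Lop X b"
      using C 3 by (simp add: oprod_split_upd[OF S p(1)] oprod_split[OF S p(1), of Z] ract_def mult.assoc)
    moreover have "oprod (Z(p' := lact X (\<chi> p') b (Z p'))) S = oprod Z S * Rop X b"
      using C' 3 by (simp add: oprod_split_upd[OF S p(2)] oprod_split[OF S p(2), of Z] lact_def mult.assoc)
    ultimately show ?thesis using \<phi>[OF b] by simp
  qed
qed

lemma balanced_E: "finite S \<Longrightarrow> balanced X \<chi> S (\<lambda>Z. EE X (oprod Z S))"
  by (rule balanced_oprod) (simp_all add: E_bimodule E_right)

lemma balanced_F: "finite S \<Longrightarrow> balanced X \<chi> S (\<lambda>Z. FF X (oprod Z S))"
  by (rule balanced_oprod) (simp_all add: F_bimodule F_right)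

end

section \<open>Removing an interval\<close>

definition chi_above :: "(nat \<Rightarrow> side) \<Rightarrow> nat set \<Rightarrow> nat set \<Rightarrow> nat set" where
  "chi_above \<chi> S V = {j \<in> S. \<forall>v\<in>V. chi_less \<chi> v j}"

definition chi_below :: "(nat \<Rightarrow> side) \<Rightarrow> nat set \<Rightarrow> nat set \<Rightarrow> nat set" where
  "chi_below \<chi> S V = {j \<in> S. \<forall>v\<in>V. chi_less \<chi> j v}"

text \<open>\<open>V\<close> is meant to be a \<open>chi_less\<close>-interval with value
  \<open>g Z\<close>. If nothing lies above \<open>V\<close>, there is no entry to act on and the
  value leaves as a right factor; in particular for \<open>V = S\<close>, where
  \<open>\<Phi>\<close> should be 1.\<close>

definition graft :: "('a::times, 'd::monoid_mult, 't) ncs \<Rightarrow> (nat \<Rightarrow> side) \<Rightarrow> nat set \<Rightarrow> nat set \<Rightarrow>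
    ((nat \<Rightarrow> 'a) \<Rightarrow> 'd) \<Rightarrow> ((nat \<Rightarrow> 'a) \<Rightarrow> 'd) \<Rightarrow> (nat \<Rightarrow> 'a) \<Rightarrow> 'd" where
  "graft X \<chi> S V g \<Phi> Z =
     (if chi_above \<chi> S V = {} then \<Phi> Z * g Z
      else \<Phi> (Z(chi_min \<chi> (chi_above \<chi> S V) := lact X (\<chi> (chi_min \<chi> (chi_above \<chi> S V))) (g Z)
        (Z (chi_min \<chi> (chi_above \<chi> S V))))))"

lemma graft_top: "chi_above \<chi> S V = {} \<Longrightarrow> graft X \<chi> S V g \<Phi> Z = \<Phi> Z * g Z"
  by (simp add: graft_def)

lemma graft_succ:
  "is_first \<chi> (chi_above \<chi> S V) s \<Longrightarrow> graft X \<chi> S V g \<Phi> Z = \<Phi> (Z(s := lact X (\<chi> s) (g Z) (Z s)))"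
  using is_first_chi_min[of \<chi> "chi_above \<chi> S V" s] by (auto simp: graft_def is_first_def)

lemma chi_above_cases:
  assumes "finite S"
  obtains "chi_above \<chi> S V = {}" | s where "is_first \<chi> (chi_above \<chi> S V) s"
proof (cases "chi_above \<chi> S V = {}")
  case False
  have "finite (chi_above \<chi> S V)" using assms by (simp add: chi_above_def)
  from that(2)[OF chi_min_is_first[OF this False]] show thesis .
qed (rule that(1))

lemma chi_interval_cases:
  assumes "chi_interval \<chi> S V" "j \<in> S - V"
  shows "j \<in> chi_above \<chi> S V \<or> j \<in> chi_below \<chi> S V"
proof (rule ccontr)
  assume "\<not> ?thesis"
  then obtain v w where vw: "v \<in> V" "\<not> chi_less \<chi> v j" "w \<in> V" "\<not> chi_less \<chi> j w"
    using assms(2) by (auto simp: chi_above_def chi_below_def)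
  then have "chi_less \<chi> j v" "chi_less \<chi> w j"
    using chi_less_total[of v j \<chi>] chi_less_total[of w j \<chi>] assms(2) by auto
  then show False using assms vw unfolding chi_interval_def by blast
qed

lemma chi_interval_subset:
  "chi_interval \<chi> S V \<Longrightarrow> V \<subseteq> T \<Longrightarrow> T \<subseteq> S \<Longrightarrow> chi_interval \<chi> T V"
  unfolding chi_interval_def by (meson subsetD)

lemma chi_interval_sub: "chi_interval \<chi> S V \<Longrightarrow> V \<subseteq> S"
  by (simp add: chi_interval_def)

lemma chi_intervalD:
  "chi_interval \<chi> S V \<Longrightarrow> a \<in> V \<Longrightarrow> c \<in> V \<Longrightarrow> b \<in> S \<Longrightarrow> chi_less \<chi> a b \<Longrightarrow> chi_less \<chi> b c \<Longrightarrow> b \<in> V"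
  unfolding chi_interval_def by blast

lemma chi_intervalI:
  assumes "V \<subseteq> S"
    and "\<And>a b c. a \<in> V \<Longrightarrow> c \<in> V \<Longrightarrow> b \<in> S \<Longrightarrow> chi_less \<chi> a b \<Longrightarrow> chi_less \<chi> b c \<Longrightarrow> b \<in> V"
  shows "chi_interval \<chi> S V"
  unfolding chi_interval_def using assms by blast

lemma chi_interval_Diff:
  assumes "chi_interval \<chi> S V"
  shows "chi_interval \<chi> (S - T) (V - T)"
proof (rule chi_intervalI)
  fix a b c assume "a \<in> V - T" "c \<in> V - T" "b \<in> S - T" "chi_less \<chi> a b" "chi_less \<chi> b c"
  then show "b \<in> V - T" using chi_intervalD[OF assms, of a c b] by simp
qed (use chi_interval_sub[OF assms] in auto)

lemma balanced_upd:
  "balanced X \<chi> S \<Phi> \<Longrightarrow> Z \<in> faces X \<chi> S \<Longrightarrow> p \<notin> S \<Longrightarrow> \<Phi> (Z(p := z)) = \<Phi> Z"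
  by (rule sym, erule (1) balanced_cong) auto

section \<open>Grafts are balanced, and grafts of disjoint intervals commute\<close>

context ncs_pair
begin

lemma graft_cong:
  assumes "Z \<in> faces X \<chi> S" "g Z \<in> B" "\<And>Y. Y \<in> faces X \<chi> (S - V) \<Longrightarrow> \<Phi> Y = \<Phi>' Y"
  shows "graft X \<chi> S V g \<Phi> Z = graft X \<chi> S V g \<Phi>' Z"
proof -
  have "Z \<in> faces X \<chi> (S - V)" using assms(1) by (rule faces_mono) blast
  then show ?thesis using assms(2,3) unfolding graft_def by (auto intro: faces_lact)
qed

text \<open>Once \<open>V\<close> is removed, its predecessor and its successor are adjacent, or the
  predecessor is last; balance of \<open>\<Phi>\<close> then moves the value across the gap. This
  connects \<open>graft\<close> with \<open>ccumulant\<close>, whose recursion acts on the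
  predecessor.\<close>

lemma graft_pred:
  assumes fin: "finite S" and V: "chi_interval \<chi> S V" "V \<noteq> {}"
    and \<Phi>: "balanced X \<chi> (S - V) \<Phi>" and Z: "Z \<in> faces X \<chi> S" and c: "g Z \<in> B"
    and p: "is_last \<chi> (chi_below \<chi> S V) p"
  shows "graft X \<chi> S V g \<Phi> Z = \<Phi> (Z(p := ract X (\<chi> p) (Z p) (g Z)))"
proof -
  have Z': "Z \<in> faces X \<chi> (S - V)" using Z by (rule faces_mono) blast
  have pS: "p \<in> S - V" and chi_below: "\<And>v. v \<in> V \<Longrightarrow> chi_less \<chi> p v"
    and last: "\<And>x. x \<in> chi_below \<chi> S V \<Longrightarrow> x \<noteq> p \<Longrightarrow> chi_less \<chi> x p"
    using p by (auto simp: is_last_def chi_below_def)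
  from V obtain v where v: "v \<in> V" by blast
  show ?thesis
  proof (cases rule: chi_above_cases[OF fin, of \<chi> V])
    case 1
    have "is_last \<chi> (S - V) p"
      using chi_interval_cases[OF V(1)] 1 pS last by (auto simp: is_last_def)
    then show ?thesis using balanced_last[OF \<Phi> Z' c] by (simp add: graft_top[OF 1])
  next
    case (2 s)
    have sS: "s \<in> S - V" and chi_above: "\<And>v. v \<in> V \<Longrightarrow> chi_less \<chi> v s"
      and first: "\<And>x. x \<in> chi_above \<chi> S V \<Longrightarrow> x \<noteq> s \<Longrightarrow> chi_less \<chi> s x"
      using 2 by (auto simp: is_first_def chi_above_def)
    have "adjacent \<chi> (S - V) p s"
      unfolding adjacent_def
    proof (intro conjI ballI notI pS sS)
      show "chi_less \<chi> p s" using chi_below[OF v] chi_above[OF v] by (rule chi_less_trans)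
      fix x assume "x \<in> S - V" "chi_less \<chi> p x \<and> chi_less \<chi> x s"
      then show False using chi_interval_cases[OF V(1), of x] last[of x] first[of x]
        by (metis chi_less_asym chi_less_irrefl)
    qed
    then show ?thesis using balanced_adjacent[OF \<Phi> Z' c] by (simp add: graft_succ[OF 2])
  qed
qed

text \<open>An element of \<B> moving up through \<open>S\<close> becomes a left factor of
  \<open>g Z\<close> on entering \<open>V\<close> and a right factor on leaving it; inside
  \<open>V\<close> balance of \<open>g\<close> applies, elsewhere balance of \<open>\<Phi>\<close>
  across the closed gap. The assumption \<open>unit\<close> serves \<open>S = V\<close>: there an
  element taken out to the left of \<open>g Z\<close> still has to pass
  \<open>\<Phi> Z\<close>.\<close>

lemma balanced_graft:
  assumes fin: "finite S" and V: "chi_interval \<chi> S V" "V \<noteq> {}"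
    and g: "balanced X \<chi> V g" "\<And>Z. Z \<in> faces X \<chi> V \<Longrightarrow> g Z \<in> B"
    and \<Phi>: "balanced X \<chi> (S - V) \<Phi>" and unit: "\<And>Z. S = V \<Longrightarrow> \<Phi> Z = 1"
  shows "balanced X \<chi> S (graft X \<chi> S V g \<Phi>)"
proof -
  have VS: "V \<subseteq> S" using V by (simp add: chi_interval_def)
  have facV: "Z \<in> faces X \<chi> V" if "Z \<in> faces X \<chi> S" for Z using that VS by (rule faces_mono)
  have facD: "Z \<in> faces X \<chi> (S - V)" if "Z \<in> faces X \<chi> S" for Z using that by (rule faces_mono) blast
  have gB: "g Z \<in> B" if "Z \<in> faces X \<chi> S" for Z using g(2) facV that by blast
  note act = faces_lact faces_ract
  have gcong: "g (Z(p := z)) = g Z" if "Z \<in> faces X \<chi> S" "p \<notin> V" for Z p z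
    using balanced_upd[OF g(1) facV[OF that(1)] that(2)] .
  have \<Phi>cong: "\<Phi> (Z(p := z)) = \<Phi> Z" if "Z \<in> faces X \<chi> S" "p \<notin> S - V" for Z p z
    using balanced_upd[OF \<Phi> facD[OF that(1)] that(2)] .
  obtain v where v: "v \<in> V" using V by blast
  note iv = chi_interval_cases[OF V(1)]
  show ?thesis
  proof (cases rule: chi_above_cases[OF fin, of \<chi> V])
    case 1
    have bel: "x \<in> S - V \<Longrightarrow> w \<in> V \<Longrightarrow> chi_less \<chi> x w" for x w
      using iv[of x] 1 by (auto simp: chi_below_def)
    show ?thesis
    proof (rule balancedI, unfold graft_top[OF 1])
      fix Z Z' assume Z: "Z \<in> faces X \<chi> S" and eq: "\<And>i. i \<in> S \<Longrightarrow> Z i = Z' i"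
      show "\<Phi> Z * g Z = \<Phi> Z' * g Z'"
        by (intro arg_cong2[of _ _ _ _ "(*)"] balanced_cong[OF g(1) facV[OF Z]] balanced_cong[OF \<Phi> facD[OF Z]])
          (use eq VS in auto)
    next
      fix Z b p assume Z: "Z \<in> faces X \<chi> S" and b: "b \<in> B" and p: "is_first \<chi> S p"
      show "\<Phi> (Z(p := lact X (\<chi> p) b (Z p))) * g (Z(p := lact X (\<chi> p) b (Z p))) = b * (\<Phi> Z * g Z)"
      proof (cases "p \<in> V")
        case True
        \<comment> \<open>\<open>V\<close> lies above everything else in \<open>S\<close> and yet
          contains the first index of \<open>S\<close>.\<close>
        have "S = V"
        proof (rule ccontr)
          assume "S \<noteq> V"
          then obtain x where "x \<in> S - V" using VS by blast
          then show False using bel[of x p] True p chi_less_asym[of \<chi> x p]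
            by (auto simp: is_first_def)
        qed
        then show ?thesis
          using unit balanced_first[OF g(1) facV[OF Z] b is_first_subset[OF p VS True]] by simp
      next
        case False
        then have "is_first \<chi> (S - V) p" using p by (auto simp: is_first_def)
        from balanced_first[OF \<Phi> facD[OF Z] b this] show ?thesis
          using gcong[OF Z False] by (simp add: mult.assoc)
      qed
    next
      fix Z b p assume Z: "Z \<in> faces X \<chi> S" and b: "b \<in> B" and p: "is_last \<chi> S p"
      have pV: "p \<in> V"
      proof (rule ccontr)
        assume "p \<notin> V"
        then show False using bel[of p v] v VS p chi_less_asym[of \<chi> p v] by (auto simp: is_last_def)
      qed
      from balanced_last[OF g(1) facV[OF Z] b is_last_subset[OF p VS pV]]
      show "\<Phi> (Z(p := ract X (\<chi> p) (Z p) b)) * g (Z(p := ract X (\<chi> p) (Z p) b)) = \<Phi> Z * g Z * b"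
        using \<Phi>cong[OF Z, of p] pV by (simp add: mult.assoc)
    next
      fix Z b p p' assume Z: "Z \<in> faces X \<chi> S" and b: "b \<in> B" and adj: "adjacent \<chi> S p p'"
      have p: "p \<in> S" "p' \<in> S" "chi_less \<chi> p p'"
        and btw: "\<And>x. x \<in> S \<Longrightarrow> chi_less \<chi> p x \<Longrightarrow> \<not> chi_less \<chi> x p'"
        using adj by (auto simp: adjacent_def)
      let ?l = "Z(p := ract X (\<chi> p) (Z p) b)" and ?r = "Z(p' := lact X (\<chi> p') b (Z p'))"
      consider "p \<in> V" "p' \<in> V" | "p \<notin> V" "p' \<notin> V" | "p \<notin> V" "p' \<in> V"
        using bel[of p' p] p chi_less_asym[of \<chi> p p'] by blast
      then show "\<Phi> ?l * g ?l = \<Phi> ?r * g ?r"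
      proof cases
        case 1
        from balanced_adjacent[OF g(1) facV[OF Z] b adjacent_subset[OF adj VS this]]
        show ?thesis using 1 Z by (simp add: \<Phi>cong)
      next
        case 2
        have "adjacent \<chi> (S - V) p p'" by (rule adjacent_subset[OF adj]) (use 2 p in auto)
        from balanced_adjacent[OF \<Phi> facD[OF Z] b this]
        show ?thesis using 2 Z by (simp add: gcong)
      next
        case 3
        have "chi_less \<chi> x p" if "x \<in> S - V" "x \<noteq> p" for x
          using bel[OF that(1) 3(2)] btw[of x] chi_less_total[OF that(2), of \<chi>] that by auto
        then have "is_last \<chi> (S - V) p" using 3 p by (auto simp: is_last_def)
        moreover have "chi_less \<chi> p' x" if "x \<in> V" "x \<noteq> p'" for x
          using bel[of p x] btw[of x] chi_less_total[OF that(2), of \<chi>] that 3 p VS by auto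
        then have "is_first \<chi> V p'" using 3 by (auto simp: is_first_def)
        ultimately show ?thesis
          using balanced_last[OF \<Phi> facD[OF Z] b] balanced_first[OF g(1) facV[OF Z] b] 3 Z
          by (simp add: \<Phi>cong gcong mult.assoc)
      qed
    qed
  next
    case (2 s)
    have sS: "s \<in> S" "s \<notin> V" and chi_above: "\<And>v. v \<in> V \<Longrightarrow> chi_less \<chi> v s"
      and first: "\<And>x. x \<in> chi_above \<chi> S V \<Longrightarrow> x \<noteq> s \<Longrightarrow> chi_less \<chi> s x"
      using 2 by (auto simp: is_first_def chi_above_def)
    \<comment> \<open>The action on the successor \<open>s\<close> as an operation of its own, so
      that the acting element and the family can be varied separately.\<close>
    define U where "U c Z = Z(s := lact X (\<chi> s) c (Z s))" for c and Z :: "nat \<Rightarrow> 'a"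
    have Uf: "U c Z \<in> faces X \<chi> S" if "Z \<in> faces X \<chi> S" "c \<in> B" for Z c
      using faces_lact[OF that] by (simp add: U_def)
    have gU: "graft X \<chi> S V g \<Phi> Z = \<Phi> (U (g Z) Z)" for Z
      by (simp add: graft_succ[OF 2] U_def)
    have Uupd: "U c (Z(p := z)) = (U c Z)(p := z)" if "p \<noteq> s" for c Z p z
      using that by (simp add: U_def fun_upd_twist)
    have Us: "U c Z i = Z i" if "i \<noteq> s" for c Z i
      using that by (simp add: U_def)
    show ?thesis
    proof (rule balancedI, unfold gU)
      fix Z Z' assume Z: "Z \<in> faces X \<chi> S" and eq: "\<And>i. i \<in> S \<Longrightarrow> Z i = Z' i"
      have "g Z = g Z'" by (rule balanced_cong[OF g(1) facV[OF Z]]) (use eq VS in auto)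
      then show "\<Phi> (U (g Z) Z) = \<Phi> (U (g Z') Z')"
        using eq by (intro balanced_cong[OF \<Phi> facD[OF Uf[OF Z gB[OF Z]]]]) (auto simp: U_def sS)
    next
      fix Z b p assume Z: "Z \<in> faces X \<chi> S" and b: "b \<in> B" and p: "is_first \<chi> S p"
      note ZU = facD[OF Uf[OF Z gB[OF Z]]]
      let ?l = "Z(p := lact X (\<chi> p) b (Z p))"
      show "\<Phi> (U (g ?l) ?l) = b * \<Phi> (U (g Z) Z)"
      proof (cases "p \<in> V")
        case True
        then have gl: "g ?l = b * g Z"
          using balanced_first[OF g(1) facV[OF Z] b is_first_subset[OF p VS True]] by simp
        have "x \<in> chi_above \<chi> S V" if "x \<in> S - V" for x
          using iv[OF that] that True p chi_less_asym[of \<chi> x p] by (auto simp: is_first_def chi_below_def)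
        then have "is_first \<chi> (S - V) s" using first sS by (auto simp: is_first_def)
        from balanced_first[OF \<Phi> ZU b this]
        have "\<Phi> (U (b * g Z) Z) = b * \<Phi> (U (g Z) Z)"
          using lact_lact[OF b gB[OF Z]] by (simp add: U_def)
        moreover have "\<Phi> (U (b * g Z) ?l) = \<Phi> (U (b * g Z) Z)"
          using True sS \<Phi>cong[OF Uf[OF Z B_mult[OF b gB[OF Z]]], of p] by (subst Uupd) auto
        ultimately show ?thesis using gl by simp
      next
        case False
        have "p \<noteq> s" using p chi_above[OF v] v VS sS unfolding is_first_def by (metis chi_less_asym subsetD)
        moreover have "is_first \<chi> (S - V) p" using p False by (auto simp: is_first_def)
        from balanced_first[OF \<Phi> ZU b this] have "\<Phi> ((U (g Z) Z)(p := lact X (\<chi> p) b (U (g Z) Z p)))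
          = b * \<Phi> (U (g Z) Z)" .
        ultimately show ?thesis using gcong[OF Z False] by (simp add: Uupd Us)
      qed
    next
      fix Z b p assume Z: "Z \<in> faces X \<chi> S" and b: "b \<in> B" and p: "is_last \<chi> S p"
      note ZU = facD[OF Uf[OF Z gB[OF Z]]]
      let ?l = "Z(p := ract X (\<chi> p) (Z p) b)"
      have pV: "p \<notin> V" using chi_above[of p] p sS chi_less_asym[of \<chi> p s] by (auto simp: is_last_def)
      then have "is_last \<chi> (S - V) p" using p by (auto simp: is_last_def)
      from balanced_last[OF \<Phi> ZU b this]
      have "\<Phi> ((U (g Z) Z)(p := ract X (\<chi> p) (U (g Z) Z p) b)) = \<Phi> (U (g Z) Z) * b" .
      \<comment> \<open>If \<open>p = s\<close>, both actions hit the same entry; left and right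
        actions commute.\<close>
      moreover have "(U (g Z) Z)(p := ract X (\<chi> p) (U (g Z) Z p) b) = U (g Z) ?l"
        by (cases "p = s") (simp_all add: U_def lact_ract fun_upd_twist)
      ultimately show "\<Phi> (U (g ?l) ?l) = \<Phi> (U (g Z) Z) * b" using gcong[OF Z pV] by simp
    next
      fix Z b p p' assume Z: "Z \<in> faces X \<chi> S" and b: "b \<in> B" and adj: "adjacent \<chi> S p p'"
      have p: "p \<in> S" "p' \<in> S" "chi_less \<chi> p p'"
        and btw: "\<And>x. x \<in> S \<Longrightarrow> chi_less \<chi> p x \<Longrightarrow> \<not> chi_less \<chi> x p'"
        using adj by (auto simp: adjacent_def)
      note ZU = facD[OF Uf[OF Z gB[OF Z]]]
      let ?l = "Z(p := ract X (\<chi> p) (Z p) b)" and ?r = "Z(p' := lact X (\<chi> p') b (Z p'))"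
      consider "p \<in> V" "p' \<in> V" | "p \<in> V" "p' \<notin> V" | "p \<notin> V" "p' \<in> V" | "p \<notin> V" "p' \<notin> V"
        by blast
      then show "\<Phi> (U (g ?l) ?l) = \<Phi> (U (g ?r) ?r)"
      proof cases
        case 1
        have "g ?l = g ?r"
          using balanced_adjacent[OF g(1) facV[OF Z] b adjacent_subset[OF adj VS 1]] .
        moreover have "\<Phi> (U c ?l) = \<Phi> (U c Z)" "\<Phi> (U c ?r) = \<Phi> (U c Z)" if "c \<in> B" for c
          using 1 sS \<Phi>cong[OF Uf[OF Z that]] Uupd by (metis DiffD2)+
        ultimately show ?thesis using gB[OF faces_lact[OF Z b]] by simp
      next
        case 2
        \<comment> \<open>Here \<open>p\<close> turns out to be the last index of \<open>V\<close>
          and \<open>p'\<close> its successor, so that \<open>b\<close> passes from the right of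
          \<open>g Z\<close> to the entry on which \<open>g Z\<close> acts.\<close>
        have "p' \<in> chi_above \<chi> S V"
          using iv[of p'] 2 p chi_less_asym[of \<chi> p p'] by (auto simp: chi_below_def)
        then have s: "p' = s" using first[of p'] btw[OF sS(1)] chi_above[OF 2(1)] by blast
        have "chi_less \<chi> x p" if "x \<in> V" "x \<noteq> p" for x
          using chi_above[OF that(1)] btw[of x] chi_less_total[OF that(2), of \<chi>] that VS s by auto
        then have "is_last \<chi> V p" using 2 by (auto simp: is_last_def)
        from balanced_last[OF g(1) facV[OF Z] b this] have "g ?l = g Z * b" .
        moreover have "\<Phi> (U (g Z * b) ?l) = \<Phi> (U (g Z * b) Z)"
          using 2 sS \<Phi>cong[OF Uf[OF Z B_mult[OF gB[OF Z] b]]] Uupd by (metis DiffD2)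
        moreover have "g ?r = g Z" using gcong[OF Z] 2 by simp
        moreover have "U (g Z) ?r = U (g Z * b) Z"
          unfolding s U_def using lact_lact[OF gB[OF Z] b] by simp
        ultimately show ?thesis by simp
      next
        case 3
        have "p \<in> chi_below \<chi> S V"
          using iv[of p] 3 p chi_less_asym[of \<chi> p p'] by (auto simp: chi_above_def)
        then have chi_below: "\<And>v. v \<in> V \<Longrightarrow> chi_less \<chi> p v" by (simp add: chi_below_def)
        then have ps: "p \<noteq> s" "chi_less \<chi> p s"
          using chi_above[OF v] chi_below[OF v] chi_less_asym chi_less_trans by blast+
        have "chi_less \<chi> p' x" if "x \<in> V" "x \<noteq> p'" for x
          using chi_below[OF that(1)] btw[of x] chi_less_total[OF that(2), of \<chi>] that VS by auto
        then have "is_first \<chi> V p'" using 3 by (auto simp: is_first_def)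
        from balanced_first[OF g(1) facV[OF Z] b this] have "g ?r = b * g Z" .
        moreover have "\<Phi> (U (b * g Z) ?r) = \<Phi> (U (b * g Z) Z)"
          using 3 sS \<Phi>cong[OF Uf[OF Z B_mult[OF b gB[OF Z]]]] Uupd by (metis DiffD2)
        \<comment> \<open>\<open>p\<close> is the predecessor of \<open>V\<close>. Across the closed
          gap, balance of \<open>\<Phi>\<close> turns the action of \<open>b\<close> at
          \<open>p\<close> into the factor \<open>b\<close> in front of \<open>g Z\<close> at
          \<open>s\<close>.\<close>
        moreover have "adjacent \<chi> (S - V) p s"
          unfolding adjacent_def
        proof (intro conjI ballI notI)
          fix x assume x: "x \<in> S - V" "chi_less \<chi> p x \<and> chi_less \<chi> x s"
          then have "x \<in> chi_below \<chi> S V" using iv[of x] first[of x] chi_less_asym[of \<chi> x s]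
            by (metis chi_less_irrefl)
          then show False using btw[of x] x 3 by (auto simp: chi_below_def)
        qed (use ps p 3 sS in auto)
        from balanced_adjacent[OF \<Phi> ZU b this]
        have "\<Phi> (U (g Z) ?l) = \<Phi> (U (b * g Z) Z)"
          using ps lact_lact[OF b gB[OF Z]] by (simp add: Uupd Us) (simp add: U_def)
        ultimately show ?thesis using gcong[OF Z 3(1)] by simp
      next
        case 4
        \<comment> \<open>Otherwise the nonempty \<open>V\<close> would lie between the adjacent
          \<open>p\<close> and \<open>p'\<close>.\<close>
        have s': "p' \<noteq> s"
        proof
          assume "p' = s"
          moreover have "p \<in> chi_below \<chi> S V"
            using iv[of p] 4 p first[of p] \<open>p' = s\<close> chi_less_asym[of \<chi> p s]
            by (metis DiffI chi_less_irrefl)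
          ultimately show False using btw[of v] v VS chi_above[OF v] by (auto simp: chi_below_def)
        qed
        have "adjacent \<chi> (S - V) p p'" by (rule adjacent_subset[OF adj]) (use 4 p in auto)
        from balanced_adjacent[OF \<Phi> ZU b this]
        have "\<Phi> ((U (g Z) Z)(p := ract X (\<chi> p) (U (g Z) Z p) b)) = \<Phi> (U (g Z) ?r)"
          using s' by (simp add: Uupd Us)
        moreover have "(U (g Z) Z)(p := ract X (\<chi> p) (U (g Z) Z p) b) = U (g Z) ?l"
          by (cases "p = s") (simp_all add: U_def lact_ract fun_upd_twist)
        ultimately show ?thesis using gcong[OF Z] 4 by simp
      qed
    qed
  qed
qed

text \<open>The two removals interact only if the successor of \<open>V\<close> belongs to
  \<open>V'\<close>. Removing \<open>V\<close> first then multiplies \<open>g' Z\<close> by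
  \<open>g Z\<close> from the left, and the product acts on the successor of \<open>V'\<close>;
  removing \<open>V'\<close> first makes that same entry the successor of \<open>V\<close>, and the
  two actions compose to the same product.\<close>

lemma graft_commute_ordered:
  assumes fin: "finite S" and V: "chi_interval \<chi> S V" "V \<noteq> {}" and V': "chi_interval \<chi> S V'" "V' \<noteq> {}"
    and less: "\<And>v v'. v \<in> V \<Longrightarrow> v' \<in> V' \<Longrightarrow> chi_less \<chi> v v'"
    and g: "balanced X \<chi> V g" "\<And>Z. Z \<in> faces X \<chi> V \<Longrightarrow> g Z \<in> B"
    and g': "balanced X \<chi> V' g'" "\<And>Z. Z \<in> faces X \<chi> V' \<Longrightarrow> g' Z \<in> B"
    and \<Phi>: "balanced X \<chi> (S - V - V') \<Phi>" and Z: "Z \<in> faces X \<chi> S"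
  shows "graft X \<chi> S V g (graft X \<chi> (S - V) V' g' \<Phi>) Z =
    graft X \<chi> S V' g' (graft X \<chi> (S - V') V g \<Phi>) Z"
proof -
  have sub: "V \<subseteq> S" "V' \<subseteq> S" using V V' by (simp_all add: chi_interval_def)
  have disj: "V \<inter> V' = {}" using less chi_less_irrefl by blast
  obtain v v' where v: "v \<in> V" "v' \<in> V'" using V V' by blast
  have aV': "chi_above \<chi> (S - V) V' = chi_above \<chi> S V'"
    using less[of _ v'] v chi_less_asym[of \<chi>] by (auto simp: chi_above_def)
  have aV: "chi_above \<chi> (S - V') V = chi_above \<chi> S V - V'" by (auto simp: chi_above_def)
  have V'chi_above: "V' \<subseteq> chi_above \<chi> S V" using less sub by (auto simp: chi_above_def)
  have ZV: "Z \<in> faces X \<chi> V" and ZV': "Z \<in> faces X \<chi> V'" and ZD: "Z \<in> faces X \<chi> (S - V - V')"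
    using Z sub by (auto simp: faces_def)
  have cB: "g Z \<in> B" "g' Z \<in> B" using g g' ZV ZV' by blast+
  obtain s where s: "is_first \<chi> (chi_above \<chi> S V) s"
    using chi_above_cases[OF fin, of \<chi> V] V'chi_above v by blast
  have sS: "s \<in> S" "s \<notin> V" and first: "\<And>x. x \<in> chi_above \<chi> S V \<Longrightarrow> x \<noteq> s \<Longrightarrow> chi_less \<chi> s x"
    using s by (auto simp: is_first_def chi_above_def)
  let ?Z = "Z(s := lact X (\<chi> s) (g Z) (Z s))"
  have gc: "g (Z(i := z)) = g Z" if "i \<notin> V" for i z
    using balanced_upd[OF g(1) ZV that] .
  have gc': "g' (Z(i := z)) = g' Z" if "i \<notin> V'" for i z
    using balanced_upd[OF g'(1) ZV' that] .
  have aboveV: "i \<notin> V'" "i \<notin> V" "i \<in> S" if "is_first \<chi> (chi_above \<chi> S V') i" for i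
    using that less[of i v'] v chi_less_asym[of \<chi> i v'] by (auto simp: is_first_def chi_above_def)
  show ?thesis
  proof (cases "s \<in> V'")
    case True
    have "is_first \<chi> V' s" using True first V'chi_above by (auto simp: is_first_def)
    then have gs: "g' ?Z = g Z * g' Z" using balanced_first[OF g'(1) ZV' cB(1)] by simp
    \<comment> \<open>\<open>V\<close> and \<open>V'\<close> are contiguous in this case, so without
      \<open>V'\<close> the same indices lie above \<open>V\<close> as above
      \<open>V'\<close>.\<close>
    have eq: "chi_above \<chi> (S - V') V = chi_above \<chi> S V'"
    proof (unfold aV, intro equalityI subsetI)
      fix x assume x: "x \<in> chi_above \<chi> S V - V'"
      then have "chi_less \<chi> s x" using first[of x] True by blast
      then show "x \<in> chi_above \<chi> S V'"
        using chi_interval_cases[OF V'(1), of x] x True chi_less_asym[of \<chi> s x]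
        by (auto simp: chi_above_def chi_below_def)
    next
      fix x assume "x \<in> chi_above \<chi> S V'"
      then show "x \<in> chi_above \<chi> S V - V'"
        using less v(2) chi_less_trans[of \<chi> _ v' x] by (auto simp: chi_above_def)
    qed
    show ?thesis
    proof (cases rule: chi_above_cases[OF fin, of \<chi> V'])
      case 1
      have "\<Phi> ?Z = \<Phi> Z"
        using True by (intro balanced_upd[OF \<Phi> ZD]) simp
      then show ?thesis
        using 1 eq by (simp add: graft_succ[OF s] graft_top aV' gs mult.assoc)
    next
      case (2 s')
      have s': "s' \<notin> V'" "s' \<notin> V" "s' \<in> S" using aboveV[OF 2] by auto
      have ne: "s' \<noteq> s" using s' True by auto
      have "\<Phi> (?Z(s' := lact X (\<chi> s') (g Z * g' Z) (Z s'))) =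
          \<Phi> (Z(s' := lact X (\<chi> s') (g Z * g' Z) (Z s')))"
        using True faces_lact[OF ZD B_mult[OF cB]] by (intro balanced_cong[OF \<Phi>, symmetric]) auto
      then show ?thesis
        using 2 eq ne s' by (simp add: graft_succ[OF s] graft_succ[of \<chi> _ _ s'] aV' gs gc lact_lact cB)
    qed
  next
    case False
    have first': "is_first \<chi> (chi_above \<chi> (S - V') V) s"
      using s False by (auto simp: aV is_first_def)
    show ?thesis
    proof (cases rule: chi_above_cases[OF fin, of \<chi> V'])
      case 1
      then show ?thesis
        using False by (simp add: graft_succ[OF s] graft_succ[OF first'] graft_top aV' gc')
    next
      case (2 s')
      have s': "s' \<notin> V'" "s' \<notin> V" "s' \<in> S" using aboveV[OF 2] by auto
      have "s' \<noteq> s"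
        using 2 first[of v'] V'chi_above v False chi_less_asym[of \<chi> s v']
        by (auto simp: is_first_def chi_above_def)
      then show ?thesis
        using 2 s' False
        by (simp add: graft_succ[OF s] graft_succ[OF first'] graft_succ[of \<chi> _ _ s'] aV' gc' gc fun_upd_twist)
    qed
  qed
qed

text \<open>Of two disjoint nonempty intervals of a total order one lies entirely below the
  other.\<close>

lemma graft_commute:
  assumes fin: "finite S" and V: "chi_interval \<chi> S V" "V \<noteq> {}" and V': "chi_interval \<chi> S V'" "V' \<noteq> {}"
    and disj: "V \<inter> V' = {}"
    and g: "balanced X \<chi> V g" "\<And>Z. Z \<in> faces X \<chi> V \<Longrightarrow> g Z \<in> B"
    and g': "balanced X \<chi> V' g'" "\<And>Z. Z \<in> faces X \<chi> V' \<Longrightarrow> g' Z \<in> B"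
    and \<Phi>: "balanced X \<chi> (S - V - V') \<Phi>" and Z: "Z \<in> faces X \<chi> S"
  shows "graft X \<chi> S V g (graft X \<chi> (S - V) V' g' \<Phi>) Z =
    graft X \<chi> S V' g' (graft X \<chi> (S - V') V g \<Phi>) Z"
proof -
  obtain v v' where v: "v \<in> V" "v' \<in> V'" using V V' by blast
  have sub: "V \<subseteq> S" "V' \<subseteq> S" using V V' by (simp_all add: chi_interval_def)
  have \<Phi>': "balanced X \<chi> (S - V' - V) \<Phi>" using \<Phi> by (simp add: Diff_eq Int_ac)
  show ?thesis
  proof (cases "chi_less \<chi> v v'")
    case True
    have "chi_less \<chi> w w'" if "w \<in> V" "w' \<in> V'" for w w'
    proof -
      have "chi_less \<chi> w v'"
        using chi_interval_cases[OF V(1), of v'] sub disj v True that chi_less_asym[of \<chi> v v']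
        by (auto simp: chi_above_def chi_below_def)
      then show ?thesis
        using chi_interval_cases[OF V'(1), of w] sub disj v that chi_less_asym[of \<chi> w v']
        by (auto simp: chi_above_def chi_below_def)
    qed
    then show ?thesis by (intro graft_commute_ordered assms) auto
  next
    case False
    then have True: "chi_less \<chi> v' v" using chi_less_total[of v v' \<chi>] v disj by auto
    have "chi_less \<chi> w' w" if "w \<in> V" "w' \<in> V'" for w w'
    proof -
      have "chi_less \<chi> v' w"
        using chi_interval_cases[OF V(1), of v'] sub disj v True that chi_less_asym[of \<chi> v' v]
        by (auto simp: chi_above_def chi_below_def)
      then show ?thesis
        using chi_interval_cases[OF V'(1), of w] sub disj v that chi_less_asym[of \<chi> v' w]
        by (auto simp: chi_above_def chi_below_def)
    qed
    then show ?thesis by (intro graft_commute_ordered[symmetric] assms \<Phi>') auto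
  qed
qed

end

section \<open>Moments\<close>

lemma BNC_block:
  assumes "\<pi> \<in> BNC \<chi> S" "V \<in> \<pi>"
  shows "V \<subseteq> S" "V \<noteq> {}"
  using assms by (auto simp: BNC_def partition_on_def)

lemma BNC_disjoint: "\<pi> \<in> BNC \<chi> S \<Longrightarrow> V \<in> \<pi> \<Longrightarrow> W \<in> \<pi> \<Longrightarrow> x \<in> V \<Longrightarrow> x \<in> W \<Longrightarrow> V = W"
  by (auto simp: BNC_def partition_on_def disjoint_def)

lemma BNC_cover: "\<pi> \<in> BNC \<chi> S \<Longrightarrow> x \<in> S \<Longrightarrow> \<exists>V\<in>\<pi>. x \<in> V"
  by (auto simp: BNC_def partition_on_def)

lemma BNC_finite: "\<pi> \<in> BNC \<chi> S \<Longrightarrow> finite S \<Longrightarrow> finite \<pi>"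
  by (auto simp: BNC_def intro: finite_elements)

lemma BNC_finite_block: "\<pi> \<in> BNC \<chi> S \<Longrightarrow> finite S \<Longrightarrow> V \<in> \<pi> \<Longrightarrow> finite V"
  by (rule finite_subset[OF BNC_block(1)])

lemma BNC_subset:
  assumes "\<pi> \<in> BNC \<chi> S" "\<rho> \<subseteq> \<pi>"
  shows "\<rho> \<in> BNC \<chi> (\<Union>\<rho>)"
proof -
  have "disjoint \<rho>" "{} \<notin> \<rho>"
    using assms unfolding BNC_def partition_on_def disjoint_def by blast+
  then show ?thesis using assms chi_noncrossing_subset[of \<chi> \<pi> \<rho>] by (simp add: BNC_def partition_on_def)
qed

lemma BNC_remove:
  assumes "\<pi> \<in> BNC \<chi> S" "V \<in> \<pi>"
  shows "\<pi> - {V} \<in> BNC \<chi> (S - V)"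
proof -
  have "\<Union>(\<pi> - {V}) = S - V"
    using assms(1) BNC_disjoint[OF assms(1,2)] assms(2) by (auto simp: BNC_def partition_on_def)
  then show ?thesis using BNC_subset[OF assms(1), of "\<pi> - {V}"] by auto
qed

lemma BNC_whole: "S \<noteq> {} \<Longrightarrow> {S} \<in> BNC \<chi> S"
  by (auto simp: BNC_def partition_on_def chi_noncrossing_def)

lemma BNC_whole_iff:
  assumes "\<pi> \<in> BNC \<chi> S" "S \<in> \<pi>"
  shows "\<pi> = {S}"
proof -
  have "W = S" if "W \<in> \<pi>" for W
    using BNC_block[OF assms(1) that] BNC_disjoint[OF assms(1) that assms(2)] by blast
  then show ?thesis using assms(2) by blast
qed

lemma BNC_empty_iff: "\<pi> \<in> BNC \<chi> S \<Longrightarrow> \<pi> = {} \<longleftrightarrow> S = {}"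
  by (auto simp: BNC_def partition_on_def)

lemma BNC_singleton: "BNC \<chi> {q} = {{{q}}}"
proof -
  have "\<pi> = {{q}}" if \<pi>: "\<pi> \<in> BNC \<chi> {q}" for \<pi>
  proof -
    obtain V where V: "V \<in> \<pi>" "q \<in> V" using BNC_cover[OF \<pi>] by blast
    then have "V = {q}" using BNC_block(1)[OF \<pi> V(1)] by blast
    then show ?thesis using BNC_whole_iff[OF \<pi>] V by blast
  qed
  then show ?thesis using BNC_whole[of "{q}" \<chi>] by blast
qed

lemma Min_block_inj:
  assumes "\<pi> \<in> BNC \<chi> S" "finite S" "V \<in> \<pi>" "W \<in> \<pi>" "Min V = Min W"
  shows "V = W"
proof -
  have "Min V \<in> V" "Min W \<in> W"
    by (intro Min_in BNC_finite_block[OF assms(1,2)] BNC_block(2)[OF assms(1)] assms(3,4))+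
  then show ?thesis using BNC_disjoint[OF assms(1,3,4)] assms(5) by metis
qed

lemma last_block_max:
  assumes "finite \<rho>" "W \<in> \<rho>"
  shows "Min W \<le> Min (last_block \<rho>)"
  using arg_max_nat_lemma[of "\<lambda>V. V \<in> \<rho>" W Min "Suc (Max (Min ` \<rho>))"] assms
  unfolding last_block_def arg_max_on_def by (auto simp: less_Suc_eq_le)

text \<open>Distinct blocks have distinct minima, so the maximiser behind \<open>last_block\<close>
  is unique and survives the removal of other blocks.\<close>

lemma last_block_subset:
  assumes "\<pi> \<in> BNC \<chi> S" "finite S" "\<rho> \<subseteq> \<pi>" "\<rho>' \<subseteq> \<rho>" "last_block \<rho> \<in> \<rho>'"
  shows "last_block \<rho>' = last_block \<rho>"
proof (rule Min_block_inj[OF assms(1,2)])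
  have fin: "finite \<rho>" "finite \<rho>'"
    using finite_subset[OF _ BNC_finite[OF assms(1,2)]] assms(3,4) by auto
  have l: "last_block \<rho>' \<in> \<rho>'" using assms(5) by (intro last_block_in[OF fin(2)]) auto
  then show "last_block \<rho>' \<in> \<pi>" "last_block \<rho> \<in> \<pi>" using assms by blast+
  show "Min (last_block \<rho>') = Min (last_block \<rho>)"
    using last_block_max[OF fin(1)] last_block_max[OF fin(2) assms(5)] l assms(4)
    by (meson antisym subsetD)
qed

text \<open>A \<open>w\<close> outside the stretch from \<open>a\<close> to \<open>c\<close> would
  give one of the crossings \<open>w\<close>, \<open>a\<close>, \<open>b\<close>, \<open>c\<close>
  and \<open>a\<close>, \<open>b\<close>, \<open>c\<close>, \<open>w\<close>.\<close>

lemma nested_block: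
  assumes "\<pi> \<in> BNC \<chi> S" "V \<in> \<pi>" "W \<in> \<pi>" "V \<noteq> W"
    and "a \<in> V" "c \<in> V" "b \<in> W" "chi_less \<chi> a b" "chi_less \<chi> b c" "w \<in> W"
  shows "chi_less \<chi> a w" "chi_less \<chi> w c"
proof -
  have nc: "chi_noncrossing \<chi> \<pi>" using assms(1) by (simp add: BNC_def)
  have ne: "w \<noteq> a" "w \<noteq> c"
    using assms BNC_disjoint[OF assms(1,2,3)] by auto
  have "\<not> chi_less \<chi> w a"
    using chi_noncrossingD[OF nc assms(3,2) \<open>w \<in> W\<close> \<open>a \<in> V\<close> \<open>b \<in> W\<close> \<open>c \<in> V\<close>] assms by auto
  then show "chi_less \<chi> a w" using chi_less_total ne by blast
  have "\<not> chi_less \<chi> c w"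
    using chi_noncrossingD[OF nc assms(2,3) \<open>a \<in> V\<close> \<open>b \<in> W\<close> \<open>c \<in> V\<close> \<open>w \<in> W\<close>] assms by auto
  then show "chi_less \<chi> w c" using chi_less_total ne by blast
qed

text \<open>A block nested in \<open>V\<close> lies to the right of \<open>Min V\<close> in the usual order, whichever side its
  minimum is on.\<close>

lemma inner_block_interval:
  assumes \<pi>: "\<pi> \<in> BNC \<chi> S" and fin: "finite S" and V: "V \<in> \<pi>"
    and max: "\<And>W. W \<in> \<pi> \<Longrightarrow> W \<noteq> V \<Longrightarrow> Min W \<le> Min V \<or> chi_min \<chi> S \<in> W"
  shows "chi_interval \<chi> S V"
proof (rule chi_intervalI)
  show "V \<subseteq> S" by (rule BNC_block(1)[OF \<pi> V])
  fix a b c assume abc: "a \<in> V" "c \<in> V" "b \<in> S" "chi_less \<chi> a b" "chi_less \<chi> b c"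
  show "b \<in> V"
  proof (rule ccontr)
    assume "b \<notin> V"
    obtain W where W: "W \<in> \<pi>" "b \<in> W" using BNC_cover[OF \<pi> abc(3)] by blast
    then have "W \<noteq> V" using \<open>b \<notin> V\<close> by blast
    note nest = nested_block[OF \<pi> V W(1) \<open>W \<noteq> V\<close>[symmetric] abc(1,2) W(2) abc(4,5)]
    have finW: "finite W" "W \<noteq> {}" "finite V" 
      using BNC_finite_block[OF \<pi> fin] BNC_block(2)[OF \<pi>] W(1) V by auto
    have "a \<in> S" using BNC_block(1)[OF \<pi> V] abc(1) by blast
    \<comment> \<open>The assumption \<open>max\<close> exempts the block of the least index, as
      \<open>ccumulant\<close> requires; that block cannot lie strictly between two elements of
      \<open>V\<close>.\<close>
    then have "chi_min \<chi> S \<notin> W"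
      using nest(1)[of "chi_min \<chi> S"] chi_min_less[of S a \<chi>] fin chi_less_asym[of \<chi> a "chi_min \<chi> S"]
      by (cases "a = chi_min \<chi> S") auto
    \<comment> \<open>If \<open>Min W\<close> is on the left, then so is \<open>a\<close>, and it is
      the smaller of the two; if \<open>Min W\<close> is on the right, the same holds for
      \<open>c\<close>.\<close>
    moreover have "a < Min W \<or> c < Min W"
      using nest[OF Min_in[OF finW(1,2)]] by (cases "\<chi> (Min W)") (auto simp: chi_less_def)
    then have "Min V < Min W"
      using Min_le[OF finW(3) abc(1)] Min_le[OF finW(3) abc(2)] by linarith
    ultimately show False using max[OF W(1) \<open>W \<noteq> V\<close>] by auto
  qed
qed

lemma last_block_interval:
  assumes "\<pi> \<in> BNC \<chi> S" "finite S" "\<pi> \<noteq> {}"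
  shows "chi_interval \<chi> S (last_block \<pi>)"
  using BNC_finite[OF assms(1,2)] assms(3)
  by (intro inner_block_interval[OF assms(1,2)] last_block_in disjI1 last_block_max)

text \<open>In contrast to \<open>moment\<close>, the value of the removed block always acts on the successor of
  the block in the order \<open>\<prec>\<^sub>\<chi>\<close>, so that all entries stay in their faces.\<close>

function imoment :: "('a::monoid_mult, 'd::monoid_mult, 't) ncs \<Rightarrow> (nat \<Rightarrow> side) \<Rightarrow>
    nat set \<Rightarrow> nat set set \<Rightarrow> (nat \<Rightarrow> 'a) \<Rightarrow> 'd" where
  "imoment X \<chi> S \<pi> Z =
     (if \<not> (finite S \<and> S \<noteq> {} \<and> \<pi> \<in> BNC \<chi> S) then 1
      else let V = last_block \<pi> in
        graft X \<chi> S V (\<lambda>Y. EE X (oprod Y V)) (\<lambda>Y. imoment X \<chi> (S - V) (\<pi> - {V}) Y) Z)"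
  by pat_completeness auto
termination
proof (relation "measure (\<lambda>(X, \<chi>, S, \<pi>, Z). card S)", goal_cases)
  case (2 X \<chi> S \<pi> Z V Y)
  then have dom: "finite S" "S \<noteq> {}" "\<pi> \<in> BNC \<chi> S" and V: "V = last_block \<pi>"
    by simp_all
  have "partition_on S \<pi>" "\<pi> \<noteq> {}" using dom by (auto simp: BNC_def partition_on_def)
  then have "card (S - V) < card S"
    unfolding V using dom by (intro last_block_shrinks) auto
  then show ?case by simp
qed auto

declare imoment.simps [simp del]

text \<open>The default value 1 of \<open>imoment\<close> plays the part of the empty product and
  supplies the assumption \<open>unit\<close> of \<open>balanced_graft\<close>.\<close>

lemma imoment_empty [simp]: "imoment X \<chi> {} \<pi> Z = 1"
  by (simp add: imoment.simps)

lemma imoment_last: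
  assumes "finite S" "S \<noteq> {}" "\<pi> \<in> BNC \<chi> S"
  shows "imoment X \<chi> S \<pi> = graft X \<chi> S (last_block \<pi>) (\<lambda>Z. EE X (oprod Z (last_block \<pi>)))
    (imoment X \<chi> (S - last_block \<pi>) (\<pi> - {last_block \<pi>}))"
  using assms by (intro ext) (simp add: imoment.simps[of X \<chi> S \<pi>] Let_def)

section \<open>Balance and range of the interval moments, and free choice of the block removed
  first\<close>

context ncs_pair
begin

lemma balanced_imoment:
  "finite S \<Longrightarrow> \<pi> \<in> BNC \<chi> S \<Longrightarrow> balanced X \<chi> S (imoment X \<chi> S \<pi>)"
proof (induction "card S" arbitrary: S \<pi> rule: less_induct)
  case less
  show ?case
  proof (cases "S = {}")
    case True
    then show ?thesis by (simp add: balanced_def is_first_def is_last_def adjacent_def)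
  next
    case False
    let ?V = "last_block \<pi>"
    have ne: "\<pi> \<noteq> {}" using False less.prems by (simp add: BNC_empty_iff)
    have V: "?V \<in> \<pi>" by (rule last_block_in[OF BNC_finite[OF less.prems(2,1)] ne])
    note Vb = BNC_block[OF less.prems(2) V]
    have "card (S - ?V) < card S"
      using Vb less.prems by (intro psubset_card_mono) auto
    then have "balanced X \<chi> (S - ?V) (imoment X \<chi> (S - ?V) (\<pi> - {?V}))"
      using less V by (intro less.hyps BNC_remove) auto
    then show ?thesis
      unfolding imoment_last[OF less.prems(1) False less.prems(2)]
      using less.prems Vb ne finite_subset[OF Vb(1)]
      by (intro balanced_graft last_block_interval balanced_E E_range) auto
  qed
qed

lemma imoment_range: "finite S \<Longrightarrow> \<pi> \<in> BNC \<chi> S \<Longrightarrow> imoment X \<chi> S \<pi> Z \<in> B"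
proof (induction "card S" arbitrary: S \<pi> Z rule: less_induct)
  case less
  show ?case
  proof (cases "S = {}")
    case True
    then show ?thesis by (simp add: B_one)
  next
    case False
    let ?V = "last_block \<pi>"
    have ne: "\<pi> \<noteq> {}" using False less.prems by (simp add: BNC_empty_iff)
    have V: "?V \<in> \<pi>" by (rule last_block_in[OF BNC_finite[OF less.prems(2,1)] ne])
    note Vb = BNC_block[OF less.prems(2) V]
    have "card (S - ?V) < card S"
      using Vb less.prems by (intro psubset_card_mono) auto
    then have "imoment X \<chi> (S - ?V) (\<pi> - {?V}) Y \<in> B" for Y
      using less V by (intro less.hyps BNC_remove) auto
    then show ?thesis
      unfolding imoment_last[OF less.prems(1) False less.prems(2)] graft_def
      by (auto intro: B_mult E_range)
  qed
qed

text \<open>Frees \<open>imoment\<close> from the order of removal: unfold the last block, remove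
  \<open>V\<close> below it by induction, and exchange the two by
  \<open>graft_commute\<close>.\<close>

lemma imoment_remove:
  "finite S \<Longrightarrow> \<pi> \<in> BNC \<chi> S \<Longrightarrow> V \<in> \<pi> \<Longrightarrow> chi_interval \<chi> S V \<Longrightarrow> Z \<in> faces X \<chi> S \<Longrightarrow>
    imoment X \<chi> S \<pi> Z = graft X \<chi> S V (\<lambda>Z. EE X (oprod Z V)) (imoment X \<chi> (S - V) (\<pi> - {V})) Z"
proof (induction "card S" arbitrary: S \<pi> Z rule: less_induct)
  case less
  note fin = less.prems(1) and \<pi> = less.prems(2) and V = less.prems(3)
  let ?W = "last_block \<pi>"
  have S: "S \<noteq> {}" using BNC_block[OF \<pi> V] by auto
  have ne: "\<pi> \<noteq> {}" using V by blast
  have W: "?W \<in> \<pi>" by (rule last_block_in[OF BNC_finite[OF less.prems(2,1)] ne])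
  note Vb = BNC_block[OF \<pi> V] and Wb = BNC_block[OF \<pi> W]
  show ?case
  proof (cases "V = ?W")
    case True
    then show ?thesis using imoment_last[OF fin S \<pi>, of X] by simp
  next
    case False
    have disj: "?W \<inter> V = {}" using BNC_disjoint[OF \<pi> V W] False by blast
    have Wint: "chi_interval \<chi> S ?W" by (rule last_block_interval[OF \<pi> fin ne])
    have Vint: "chi_interval \<chi> (S - ?W) V"
      by (rule chi_interval_subset[OF less.prems(4)]) (use Vb disj in auto)
    have card: "card (S - ?W) < card S" using Wb fin by (intro psubset_card_mono) auto
    have comm: "S - V - ?W = S - ?W - V" "\<pi> - {V} - {?W} = \<pi> - {?W} - {V}" by auto
    have \<pi>WV: "\<pi> - {?W} - {V} \<in> BNC \<chi> (S - ?W - V)"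
      using BNC_remove[OF BNC_remove[OF \<pi> W], of V] V False by auto
    have finVW: "finite V" "finite ?W" using finite_subset[OF _ fin] Vb Wb by auto
    have "imoment X \<chi> S \<pi> Z =
      graft X \<chi> S ?W (\<lambda>Z. EE X (oprod Z ?W)) (imoment X \<chi> (S - ?W) (\<pi> - {?W})) Z"
      using imoment_last[OF fin S \<pi>, of X] by simp
    also have "\<dots> = graft X \<chi> S ?W (\<lambda>Z. EE X (oprod Z ?W))
      (graft X \<chi> (S - ?W) V (\<lambda>Z. EE X (oprod Z V)) (imoment X \<chi> (S - ?W - V) (\<pi> - {?W} - {V}))) Z"
    proof (rule graft_cong)
      fix Y assume "Y \<in> faces X \<chi> (S - ?W)"
      then show "imoment X \<chi> (S - ?W) (\<pi> - {?W}) Y = graft X \<chi> (S - ?W) V (\<lambda>Z. EE X (oprod Z V))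
          (imoment X \<chi> (S - ?W - V) (\<pi> - {?W} - {V})) Y"
        using fin BNC_remove[OF \<pi> W] V False Vint
        by (intro less.hyps[OF card]) auto
    qed (use less.prems E_range in auto)
    also have "\<dots> = graft X \<chi> S V (\<lambda>Z. EE X (oprod Z V)) (graft X \<chi> (S - V) ?W (\<lambda>Z. EE X (oprod Z ?W))
        (imoment X \<chi> (S - ?W - V) (\<pi> - {?W} - {V}))) Z"
      using fin \<pi>WV finVW
      by (intro graft_commute Wint Wb less.prems Vb disj balanced_E E_range balanced_imoment) auto
    also have "graft X \<chi> (S - V) ?W (\<lambda>Z. EE X (oprod Z ?W)) (imoment X \<chi> (S - ?W - V) (\<pi> - {?W} - {V})) =
        imoment X \<chi> (S - V) (\<pi> - {V})"
    proof -
      have lb: "last_block (\<pi> - {V}) = ?W"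
        using W False by (intro last_block_subset[OF \<pi> fin]) auto
      have "S - V \<noteq> {}" using Wb disj by blast
      from imoment_last[OF _ this BNC_remove[OF \<pi> V], of X, unfolded lb comm] show ?thesis
        using fin by simp
    qed
    finally show ?thesis .
  qed
qed

end

lemma block_of_eq: "\<pi> \<in> BNC \<chi> S \<Longrightarrow> V \<in> \<pi> \<Longrightarrow> i \<in> V \<Longrightarrow> block_of \<pi> i = V"
  unfolding block_of_def by (rule the_equality) (simp, elim conjE, rule BNC_disjoint)

context ncs_pair
begin

text \<open>The recursion for \<open>moment\<close> may put a left operator on a right entry and vice versa, so that
  entries leave their faces. It agrees with the recursion for \<open>imoment\<close> because only the products of
  the entries of a block from some position \<open>t\<close> on matter, and these only up to \<open>same_tail\<close>.\<close>

lemma moment_imoment_tails: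
  assumes "finite S" "S \<noteq> {}" "\<pi> \<in> BNC \<chi> S" "Y \<in> faces X \<chi> S"
    and "\<And>i. i \<in> S \<Longrightarrow> i < t \<Longrightarrow> Z i = Y i"
    and "\<And>W. W \<in> \<pi> \<Longrightarrow> same_tail (EE X) (oprod Z {i\<in>W. t \<le> i}) (oprod Y {i\<in>W. t \<le> i})"
    and "\<And>W. W \<in> \<pi> \<Longrightarrow> Min W \<le> t"
  shows "moment X \<chi> S Z \<pi> = imoment X \<chi> S \<pi> Y"
  using assms
proof (induction "card S" arbitrary: S \<pi> Z Y t rule: less_induct)
  case less
  note fin = less.prems(1) and \<pi> = less.prems(3) and Y = less.prems(4)
  define V where "V = last_block \<pi>"
  define m where "m = Min V"
  define c where "c = EE X (oprod Y V)"
  have ne: "\<pi> \<noteq> {}" using BNC_empty_iff[OF \<pi>] less.prems(2) by simp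
  have V: "V \<in> \<pi>" unfolding V_def by (rule last_block_in[OF BNC_finite[OF \<pi> fin] ne])
  note Vb = BNC_block[OF \<pi> V]
  have finV: "finite V" using finite_subset[OF Vb(1) fin] .
  have mV: "m \<in> V" unfolding m_def using finV Vb(2) by (rule Min_in)
  have mle: "m \<le> i" if "i \<in> V" for i using that finV by (simp add: m_def)
  have mt: "m \<le> t" unfolding m_def by (rule less.prems(7)[OF V])
  have cB: "c \<in> B" unfolding c_def by (rule E_range)
  have Vint: "chi_interval \<chi> S V" unfolding V_def by (rule last_block_interval[OF \<pi> fin ne])
  note cases = chi_interval_cases[OF Vint]
  \<comment> \<open>Lowering the threshold from \<open>t\<close> to \<open>m\<close> only puts equal
    factors in front, which \<open>same_tail\<close> absorbs.\<close>
  have tails: "same_tail (EE X) (oprod Z {i\<in>W. m \<le> i}) (oprod Y {i\<in>W. m \<le> i})" if W: "W \<in> \<pi>" for W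
  proof -
    have finW: "finite W" by (rule BNC_finite_block[OF \<pi> fin W])
    have split: "{i\<in>W. m \<le> i} = {i\<in>W. m \<le> i \<and> i < t} \<union> {i\<in>W. t \<le> i}" using mt by auto
    have un: "oprod Q {i\<in>W. m \<le> i} = oprod Q {i\<in>W. m \<le> i \<and> i < t} * oprod Q {i\<in>W. t \<le> i}"
      for Q :: "nat \<Rightarrow> 'a"
      unfolding split using finW by (intro oprod_Un) auto
    have "oprod Z {i\<in>W. m \<le> i \<and> i < t} = oprod Y {i\<in>W. m \<le> i \<and> i < t}"
      using BNC_block(1)[OF \<pi> W] less.prems(5) by (intro oprod_cong) auto
    then show ?thesis unfolding un using less.prems(6)[OF W] by (simp add: same_tail_mult)
  qed
  have "{i\<in>V. m \<le> i} = V" using mle by auto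
  then have c: "EE X (oprod Z V) = c"
    using same_tailD[OF tails[OF V]] by (simp add: c_def)
  have im: "imoment X \<chi> S \<pi> Y =
      graft X \<chi> S V (\<lambda>Z. EE X (oprod Z V)) (imoment X \<chi> (S - V) (\<pi> - {V})) Y"
    using imoment_last[OF fin less.prems(2) \<pi>, of X] by (simp add: V_def)
  show ?case
  proof (cases "\<pi> = {S}")
    case True
    then have "V = S" using V by simp
    have "chi_above \<chi> S S = {}" using chi_less_irrefl unfolding chi_above_def by blast
    then have "imoment X \<chi> S \<pi> Y = c"
      unfolding im using \<open>V = S\<close> by (simp add: graft_top c_def)
    moreover have "moment X \<chi> S Z \<pi> = c"
      using True c fin less.prems(2) \<pi> \<open>V = S\<close> by (subst moment.simps) simp
    ultimately show ?thesis by simp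
  next
    case False
    have VS: "V \<noteq> S" using BNC_whole_iff[OF \<pi>] V False by auto
    have SV: "S - V \<noteq> {}" "finite (S - V)" "\<pi> - {V} \<in> BNC \<chi> (S - V)" "card (S - V) < card S"
      using VS Vb fin BNC_remove[OF \<pi> V] by (auto intro!: psubset_card_mono)
    have bal: "balanced X \<chi> (S - V) (imoment X \<chi> (S - V) (\<pi> - {V}))"
      using SV by (intro balanced_imoment)
    have YV: "Y \<in> faces X \<chi> (S - V)" using Y by (rule faces_mono) blast
    have Wb: "W \<subseteq> S - V" "W \<noteq> {}" "finite W" "W \<in> \<pi>" if "W \<in> \<pi> - {V}" for W
      using BNC_block[OF SV(3) that] finite_subset[OF _ SV(2)] that by auto
    have unf: "moment X \<chi> S Z \<pi> =
      (if V = {i \<in> S. m \<le> i} then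
        let p = Max {i \<in> S. i < m} in moment X \<chi> (S - V) (Z(p := Z p * side_op X (\<chi> m) c)) (\<pi> - {V})
      else
        let J = {i \<in> S. m < i} - V;
            W = block_of \<pi> (case \<chi> m of Lft \<Rightarrow> chi_min \<chi> J | Rgt \<Rightarrow> chi_max \<chi> J);
            k = Min {i \<in> W. m < i}
        in moment X \<chi> (S - V) (Z(k := side_op X (\<chi> m) c * Z k)) (\<pi> - {V}))"
    proof (subst moment.simps, subst if_not_P)
      show "\<not> \<not> (finite S \<and> S \<noteq> {} \<and> \<pi> \<in> BNC \<chi> S)" using fin less.prems(2) \<pi> by simp
    qed (simp only: if_not_P[OF False] Let_def c flip: V_def m_def)
    show ?thesis
    proof (cases "V = {i\<in>S. m \<le> i}")
      case True
      define p where "p = Max {i\<in>S. i < m}"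
      have SVm: "{i\<in>S. i < m} = S - V" using True by auto
      have p: "p \<in> S - V" using Max_in[OF SV(2,1)] by (simp add: p_def SVm)
      have pm: "p < m" using p True by auto
      have pmax: "i \<le> p" if "i \<in> S - V" for i using Max_ge[OF SV(2) that] by (simp add: p_def SVm)
      \<comment> \<open>All remaining indices are smaller than those of \<open>V\<close>. So a left
        \<open>p\<close> is the \<open>chi_less\<close>-predecessor of \<open>V\<close> and a right
        \<open>p\<close> its successor, whichever side \<open>m\<close> is on.\<close>
      define Y' where "Y' = Y(p := (case \<chi> p of Lft \<Rightarrow> ract X Lft (Y p) c | Rgt \<Rightarrow> lact X Rgt c (Y p)))"
      have step: "moment X \<chi> S Z \<pi> =
          moment X \<chi> (S - V) (Z(p := Z p * side_op X (\<chi> m) c)) (\<pi> - {V})"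
        by (simp only: unf if_P[OF True] Let_def p_def)
      have graft: "imoment X \<chi> S \<pi> Y = imoment X \<chi> (S - V) (\<pi> - {V}) Y'"
      proof (cases "\<chi> p")
        case Lft
        have "is_last \<chi> (chi_below \<chi> S V) p"
          unfolding is_last_def
        proof (intro conjI ballI impI)
          have "chi_less \<chi> p v" if "v \<in> V" for v
            using mle[OF that] pm Lft by (cases "\<chi> v") (auto simp: chi_less_def)
          then show "p \<in> chi_below \<chi> S V" using p by (simp add: chi_below_def)
          fix x assume x: "x \<in> chi_below \<chi> S V" "x \<noteq> p"
          then have "x \<in> S - V" "chi_less \<chi> x m" using mV by (auto simp: chi_below_def)
          then show "chi_less \<chi> x p"
            using pmax[of x] pm x(2) Lft by (cases "\<chi> x") (auto simp: chi_less_def)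
        qed
        from graft_pred[where g = "\<lambda>Z. EE X (oprod Z V)", OF fin Vint Vb(2) bal Y E_range this]
        show ?thesis using Lft by (simp add: im Y'_def c_def)
      next
        case Rgt
        have "is_first \<chi> (chi_above \<chi> S V) p"
          unfolding is_first_def
        proof (intro conjI ballI impI)
          have "chi_less \<chi> v p" if "v \<in> V" for v
            using mle[OF that] pm Rgt by (cases "\<chi> v") (auto simp: chi_less_def)
          then show "p \<in> chi_above \<chi> S V" using p by (simp add: chi_above_def)
          fix x assume x: "x \<in> chi_above \<chi> S V" "x \<noteq> p"
          then have "x \<in> S - V" "chi_less \<chi> m x" using mV by (auto simp: chi_above_def)
          then show "chi_less \<chi> p x"
            using pmax[of x] pm x(2) Rgt by (cases "\<chi> x") (auto simp: chi_less_def)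
        qed
        from graft_succ[OF this] show ?thesis using Rgt by (simp add: im Y'_def c_def)
      qed
      show ?thesis
        unfolding step graft
      proof (rule less.hyps[OF SV(4) SV(2,1,3), where t = p])
        show "Y' \<in> faces X \<chi> (S - V)"
          using faces_lact[OF YV cB, of p] faces_ract[OF YV cB, of p]
          by (cases "\<chi> p") (simp_all add: Y'_def)
        show "(Z(p := Z p * side_op X (\<chi> m) c)) i = Y' i" if "i \<in> S - V" "i < p" for i
          using that less.prems(5)[of i] pm mt by (simp add: Y'_def)
        fix W assume W: "W \<in> \<pi> - {V}"
        note Wb = Wb[OF W]
        show "Min W \<le> p" using pmax Min_in[OF Wb(3,2)] Wb(1) by auto
        show "same_tail (EE X) (oprod (Z(p := Z p * side_op X (\<chi> m) c)) {i\<in>W. p \<le> i}) (oprod Y' {i\<in>W. p \<le> i})"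
        proof (cases "p \<in> W")
          case True
          then have "{i\<in>W. p \<le> i} = {p}" using pmax Wb(1) by force
          moreover have "Z p = Y p" using less.prems(5)[of p] p pm mt by simp
          \<comment> \<open>The entry at \<open>p\<close> closes the product of its block, so E does
            not see whether \<open>moment\<close> has put L_c or R_c there.\<close>
          moreover have "same_tail (EE X) (Y p * Lop X c) (Y p * Rop X c)"
              "same_tail (EE X) (Y p * Rop X c) (Y p * Lop X c)"
            using E_right[OF cB] by (simp_all add: same_tail_def flip: mult.assoc)
          ultimately show ?thesis
            by (cases "\<chi> p"; cases "\<chi> m") (simp_all add: Y'_def ract_def lact_def side_op_def)
        next
          case False
          then have "{i\<in>W. p \<le> i} = {}" using pmax Wb(1) by force
          then show ?thesis by (simp only: oprod_empty same_tail_refl)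
        qed
      qed
    next
      case False
      define J where "J = {i\<in>S. m < i} - V"
      \<comment> \<open>This index is the \<open>chi_less\<close>-neighbour of the interval
        \<open>V\<close>: its successor if \<open>m\<close> is on the left, its predecessor if
        \<open>m\<close> is on the right.\<close>
      define s where "s = (case \<chi> m of Lft \<Rightarrow> chi_min \<chi> J | Rgt \<Rightarrow> chi_max \<chi> J)"
      define W where "W = block_of \<pi> s"
      define k where "k = Min {i\<in>W. m < i}"
      have finJ: "finite J" using fin by (simp add: J_def)
      have "J \<noteq> {}"
      proof -
        have "V \<subseteq> {i\<in>S. m \<le> i}" using mle Vb(1) by auto
        then obtain i where "i \<in> S" "m \<le> i" "i \<notin> V" using False by blast
        then have "i \<in> J" using mV by (cases "i = m") (auto simp: J_def)
        then show ?thesis by blast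
      qed
      then have sJ: "s \<in> J" using chi_min_in[OF finJ] chi_max_in[OF finJ] by (auto simp: s_def split: side.split)
      then have s: "s \<in> S" "m < s" "s \<notin> V" by (auto simp: J_def)
      obtain W' where "W' \<in> \<pi>" "s \<in> W'" using BNC_cover[OF \<pi> s(1)] by blast
      then have W: "W \<in> \<pi>" "s \<in> W" using block_of_eq[OF \<pi>] by (simp_all add: W_def)
      have WV: "W \<in> \<pi> - {V}" using W s by auto
      note Wb' = Wb[OF WV]
      define T where "T = {i\<in>W. m \<le> i}"
      have T: "T = {i\<in>W. m < i}" using Wb'(1) mV by (auto simp: T_def less_le)
      have sT: "s \<in> T" using W s by (simp add: T)
      have finT: "finite T" using Wb'(3) by (simp add: T_def)
      have TJ: "T \<subseteq> J" using Wb'(1) by (auto simp: T J_def)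
      have k: "k \<in> T" "\<And>i. i \<in> T \<Longrightarrow> k \<le> i"
        using Min_in[OF finT] Min_le[OF finT] sT by (auto simp: k_def simp flip: T)
      have km: "m < k" using k(1) by (simp add: T)
      \<comment> \<open>\<open>moment\<close> puts the operator in front of the entry
        \<open>k\<close>, the first index of \<open>W\<close> behind \<open>m\<close> in the usual
        order, whereas \<open>imoment\<close> needs it at \<open>s\<close>. Within the tail
        \<open>T\<close> of \<open>W\<close> it is carried there by \<open>move_Lop\<close> or
        \<open>move_Rop\<close>.\<close>
      define Y' where "Y' = Y(s := (case \<chi> m of Lft \<Rightarrow> lact X (\<chi> s) c (Y s) | Rgt \<Rightarrow> ract X (\<chi> s) (Y s) c))"
      have step: "moment X \<chi> S Z \<pi> =
          moment X \<chi> (S - V) (Z(k := side_op X (\<chi> m) c * Z k)) (\<pi> - {V})"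
        by (simp only: unf if_not_P[OF False] Let_def J_def s_def W_def k_def)
      have YT: "Y \<in> faces X \<chi> T" using Y by (rule faces_mono) (use TJ J_def in auto)
      have "imoment X \<chi> S \<pi> Y = imoment X \<chi> (S - V) (\<pi> - {V}) Y' \<and>
          same_tail (EE X) (side_op X (\<chi> m) c * oprod Y T) (oprod Y' T)"
      proof (cases "\<chi> m")
        case Lft
        then have first: "is_first \<chi> J s" using chi_min_is_first[OF finJ \<open>J \<noteq> {}\<close>] by (simp add: s_def)
        have "is_first \<chi> (chi_above \<chi> S V) s"
          unfolding is_first_def
        proof (intro conjI ballI impI)
          show "s \<in> chi_above \<chi> S V"
            using cases[of s] s mV Lft by (auto simp: chi_below_def chi_less_def)
          fix x assume x: "x \<in> chi_above \<chi> S V" "x \<noteq> s"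
          then have x': "x \<in> S" "x \<notin> V" "chi_less \<chi> m x" using mV by (auto simp: chi_above_def)
          show "chi_less \<chi> s x"
          proof (cases "x \<in> J")
            case True
            then show ?thesis using first x by (auto simp: is_first_def)
          next
            case False
            then show ?thesis using x' Lft s by (cases "\<chi> s") (auto simp: J_def chi_less_def)
          qed
        qed
        from graft_succ[OF this] have "imoment X \<chi> S \<pi> Y = imoment X \<chi> (S - V) (\<pi> - {V}) Y'"
          using Lft by (simp add: im Y'_def c_def)
        moreover have "same_tail (EE X) (Lop X c * oprod Y T) (oprod (Y(s := lact X (\<chi> s) c (Y s))) T)"
          using is_first_subset[OF first TJ sT] cB by (intro move_Lop E_right finT YT)
        ultimately show ?thesis using Lft by (simp add: side_op_def Y'_def)
      next
        case Rgt
        then have last: "is_last \<chi> J s" using chi_max_is_last[OF finJ \<open>J \<noteq> {}\<close>] by (simp add: s_def)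
        have "is_last \<chi> (chi_below \<chi> S V) s"
          unfolding is_last_def
        proof (intro conjI ballI impI)
          show "s \<in> chi_below \<chi> S V"
            using cases[of s] s mV Rgt by (auto simp: chi_above_def chi_less_def)
          fix x assume x: "x \<in> chi_below \<chi> S V" "x \<noteq> s"
          then have x': "x \<in> S" "x \<notin> V" "chi_less \<chi> x m" using mV by (auto simp: chi_below_def)
          show "chi_less \<chi> x s"
          proof (cases "x \<in> J")
            case True
            then show ?thesis using last x by (auto simp: is_last_def)
          next
            case False
            then show ?thesis using x' Rgt s by (cases "\<chi> s") (auto simp: J_def chi_less_def)
          qed
        qed
        from graft_pred[where g = "\<lambda>Z. EE X (oprod Z V)", OF fin Vint Vb(2) bal Y E_range this]
        have "imoment X \<chi> S \<pi> Y = imoment X \<chi> (S - V) (\<pi> - {V}) Y'"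
          using Rgt by (simp add: im Y'_def c_def)
        moreover have "same_tail (EE X) (Rop X c * oprod Y T) (oprod (Y(s := ract X (\<chi> s) (Y s) c)) T)"
          using is_last_subset[OF last TJ sT] cB by (intro move_Rop E_right finT YT)
        ultimately show ?thesis using Rgt by (simp add: side_op_def Y'_def)
      qed
      then have graft: "imoment X \<chi> S \<pi> Y = imoment X \<chi> (S - V) (\<pi> - {V}) Y'"
        and move: "same_tail (EE X) (side_op X (\<chi> m) c * oprod Y T) (oprod Y' T)" by blast+
      show ?thesis
        unfolding step graft
      proof (rule less.hyps[OF SV(4) SV(2,1,3), where t = m])
        show "Y' \<in> faces X \<chi> (S - V)"
          using faces_lact[OF YV cB, of s] faces_ract[OF YV cB, of s]
          by (cases "\<chi> m") (simp_all add: Y'_def)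
        show "(Z(k := side_op X (\<chi> m) c * Z k)) i = Y' i" if "i \<in> S - V" "i < m" for i
          using that less.prems(5)[of i] km s mt by (simp add: Y'_def)
        fix U assume U: "U \<in> \<pi> - {V}"
        show "Min U \<le> m"
          using last_block_max[OF BNC_finite[OF \<pi> fin]] U by (simp add: V_def m_def)
        show "same_tail (EE X) (oprod (Z(k := side_op X (\<chi> m) c * Z k)) {i\<in>U. m \<le> i}) (oprod Y' {i\<in>U. m \<le> i})"
        proof (cases "U = W")
          case True
          have "{i\<in>T. i < k} = {}" using k(2) by force
          then have "oprod (Z(k := side_op X (\<chi> m) c * Z k)) T = side_op X (\<chi> m) c * oprod Z T"
            by (simp only: oprod_split_upd[OF finT k(1)] oprod_split[OF finT k(1), of Z] oprod_empty mult_1_left mult.assoc)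
          then show ?thesis
            using same_tail_trans[OF same_tail_mult[OF tails[OF W(1), folded T_def]] move]
            unfolding True T_def[symmetric] by simp
        next
          case False
          then have "k \<notin> U" "s \<notin> U"
            using k(1) W U BNC_disjoint[OF \<pi> _ W(1)] by (auto simp: T)
          then have "oprod (Z(k := side_op X (\<chi> m) c * Z k)) {i\<in>U. m \<le> i} = oprod Z {i\<in>U. m \<le> i}"
              "oprod Y' {i\<in>U. m \<le> i} = oprod Y {i\<in>U. m \<le> i}"
            by (auto intro!: oprod_cong simp: Y'_def)
          then show ?thesis using tails U by simp
        qed
      qed
    qed
  qed
qed

lemma moment_eq_imoment:
  assumes "finite S" "S \<noteq> {}" "\<pi> \<in> BNC \<chi> S" "Z \<in> faces X \<chi> S"
  shows "moment X \<chi> S Z \<pi> = imoment X \<chi> S \<pi> Z"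
\<comment> \<open>With equal families the only condition on the threshold is that no block starts
  behind it.\<close>
proof (rule moment_imoment_tails[OF assms, where t = "Max S"])
  fix W assume W: "W \<in> \<pi>"
  have "Min W \<in> S"
    using Min_in[OF BNC_finite_block[OF assms(3,1) W] BNC_block(2)[OF assms(3) W]]
      BNC_block(1)[OF assms(3) W] by blast
  then show "Min W \<le> Max S" using assms(1) by simp
qed simp_all

end

section \<open>Isolating a point\<close>

definition delete_point :: "nat \<Rightarrow> nat set set \<Rightarrow> nat set set" where
  "delete_point q \<pi> = (\<lambda>W. W - {q}) ` \<pi> - {{}}"

definition isolate :: "nat \<Rightarrow> nat set set \<Rightarrow> nat set set" where
  "isolate q \<pi> = insert {q} (delete_point q \<pi>)"

lemma BNC_delete_point:
  assumes "\<pi> \<in> BNC \<chi> S"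
  shows "delete_point q \<pi> \<in> BNC \<chi> (S - {q})"
proof -
  have "partition_on (S - {q}) (delete_point q \<pi>)"
  proof (rule partition_onI)
    have "\<Union>\<pi> = S" using assms by (simp add: BNC_def partition_on_def)
    then show "\<Union> (delete_point q \<pi>) = S - {q}" by (auto simp: delete_point_def)
    show "disjnt U U'" if U: "U \<in> delete_point q \<pi>" "U' \<in> delete_point q \<pi>" "U \<noteq> U'" for U U'
    proof -
      obtain W W' where W: "U = W - {q}" "U' = W' - {q}" "W \<in> \<pi>" "W' \<in> \<pi>"
        using U(1,2) unfolding delete_point_def by blast
      then show ?thesis using BNC_disjoint[OF assms W(3,4)] U(3) by (auto simp: disjnt_def)
    qed
  qed (simp add: delete_point_def)
  moreover have "chi_noncrossing \<chi> (delete_point q \<pi>)"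
    unfolding chi_noncrossing_def
  proof (intro notI, elim bexE conjE)
    fix U U' a b c d
    assume U: "U \<in> delete_point q \<pi>" "U' \<in> delete_point q \<pi>" "U \<noteq> U'"
      and *: "a \<in> U" "b \<in> U'" "c \<in> U" "d \<in> U'" "chi_less \<chi> a b" "chi_less \<chi> b c" "chi_less \<chi> c d"
    obtain W W' where W: "U = W - {q}" "U' = W' - {q}" "W \<in> \<pi>" "W' \<in> \<pi>"
      using U(1,2) unfolding delete_point_def by blast
    have "W = W'"
      using assms * W by (intro chi_noncrossingD[of \<chi> \<pi> W W' a b c d]) (auto simp: BNC_def)
    then show False using W U(3) by simp
  qed
  ultimately show ?thesis by (simp add: BNC_def)
qed

lemma BNC_insert_singleton:
  assumes "\<pi> \<in> BNC \<chi> (S - {q})" "q \<in> S"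
  shows "insert {q} \<pi> \<in> BNC \<chi> S"
proof -
  have "partition_on S (insert {q} \<pi>)"
  proof (rule partition_onI)
    show "\<Union> (insert {q} \<pi>) = S" using assms by (auto simp: BNC_def partition_on_def)
    show "disjnt U U'" if "U \<in> insert {q} \<pi>" "U' \<in> insert {q} \<pi>" "U \<noteq> U'" for U U'
      using that BNC_disjoint[OF assms(1), of U U'] BNC_block(1)[OF assms(1), of U]
        BNC_block(1)[OF assms(1), of U'] unfolding disjnt_def by blast
    show "{} \<notin> insert {q} \<pi>" using BNC_block(2)[OF assms(1)] by auto
  qed
  moreover have "chi_noncrossing \<chi> (insert {q} \<pi>)"
    unfolding chi_noncrossing_def
  proof (intro notI, elim bexE conjE)
    fix U U' a b c d
    assume U: "U \<in> insert {q} \<pi>" "U' \<in> insert {q} \<pi>" "U \<noteq> U'"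
      and *: "a \<in> U" "b \<in> U'" "c \<in> U" "d \<in> U'" "chi_less \<chi> a b" "chi_less \<chi> b c" "chi_less \<chi> c d"
    have "a \<noteq> c" "b \<noteq> d" using * chi_less_asym[of \<chi> a b] chi_less_asym[of \<chi> b c] by auto
    then have "U \<in> \<pi>" "U' \<in> \<pi>" using U * by auto
    then have "U = U'"
      using assms * by (intro chi_noncrossingD[of \<chi> \<pi> U U' a b c d]) (auto simp: BNC_def)
    then show False using U(3) by simp
  qed
  ultimately show ?thesis by (simp add: BNC_def)
qed

lemma BNC_isolate: "\<pi> \<in> BNC \<chi> S \<Longrightarrow> q \<in> S \<Longrightarrow> isolate q \<pi> \<in> BNC \<chi> S"
  unfolding isolate_def by (intro BNC_insert_singleton BNC_delete_point)

lemma delete_point_eq: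
  assumes "\<pi> \<in> BNC \<chi> S" "Q \<in> \<pi>" "q \<in> Q"
  shows "delete_point q \<pi> = (if Q = {q} then {} else {Q - {q}}) \<union> (\<pi> - {Q})"
proof -
  have "W - {q} = W" "W \<noteq> {}" if "W \<in> \<pi> - {Q}" for W
    using BNC_disjoint[OF assms(1) _ assms(2), of W q] BNC_block(2)[OF assms(1), of W] that assms(3) by auto
  then have "(\<lambda>W. W - {q}) ` (\<pi> - {Q}) = \<pi> - {Q}" "{} \<notin> \<pi> - {Q}" by (auto simp: image_iff)
  moreover have "\<pi> = insert Q (\<pi> - {Q})" using assms by blast
  ultimately have "delete_point q \<pi> = insert (Q - {q}) (\<pi> - {Q}) - {{}}"
    unfolding delete_point_def by (metis image_insert)
  then show ?thesis using \<open>{} \<notin> \<pi> - {Q}\<close> assms(3) by auto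
qed

lemma delete_point_singleton: "\<pi> \<in> BNC \<chi> S \<Longrightarrow> {q} \<in> \<pi> \<Longrightarrow> delete_point q \<pi> = \<pi> - {{q}}"
  using delete_point_eq[of \<pi> \<chi> S "{q}" q] by simp

lemma refines_isolate:
  assumes "\<pi> \<in> BNC \<chi> S" "q \<in> S"
  shows "refines S (isolate q \<pi>) \<pi>"
  unfolding refines_def
proof (intro conjI ballI)
  fix U assume "U \<in> isolate q \<pi>"
  then show "\<exists>W\<in>\<pi>. U \<subseteq> W"
    using BNC_cover[OF assms] unfolding isolate_def delete_point_def by blast
qed (use assms BNC_isolate[OF assms] in \<open>auto simp: BNC_def\<close>)

text \<open>Together with \<open>refines_isolate\<close> this says that
  \<open>isolate q \<pi>\<close> is the coarsest partition below \<open>\<pi>\<close> that has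
  \<open>{q}\<close> as a block.\<close>

lemma refines_isolate_iff:
  assumes "\<pi> \<in> BNC \<chi> S" "\<tau> \<in> BNC \<chi> S" "{q} \<in> \<tau>"
  shows "refines S \<tau> (isolate q \<pi>) \<longleftrightarrow> refines S \<tau> \<pi>"
proof -
  have q: "q \<in> S" using BNC_block(1)[OF assms(2,3)] by simp
  show ?thesis
  proof
    assume "refines S \<tau> (isolate q \<pi>)"
    then show "refines S \<tau> \<pi>" by (rule refines_trans[OF _ refines_isolate[OF assms(1) q]])
  next
    assume r: "refines S \<tau> \<pi>"
    show "refines S \<tau> (isolate q \<pi>)"
      unfolding refines_def
    proof (intro conjI ballI)
      fix U assume U: "U \<in> \<tau>"
      show "\<exists>W\<in>isolate q \<pi>. U \<subseteq> W"
      proof (cases "U = {q}")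
        case False
        then have "q \<notin> U" using BNC_disjoint[OF assms(2) U assms(3), of q] by auto
        moreover obtain W where "W \<in> \<pi>" "U \<subseteq> W" using r U unfolding refines_def by blast
        moreover have "U \<noteq> {}" by (rule BNC_block(2)[OF assms(2) U])
        ultimately show ?thesis by (intro bexI[of _ "W - {q}"]) (auto simp: isolate_def delete_point_def)
      qed (simp add: isolate_def)
    qed (use assms BNC_isolate[OF assms(1) q] in \<open>auto simp: BNC_def\<close>)
  qed
qed

lemma chi_interval_singleton: "q \<in> S \<Longrightarrow> chi_interval \<chi> S {q}"
  by (rule chi_intervalI) (auto dest: chi_less_asym)

lemma successor_cases:
  assumes "finite S" "q \<in> S"
  obtains "is_last \<chi> S q" | s where "adjacent \<chi> S q s"
proof (cases rule: chi_above_cases[OF assms(1), of \<chi> "{q}"])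
  case 1
  then have "chi_less \<chi> x q" if "x \<in> S" "x \<noteq> q" for x
    using that chi_less_total[of x q \<chi>] by (auto simp: chi_above_def)
  then show thesis using assms that(1) by (simp add: is_last_def)
next
  case (2 s)
  have "\<not> (chi_less \<chi> q x \<and> chi_less \<chi> x s)" if "x \<in> S" for x
    using 2 that chi_less_asym[of \<chi> x s] by (auto simp: is_first_def chi_above_def)
  then show thesis using that(2)[of s] 2 assms(2) by (simp add: is_first_def chi_above_def adjacent_def)
qed

section \<open>Unit entries, and their deletion from moments\<close>

context ncs_pair
begin

lemma balanced_unit_last:
  "balanced X \<chi> S \<Phi> \<Longrightarrow> Z \<in> faces X \<chi> S \<Longrightarrow> Z q = 1 \<Longrightarrow> c \<in> B \<Longrightarrow> is_last \<chi> S q \<Longrightarrow>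
    \<Phi> (Z(q := side_op X (\<chi> q) c)) = \<Phi> Z * c"
  using balanced_last[of X \<chi> S \<Phi> Z c q] by (simp add: side_op_ract)

lemma balanced_unit_succ:
  "balanced X \<chi> S \<Phi> \<Longrightarrow> Z \<in> faces X \<chi> S \<Longrightarrow> Z q = 1 \<Longrightarrow> c \<in> B \<Longrightarrow> adjacent \<chi> S q s \<Longrightarrow>
    \<Phi> (Z(q := side_op X (\<chi> q) c)) = \<Phi> (Z(s := lact X (\<chi> s) c (Z s)))"
  using balanced_adjacent[of X \<chi> S \<Phi> Z c q s] by (simp add: side_op_ract)

lemma balanced_unit_pred:
  "balanced X \<chi> S \<Phi> \<Longrightarrow> Z \<in> faces X \<chi> S \<Longrightarrow> Z q = 1 \<Longrightarrow> c \<in> B \<Longrightarrow> adjacent \<chi> S p q \<Longrightarrow>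
    \<Phi> (Z(q := side_op X (\<chi> q) c)) = \<Phi> (Z(p := ract X (\<chi> p) (Z p) c))"
  using balanced_adjacent[of X \<chi> S \<Phi> Z c p q] by (simp add: side_op_lact)

text \<open>The reduction to a unit entry: \<open>b\<close> leaves the position \<open>q\<close> to
  the right, either as a factor of the value or into the successor. In both cases what remains has
  the unit at \<open>q\<close> and all entries in their faces.\<close>

lemma balanced_side_op_zero:
  assumes \<Phi>: "balanced X \<chi> S \<Phi>" and S: "finite S" "q \<in> S"
    and unit: "\<And>Z. Z \<in> faces X \<chi> S \<Longrightarrow> Z q = 1 \<Longrightarrow> \<Phi> Z = 0"
    and Z: "Z \<in> faces X \<chi> S" "Z q = side_op X (\<chi> q) b" "b \<in> B"
  shows "\<Phi> Z = 0"
proof -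
  let ?Z = "Z(q := 1)"
  have Z1: "?Z \<in> faces X \<chi> S" using Z(1) face_one by (intro faces_upd)
  have upd: "?Z(q := side_op X (\<chi> q) b) = Z" using Z(2) by auto
  show ?thesis
  proof (cases rule: successor_cases[OF S, of \<chi>])
    case 1
    from balanced_unit_last[OF \<Phi> Z1 _ Z(3) this] show ?thesis using unit[OF Z1] upd by simp
  next
    case (2 s)
    then have "s \<noteq> q" by (auto simp: adjacent_def)
    moreover have "?Z(s := lact X (\<chi> s) b (?Z s)) \<in> faces X \<chi> S" using Z1 Z(3) by (rule faces_lact)
    ultimately have "\<Phi> (?Z(s := lact X (\<chi> s) b (?Z s))) = 0" by (intro unit) simp_all
    then show ?thesis using balanced_unit_succ[OF \<Phi> Z1 _ Z(3) 2] upd by simp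
  qed
qed

text \<open>A block \<open>{q}\<close> has value E(1) = 1, and in the product of a larger block the
  unit drops out. The one delicate case is that of a removed block whose successor is
  \<open>q\<close>: its value lands on the unit entry and has to be passed on to the next index,
  which is the successor once \<open>q\<close> is gone.\<close>

lemma imoment_delete_point:
  "finite S \<Longrightarrow> \<sigma> \<in> BNC \<chi> S \<Longrightarrow> q \<in> S \<Longrightarrow> Z \<in> faces X \<chi> S \<Longrightarrow> Z q = 1 \<Longrightarrow>
    imoment X \<chi> S \<sigma> Z = imoment X \<chi> (S - {q}) (delete_point q \<sigma>) Z"
proof (induction "card S" arbitrary: S \<sigma> Z rule: less_induct)
  case less
  note fin = less.prems(1) and \<sigma> = less.prems(2) and q = less.prems(3) and Z = less.prems(4,5)
  obtain Q where Q: "Q \<in> \<sigma>" "q \<in> Q" using BNC_cover[OF \<sigma> q] by blast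
  show ?case
  proof (cases "Q = {q}")
    case True
    \<comment> \<open>A singleton is an interval, so it may be removed first even if it is not the
      last block.\<close>
    have "imoment X \<chi> S \<sigma> Z =
        graft X \<chi> S {q} (\<lambda>Z. EE X (oprod Z {q})) (imoment X \<chi> (S - {q}) (\<sigma> - {{q}})) Z"
      using True Q q by (intro imoment_remove fin \<sigma> Z chi_interval_singleton) auto
    then show ?thesis
      using True Q Z by (simp add: graft_def E_one delete_point_singleton[OF \<sigma>])
  next
    case False
    define V where "V = last_block \<sigma>"
    have V: "V \<in> \<sigma>" unfolding V_def using Q by (intro last_block_in BNC_finite[OF \<sigma> fin]) auto
    note Vb = BNC_block[OF \<sigma> V]
    have Vint: "chi_interval \<chi> S V" unfolding V_def using Q by (intro last_block_interval[OF \<sigma> fin]) auto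
    have fins: "finite V" "finite (S - V)" "finite (S - {q})" using fin finite_subset[OF Vb(1)] by auto
    have im: "imoment X \<chi> S \<sigma> Z = graft X \<chi> S V (\<lambda>Z. EE X (oprod Z V)) (imoment X \<chi> (S - V) (\<sigma> - {V})) Z"
      by (rule imoment_remove[OF fin \<sigma> V Vint Z(1)])
    have \<sigma>q: "delete_point q \<sigma> \<in> BNC \<chi> (S - {q})" by (rule BNC_delete_point[OF \<sigma>])
    have Zq: "Z \<in> faces X \<chi> (S - {q})" using Z(1) by (rule faces_mono) blast
    show ?thesis
    proof (cases "V = Q")
      case True
      have del: "delete_point q \<sigma> = insert (V - {q}) (\<sigma> - {V})"
        using delete_point_eq[OF \<sigma> Q] False True by simp
      have "V - {q} \<notin> \<sigma> - {V}"
        using BNC_disjoint[OF \<sigma> V, of "V - {q}"] BNC_block(2)[OF \<sigma>, of "V - {q}"] by blast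
      then have rest: "delete_point q \<sigma> - {V - {q}} = \<sigma> - {V}" "S - {q} - (V - {q}) = S - V"
        using del True Q by auto
      \<comment> \<open>Even if \<open>q\<close> is an end of \<open>V\<close>: an index outside the
        interval \<open>V\<close> that is above one element of it is above all of it.\<close>
      have ab: "chi_above \<chi> (S - {q}) (V - {q}) = chi_above \<chi> S V"
      proof (intro equalityI subsetI)
        fix x assume "x \<in> chi_above \<chi> S V"
        then show "x \<in> chi_above \<chi> (S - {q}) (V - {q})" using True Q by (auto simp: chi_above_def)
      next
        fix x assume x: "x \<in> chi_above \<chi> (S - {q}) (V - {q})"
        obtain v where v: "v \<in> V" "v \<noteq> q" using False True Q by blast
        then have "chi_less \<chi> v x" "x \<in> S" "x \<notin> V" using x chi_less_irrefl unfolding chi_above_def by blast+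
        then show "x \<in> chi_above \<chi> S V"
          using chi_interval_cases[OF Vint, of x] v chi_less_asym[of \<chi> v x] by (auto simp: chi_below_def)
      qed
      have "imoment X \<chi> (S - {q}) (delete_point q \<sigma>) Z =
          graft X \<chi> (S - {q}) (V - {q}) (\<lambda>Z. EE X (oprod Z (V - {q}))) (imoment X \<chi> (S - V) (\<sigma> - {V})) Z"
        using imoment_remove[OF fins(3) \<sigma>q _ chi_interval_Diff[OF Vint] Zq] del unfolding rest by simp
      moreover have "oprod Z V = oprod Z (V - {q})"
        using True Q Z(2) by (intro oprod_remove_one fins) auto
      ultimately show ?thesis unfolding im by (simp add: graft_def ab)
    next
      case ne: False
      have qV: "q \<notin> V" using BNC_disjoint[OF \<sigma> V Q(1)] Q(2) ne by blast
      have V': "V \<in> delete_point q \<sigma>" using delete_point_eq[OF \<sigma> Q] V ne by simp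
      have QV: "Q \<in> \<sigma> - {V}" using Q ne by simp
      have "V \<noteq> Q - {q}" using BNC_disjoint[OF \<sigma> V Q(1)] Vb(2) ne by blast
      then have rest: "delete_point q \<sigma> - {V} = delete_point q (\<sigma> - {V})" "S - {q} - V = S - V - {q}"
        using delete_point_eq[OF \<sigma> Q] delete_point_eq[OF BNC_remove[OF \<sigma> V] QV Q(2)] False by auto
      define \<Psi> where "\<Psi> = imoment X \<chi> (S - V - {q}) (delete_point q (\<sigma> - {V}))"
      have card: "card (S - V) < card S" using Vb fin by (intro psubset_card_mono) auto
      have IH: "imoment X \<chi> (S - V) (\<sigma> - {V}) Y = \<Psi> Y" if "Y \<in> faces X \<chi> (S - V)" "Y q = 1" for Y
        unfolding \<Psi>_def using qV q that by (intro less.hyps[OF card fins(2) BNC_remove[OF \<sigma> V]]) auto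
      have ZV: "Z \<in> faces X \<chi> (S - V)" using Z(1) by (rule faces_mono) blast
      define c where "c = EE X (oprod Z V)"
      have cB: "c \<in> B" unfolding c_def by (rule E_range)
      have bal: "balanced X \<chi> (S - V) (imoment X \<chi> (S - V) (\<sigma> - {V}))"
        by (rule balanced_imoment[OF fins(2) BNC_remove[OF \<sigma> V]])
      have ab: "chi_above \<chi> (S - {q}) V = chi_above \<chi> S V - {q}" by (auto simp: chi_above_def)
      \<comment> \<open>If \<open>q\<close> is the minimum of \<open>Q\<close>, its deletion may
        raise that minimum beyond the minimum of \<open>V\<close>, so \<open>V\<close> need not be
        the last block any more; hence \<open>imoment_remove\<close>.\<close>
      have "imoment X \<chi> (S - {q}) (delete_point q \<sigma>) Z = graft X \<chi> (S - {q}) V (\<lambda>Z. EE X (oprod Z V)) \<Psi> Z"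
        using imoment_remove[OF fins(3) \<sigma>q V' _ Zq] chi_interval_Diff[OF Vint, of "{q}"] qV
        unfolding rest \<Psi>_def by simp
      moreover have "imoment X \<chi> S \<sigma> Z = graft X \<chi> (S - {q}) V (\<lambda>Z. EE X (oprod Z V)) \<Psi> Z"
      proof (cases rule: chi_above_cases[OF fin, of \<chi> V])
        case 1
        then show ?thesis unfolding im using IH[OF ZV Z(2)] by (simp add: graft_top ab)
      next
        case (2 s)
        show ?thesis
        proof (cases "s = q")
          case False
          then have "is_first \<chi> (chi_above \<chi> (S - {q}) V) s"
            using 2 by (auto simp: ab is_first_def)
          then show ?thesis
            unfolding im using IH[OF faces_lact[OF ZV cB, of s]] Z(2) False
            by (simp add: graft_succ[OF 2] graft_succ c_def)
        next
          case True
          have eq: "imoment X \<chi> S \<sigma> Z = imoment X \<chi> (S - V) (\<sigma> - {V}) (Z(q := side_op X (\<chi> q) c))"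
            unfolding im using True Z(2) by (simp add: graft_succ[OF 2] c_def side_op_lact)
          have qS: "q \<in> S - V" using q qV by simp
          have first: "chi_less \<chi> q x" if "x \<in> chi_above \<chi> S V" "x \<noteq> q" for x
            using 2 that True by (auto simp: is_first_def)
          obtain v where v: "v \<in> V" using Vb(2) by blast
          have vq: "chi_less \<chi> w q" if "w \<in> V" for w using 2 True that by (auto simp: is_first_def chi_above_def)
          have low: "chi_less \<chi> x q" if "x \<in> S - V" "x \<notin> chi_above \<chi> S V" for x
            using chi_interval_cases[OF Vint that(1)] that(2) v vq[OF v] chi_less_trans[of \<chi> x v q]
            by (auto simp: chi_below_def)
          show ?thesis
          proof (cases rule: chi_above_cases[OF fins(3), of \<chi> V])
            case 1
            then have "is_last \<chi> (S - V) q" using low qS ab by (auto simp: is_last_def)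
            from balanced_unit_last[OF bal ZV Z(2) cB this] show ?thesis
              using 1 IH[OF ZV Z(2)] by (simp add: eq graft_top c_def)
          next
            case (2 s')
            then have s': "s' \<in> chi_above \<chi> S V" "s' \<noteq> q" "s' \<in> S - V"
              by (auto simp: is_first_def ab chi_above_def)
            have "adjacent \<chi> (S - V) q s'"
              unfolding adjacent_def
            proof (intro conjI ballI notI qS s' first)
              fix x assume x: "x \<in> S - V" "chi_less \<chi> q x \<and> chi_less \<chi> x s'"
              then have "x \<in> chi_above \<chi> S V" "x \<noteq> q" "x \<noteq> s'"
                using low[of x] chi_less_asym[of \<chi> q x] by auto
              then show False using 2 x chi_less_asym[of \<chi> x s'] by (auto simp: is_first_def ab)
            qed (use s' in auto)
            from balanced_unit_succ[OF bal ZV Z(2) cB this] show ?thesis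
              using IH[OF faces_lact[OF ZV cB, of s']] Z(2) s'
              by (simp add: eq graft_succ[OF 2] c_def)
          qed
        qed
      qed
      ultimately show ?thesis by simp
    qed
  qed
qed

text \<open>Both partitions become the same one when \<open>q\<close> is deleted.\<close>

lemma imoment_isolate:
  assumes "finite S" "\<sigma> \<in> BNC \<chi> S" "q \<in> S" "Z \<in> faces X \<chi> S" "Z q = 1"
  shows "imoment X \<chi> S (isolate q \<sigma>) Z = imoment X \<chi> S \<sigma> Z"
proof -
  have "{q} \<notin> delete_point q \<sigma>" by (auto simp: delete_point_def)
  then have "delete_point q (isolate q \<sigma>) = delete_point q \<sigma>"
    using delete_point_singleton[OF BNC_isolate[OF assms(2,3)]] by (simp add: isolate_def)
  then show ?thesis
    using imoment_delete_point[OF assms] imoment_delete_point[OF assms(1) BNC_isolate[OF assms(2,3)] assms(3-5)]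
    by simp
qed

end

section \<open>Vanishing of the bi-free cumulants\<close>

text \<open>Uniqueness in Moebius inversion over a finite order. The order is a parameter because
  refinement is used in one application and its reverse, on the partitions with block
  \<open>{q}\<close>, in the other.\<close>

lemma order_sum_zero:
  fixes f :: "'b \<Rightarrow> int"
  assumes fin: "finite P" and refl: "\<And>x. x \<in> P \<Longrightarrow> le x x"
    and antisym: "\<And>x y. x \<in> P \<Longrightarrow> y \<in> P \<Longrightarrow> le x y \<Longrightarrow> le y x \<Longrightarrow> x = y"
    and trans: "\<And>x y z. x \<in> P \<Longrightarrow> y \<in> P \<Longrightarrow> z \<in> P \<Longrightarrow> le x y \<Longrightarrow> le y z \<Longrightarrow> le x z"
    and sum: "\<And>y. y \<in> P \<Longrightarrow> (\<Sum>x | x \<in> P \<and> le x y. f x) = 0"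
  shows "y \<in> P \<Longrightarrow> f y = 0"
proof (induction "card {x \<in> P. le x y}" arbitrary: y rule: less_induct)
  case less
  have "f x = 0" if x: "x \<in> P" "le x y" "x \<noteq> y" for x
  proof (rule less.hyps)
    have "{z \<in> P. le z x} \<subseteq> {z \<in> P. le z y}" using trans x less.prems by blast
    moreover have "y \<notin> {z \<in> P. le z x}" using antisym[of x y] x less.prems by blast
    ultimately have "{z \<in> P. le z x} \<subset> {z \<in> P. le z y}" using refl less.prems by blast
    then show "card {z \<in> P. le z x} < card {z \<in> P. le z y}"
      using fin by (intro psubset_card_mono) auto
  qed (rule x)
  then have "(\<Sum>x\<in>{x \<in> P. le x y} - {y}. f x) = 0" by (intro sum.neutral) auto
  moreover have "(\<Sum>x | x \<in> P \<and> le x y. f x) = f y + (\<Sum>x\<in>{x \<in> P. le x y} - {y}. f x)"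
    using fin less.prems refl by (intro sum.remove) auto
  ultimately show ?case using sum[OF less.prems] by simp
qed

lemma refines_BNC_refl: "\<pi> \<in> BNC \<chi> S \<Longrightarrow> refines S \<pi> \<pi>"
  by (simp add: BNC_def refines_refl)

text \<open>The defining recursion, summed over all partitions below \<open>\<pi>\<close>; those not
  above \<open>\<sigma>\<close> contribute the default value 0.\<close>

lemma moebius_sum_right:
  assumes S: "finite S" and \<sigma>: "\<sigma> \<in> BNC \<chi> S" and \<pi>: "\<pi> \<in> BNC \<chi> S"
  shows "(\<Sum>\<tau> | \<tau> \<in> BNC \<chi> S \<and> refines S \<tau> \<pi>. moebius \<chi> S \<sigma> \<tau>) = (if \<sigma> = \<pi> then 1 else 0)"
proof -
  have zero: "moebius \<chi> S \<sigma> \<tau> = 0" if "\<not> refines S \<sigma> \<tau>" for \<tau>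
    using that by (simp add: moebius.simps)
  show ?thesis
  proof (cases "refines S \<sigma> \<pi>")
    case False
    then have "moebius \<chi> S \<sigma> \<tau> = 0" if "refines S \<tau> \<pi>" for \<tau>
      using that refines_trans zero by blast
    then show ?thesis using False refines_BNC_refl[OF \<sigma>] by (auto intro: sum.neutral)
  next
    case True
    let ?I = "{\<tau> \<in> BNC \<chi> S. refines S \<sigma> \<tau> \<and> refines S \<tau> \<pi>}"
    have "(\<Sum>\<tau> | \<tau> \<in> BNC \<chi> S \<and> refines S \<tau> \<pi>. moebius \<chi> S \<sigma> \<tau>) = (\<Sum>\<tau>\<in>?I. moebius \<chi> S \<sigma> \<tau>)"
      using zero S by (intro sum.mono_neutral_right) (auto simp: finite_BNC)
    also have "\<dots> = moebius \<chi> S \<sigma> \<pi> + (\<Sum>\<tau>\<in>?I - {\<pi>}. moebius \<chi> S \<sigma> \<tau>)"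
      using True \<pi> S refines_BNC_refl[OF \<pi>] by (intro sum.remove) (auto simp: finite_BNC)
    also have "\<dots> = (if \<sigma> = \<pi> then 1 else 0)"
    proof (cases "\<sigma> = \<pi>")
      case eq: True
      have "?I - {\<pi>} = {}" using refines_asym unfolding eq by blast
      then have "(\<Sum>\<tau>\<in>?I - {\<pi>}. moebius \<chi> S \<sigma> \<tau>) = 0" by (simp only: sum.empty)
      then show ?thesis using eq S \<pi> refines_BNC_refl[OF \<pi>] by (simp add: moebius.simps[of \<chi> S \<pi> \<pi>])
    next
      case False
      have "?I - {\<pi>} = {\<tau>. \<tau> \<in> BNC \<chi> S \<and> refines S \<sigma> \<tau> \<and> refines S \<tau> \<pi> \<and> \<tau> \<noteq> \<pi>}" by blast
      then show ?thesis
        using False True S \<sigma> \<pi> by (simp add: moebius.simps[of \<chi> S \<sigma> \<pi>])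
    qed
    finally show ?thesis .
  qed
qed

text \<open>\<open>moebius\<close> is defined by recursion in its upper argument; this is the
  relation in the lower one, the other half of being inverse to the zeta function. The difference
  \<open>f\<close> of the two sides, as a function of the upper partition, has vanishing sums over
  all lower sets, by \<open>moebius_sum_right\<close>.\<close>

lemma moebius_sum_left:
  assumes S: "finite S" and \<sigma>: "\<sigma> \<in> BNC \<chi> S" and \<pi>: "\<pi> \<in> BNC \<chi> S"
  shows "(\<Sum>\<tau> | \<tau> \<in> BNC \<chi> S \<and> refines S \<sigma> \<tau>. moebius \<chi> S \<tau> \<pi>) = (if \<sigma> = \<pi> then 1 else 0)"
proof -
  define f where "f \<rho> = (\<Sum>\<tau> | \<tau> \<in> BNC \<chi> S \<and> refines S \<sigma> \<tau>. moebius \<chi> S \<tau> \<rho>) - (if \<sigma> = \<rho> then 1 else 0)" for \<rho>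
  have finB: "finite (BNC \<chi> S)" by (rule finite_BNC[OF S])
  have "f \<pi> = 0"
  proof (rule order_sum_zero[OF finB, where le = "refines S" and f = f])
    fix \<rho> assume \<rho>: "\<rho> \<in> BNC \<chi> S"
    have "(\<Sum>\<nu> | \<nu> \<in> BNC \<chi> S \<and> refines S \<nu> \<rho>. \<Sum>\<tau> | \<tau> \<in> BNC \<chi> S \<and> refines S \<sigma> \<tau>. moebius \<chi> S \<tau> \<nu>) =
        (\<Sum>\<tau> | \<tau> \<in> BNC \<chi> S \<and> refines S \<sigma> \<tau>. \<Sum>\<nu> | \<nu> \<in> BNC \<chi> S \<and> refines S \<nu> \<rho>. moebius \<chi> S \<tau> \<nu>)"
      by (rule sum.swap)
    also have "\<dots> = (\<Sum>\<tau> | \<tau> \<in> BNC \<chi> S \<and> refines S \<sigma> \<tau>. if \<tau> = \<rho> then 1 else 0)"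
      using moebius_sum_right[OF S _ \<rho>] by (intro sum.cong) auto
    also have "\<dots> = (if refines S \<sigma> \<rho> then 1 else 0)"
      using finB \<rho> by (simp add: sum.delta)
    also have "\<dots> = (\<Sum>\<nu> | \<nu> \<in> BNC \<chi> S \<and> refines S \<nu> \<rho>. if \<sigma> = \<nu> then 1 else 0)"
      using finB \<sigma> by (simp add: sum.delta')
    finally show "(\<Sum>\<nu> | \<nu> \<in> BNC \<chi> S \<and> refines S \<nu> \<rho>. f \<nu>) = 0"
      by (simp add: f_def sum_subtractf)
  qed (use \<pi> refines_BNC_refl refines_asym refines_trans in \<open>blast+\<close>)
  then show ?thesis by (simp add: f_def)
qed

text \<open>The partitions with singleton block \<open>{q}\<close> are the fixed points of the interior operator
  \<open>isolate q\<close>, and \<open>{S}\<close> is not one of them.\<close>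

lemma moebius_sum_isolate:
  assumes S: "finite S" and q: "q \<in> S" "S \<noteq> {q}" and \<tau>: "\<tau> \<in> BNC \<chi> S" "{q} \<in> \<tau>"
  shows "(\<Sum>\<sigma> | \<sigma> \<in> BNC \<chi> S \<and> isolate q \<sigma> = \<tau>. moebius \<chi> S \<sigma> {S}) = 0"
proof -
  define P where "P = {\<tau> \<in> BNC \<chi> S. {q} \<in> \<tau>}"
  define h where "h \<tau> = (\<Sum>\<sigma> | \<sigma> \<in> BNC \<chi> S \<and> isolate q \<sigma> = \<tau>. moebius \<chi> S \<sigma> {S})" for \<tau>
  have finB: "finite (BNC \<chi> S)" by (rule finite_BNC[OF S])
  have "h \<tau> = 0"
  proof (rule order_sum_zero[where P = P and f = h and le = "\<lambda>x y. refines S y x"])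
    fix \<rho> assume \<rho>: "\<rho> \<in> P"
    let ?Q = "{\<sigma> \<in> BNC \<chi> S. refines S \<rho> (isolate q \<sigma>)}"
    \<comment> \<open>The fibres over all fixed points above \<open>\<rho>\<close> together consist
      of the partitions above \<open>\<rho>\<close>, by \<open>refines_isolate_iff\<close>. Over
      these the Moebius values sum to zero, since \<open>{q}\<close> is a block of
      \<open>\<rho>\<close> and so \<open>\<rho>\<close> is not \<open>{S}\<close>.\<close>
    have "(\<Sum>\<nu> | \<nu> \<in> P \<and> refines S \<rho> \<nu>. h \<nu>) =
        (\<Sum>\<nu> | \<nu> \<in> P \<and> refines S \<rho> \<nu>. \<Sum>\<sigma> | \<sigma> \<in> ?Q \<and> isolate q \<sigma> = \<nu>. moebius \<chi> S \<sigma> {S})"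
      unfolding h_def by (intro sum.cong refl) auto
    also have "\<dots> = (\<Sum>\<sigma>\<in>?Q. moebius \<chi> S \<sigma> {S})"
    proof (rule sum.group)
      show "isolate q ` ?Q \<subseteq> {\<nu> \<in> P. refines S \<rho> \<nu>}"
        using BNC_isolate[OF _ q(1)] by (auto simp: P_def isolate_def)
    qed (simp_all add: finB P_def)
    also have "?Q = {\<sigma> \<in> BNC \<chi> S. refines S \<rho> \<sigma>}"
      using refines_isolate_iff \<rho> by (auto simp: P_def)
    also have "(\<Sum>\<sigma>\<in>\<dots>. moebius \<chi> S \<sigma> {S}) = 0"
    proof -
      have "S \<noteq> {}" "\<rho> \<noteq> {S}" "\<rho> \<in> BNC \<chi> S" using \<rho> q by (auto simp: P_def)
      then show ?thesis using moebius_sum_left[OF S, of \<rho> \<chi> "{S}"] BNC_whole[of S \<chi>] by simp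
    qed
    finally show "(\<Sum>\<nu> | \<nu> \<in> P \<and> refines S \<rho> \<nu>. h \<nu>) = 0" .
  next
    fix x y z assume "refines S y x" "refines S z y"
    then show "refines S z x" by (rule refines_trans[rotated])
  next
    fix x y assume "refines S y x" "refines S x y"
    then show "x = y" by (rule refines_asym[rotated])
  qed (use \<tau> finB refines_BNC_refl in \<open>auto simp: P_def\<close>)
  then show ?thesis by (simp add: h_def)
qed

section \<open>Bi-free cumulants: balance, range, vanishing\<close>

context ncs_pair
begin

lemma balanced_sum:
  assumes "\<And>i. i \<in> I \<Longrightarrow> balanced X \<chi> S (\<Phi> i)"
  shows "balanced X \<chi> S (\<lambda>Z. \<Sum>i\<in>I. scD X (a i) (\<Phi> i Z))"
proof (rule balancedI)
  fix Z Z' assume "Z \<in> faces X \<chi> S" "\<And>i. i \<in> S \<Longrightarrow> Z i = Z' i"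
  then have "\<Phi> i Z = \<Phi> i Z'" if "i \<in> I" for i using balanced_cong[OF assms[OF that]] by blast
  then show "(\<Sum>i\<in>I. scD X (a i) (\<Phi> i Z)) = (\<Sum>i\<in>I. scD X (a i) (\<Phi> i Z'))" by simp
next
  fix Z b p p' assume "Z \<in> faces X \<chi> S" "b \<in> B" "adjacent \<chi> S p p'"
  from balanced_adjacent[OF assms this]
  show "(\<Sum>i\<in>I. scD X (a i) (\<Phi> i (Z(p := ract X (\<chi> p) (Z p) b)))) =
      (\<Sum>i\<in>I. scD X (a i) (\<Phi> i (Z(p' := lact X (\<chi> p') b (Z p')))))" by simp
next
  fix Z b p assume "Z \<in> faces X \<chi> S" "b \<in> B" "is_first \<chi> S p"
  from balanced_first[OF assms this]
  show "(\<Sum>i\<in>I. scD X (a i) (\<Phi> i (Z(p := lact X (\<chi> p) b (Z p))))) = b * (\<Sum>i\<in>I. scD X (a i) (\<Phi> i Z))"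
    by (simp add: sum_distrib_left D.scale_mult_right)
next
  fix Z b p assume "Z \<in> faces X \<chi> S" "b \<in> B" "is_last \<chi> S p"
  from balanced_last[OF assms this]
  show "(\<Sum>i\<in>I. scD X (a i) (\<Phi> i (Z(p := ract X (\<chi> p) (Z p) b)))) = (\<Sum>i\<in>I. scD X (a i) (\<Phi> i Z)) * b"
    by (simp add: sum_distrib_right D.scale_mult_left)
qed

lemma cumulant_whole:
  assumes "finite S" "S \<noteq> {}" "Z \<in> faces X \<chi> S"
  shows "cumulant X \<chi> S Z {S} =
    (\<Sum>\<sigma>\<in>BNC \<chi> S. scD X (of_int (moebius \<chi> S \<sigma> {S})) (imoment X \<chi> S \<sigma> Z))"
proof -
  have "refines S \<sigma> {S}" if "\<sigma> \<in> BNC \<chi> S" for \<sigma>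
    using that assms BNC_block(1)[OF that] BNC_whole[of S \<chi>] by (simp add: refines_def BNC_def)
  then have "{\<sigma>. \<sigma> \<in> BNC \<chi> S \<and> refines S \<sigma> {S}} = BNC \<chi> S" by blast
  then show ?thesis unfolding cumulant_def using moment_eq_imoment[OF assms(1,2) _ assms(3)] by simp
qed

lemma balanced_cumulant:
  assumes "finite S" "S \<noteq> {}"
  shows "balanced X \<chi> S (\<lambda>Z. cumulant X \<chi> S Z {S})"
  by (rule balanced_eq_on_faces[OF balanced_sum[OF balanced_imoment[OF assms(1)]]])
    (simp_all add: cumulant_whole[OF assms] faces_lact faces_ract)

lemma cumulant_range:
  assumes "finite S" "S \<noteq> {}" "Z \<in> faces X \<chi> S"
  shows "cumulant X \<chi> S Z {S} \<in> B"
  unfolding cumulant_whole[OF assms]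
  by (intro D.subspace_sum D.subspace_scale B_sub imoment_range assms(1))

text \<open>The exceptional case of a single entry: an inner block \<open>{q}\<close> with unit
  entry acts on its predecessor by 1, that is, not at all.\<close>

lemma cumulant_one:
  assumes "Z q = 1"
  shows "cumulant X \<chi> {q} Z {{q}} = 1"
proof -
  have q: "{{q}} \<in> BNC \<chi> {q}" by (rule BNC_whole) simp
  have "{\<sigma>. \<sigma> \<in> BNC \<chi> {q} \<and> refines {q} \<sigma> {{q}}} = {{{q}}}"
    using refines_BNC_refl[OF q] by (auto simp: BNC_singleton)
  moreover have "moebius \<chi> {q} {{q}} {{q}} = 1"
    using q refines_BNC_refl[OF q] by (simp add: moebius.simps)
  moreover have "moment X \<chi> {q} Z {{q}} = 1"
    using q assms by (simp add: moment.simps E_one)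
  ultimately show ?thesis by (simp add: cumulant_def)
qed

lemma cumulant_unit:
  assumes S: "finite S" "q \<in> S" "S \<noteq> {q}" and Z: "Z \<in> faces X \<chi> S" "Z q = 1"
  shows "cumulant X \<chi> S Z {S} = 0"
proof -
  let ?P = "BNC \<chi> S" and ?f = "\<lambda>\<sigma>. scD X (of_int (moebius \<chi> S \<sigma> {S})) (imoment X \<chi> S \<sigma> Z)"
  have "cumulant X \<chi> S Z {S} = sum ?f ?P"
    using S by (intro cumulant_whole Z) auto
  also have "\<dots> = (\<Sum>\<tau>\<in>isolate q ` ?P. sum ?f {\<sigma>. \<sigma> \<in> ?P \<and> isolate q \<sigma> = \<tau>})"
    by (rule sum.image_gen[OF finite_BNC[OF S(1)]])
  also have "\<dots> = 0"
  proof (rule sum.neutral, rule ballI)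
    fix \<tau> assume "\<tau> \<in> isolate q ` ?P"
    then have \<tau>: "\<tau> \<in> ?P" "{q} \<in> \<tau>" using BNC_isolate[OF _ S(2)] by (auto simp: isolate_def)
    have "sum ?f {\<sigma>. \<sigma> \<in> ?P \<and> isolate q \<sigma> = \<tau>} =
        (\<Sum>\<sigma> | \<sigma> \<in> ?P \<and> isolate q \<sigma> = \<tau>. scD X (of_int (moebius \<chi> S \<sigma> {S})) (imoment X \<chi> S \<tau> Z))"
      using imoment_isolate[OF S(1) _ S(2) Z] by (intro sum.cong refl) auto
    also have "\<dots> = scD X (of_int (\<Sum>\<sigma> | \<sigma> \<in> ?P \<and> isolate q \<sigma> = \<tau>. moebius \<chi> S \<sigma> {S})) (imoment X \<chi> S \<tau> Z)"
      by (simp add: D.scale_sum_left)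
    finally show "sum ?f {\<sigma>. \<sigma> \<in> ?P \<and> isolate q \<sigma> = \<tau>} = 0"
      using moebius_sum_isolate[OF S \<tau>] by simp
  qed
  finally show ?thesis .
qed

lemma cumulant_vanishes:
  assumes "finite S" "q \<in> S" "S \<noteq> {q}" "Z \<in> faces X \<chi> S" "Z q = side_op X (\<chi> q) b" "b \<in> B"
  shows "cumulant X \<chi> S Z {S} = 0"
proof (rule balanced_side_op_zero[OF _ assms(1,2) _ assms(4-6)])
  show "balanced X \<chi> S (\<lambda>Z. cumulant X \<chi> S Z {S})"
    using assms(2) by (intro balanced_cumulant[OF assms(1)]) auto
qed (rule cumulant_unit[OF assms(1-3)])

end

section \<open>Vanishing of the conditionally bi-free cumulants\<close>

lemma outer_decomp_eqI:
  "finite S \<Longrightarrow> \<pi> \<in> BNC \<chi> S \<Longrightarrow> is_outer_decomp \<chi> S \<pi> Us \<Longrightarrow> outer_decomp \<chi> S \<pi> = Us"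
  unfolding outer_decomp_def by (rule the1_equality[OF is_outer_decomp_ex1])

lemma outer_decomp_whole:
  assumes "finite S" "S \<noteq> {}" "\<pi> \<in> BNC \<chi> S" "W \<in> \<pi>" "chi_min \<chi> S \<in> W" "chi_max \<chi> S \<in> W"
  shows "outer_decomp \<chi> S \<pi> = [S]"
proof (rule outer_decomp_eqI[OF assms(1,3)])
  have "S = \<Union>\<pi>" using assms(3) by (simp add: BNC_def partition_on_def)
  then show "is_outer_decomp \<chi> S \<pi> [S]"
    using assms by (auto simp: is_outer_decomp_def chi_interval_def partition_on_def)
qed

lemma outer_decomp_length_one:
  assumes "finite S" "S \<noteq> {}" "\<pi> \<in> BNC \<chi> S" "length (outer_decomp \<chi> S \<pi>) = 1"
  obtains W where "W \<in> \<pi>" "chi_min \<chi> S \<in> W" "chi_max \<chi> S \<in> W"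
proof -
  obtain U where U: "outer_decomp \<chi> S \<pi> = [U]"
    using assms(4) by (auto simp: length_Suc_conv)
  have dec: "is_outer_decomp \<chi> S \<pi> [U]"
    using outer_decomp_is_outer_decomp[OF assms(1,3)] U by simp
  then have "U = S" by (simp add: is_outer_decomp_def partition_on_def)
  then show thesis using dec that by (auto simp: is_outer_decomp_def)
qed

lemma BNC_restrict:
  assumes "\<pi> \<in> BNC \<chi> S" "S = U \<union> U'" "U \<inter> U' = {}" "\<And>W. W \<in> \<pi> \<Longrightarrow> W \<subseteq> U \<or> W \<subseteq> U'"
  shows "{W \<in> \<pi>. W \<subseteq> U} \<in> BNC \<chi> U"
proof -
  have "\<Union>{W \<in> \<pi>. W \<subseteq> U} = U"
  proof (intro equalityI subsetI)
    fix x assume x: "x \<in> U"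
    then obtain W where "W \<in> \<pi>" "x \<in> W" using BNC_cover[OF assms(1), of x] assms(2) by blast
    then show "x \<in> \<Union>{W \<in> \<pi>. W \<subseteq> U}" using assms(3,4) x by blast
  qed blast
  then show ?thesis using BNC_subset[OF assms(1), of "{W \<in> \<pi>. W \<subseteq> U}"] by auto
qed

text \<open>Only the first interval is split off, against the union of all others. Such a cut into
  two parts suffices for inductions on the cardinality, which then need no lists of
  intervals.\<close>

lemma outer_decomp_split:
  assumes fin: "finite S" and \<pi>: "\<pi> \<in> BNC \<chi> S" and "S \<noteq> {}" and len: "length (outer_decomp \<chi> S \<pi>) \<noteq> 1"
  obtains U U' where "S = U \<union> U'" "U \<noteq> {}" "U' \<noteq> {}"
    "\<forall>x\<in>U. \<forall>y\<in>U'. chi_less \<chi> x y" "\<forall>W\<in>\<pi>. W \<subseteq> U \<or> W \<subseteq> U'"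
proof -
  have dec: "is_outer_decomp \<chi> S \<pi> (outer_decomp \<chi> S \<pi>)"
    by (rule outer_decomp_is_outer_decomp[OF fin \<pi>])
  then have "outer_decomp \<chi> S \<pi> \<noteq> []"
    using \<open>S \<noteq> {}\<close> by (auto simp: is_outer_decomp_def partition_on_def)
  then obtain U U1 Us where Us: "outer_decomp \<chi> S \<pi> = U # U1 # Us"
    using len by (metis One_nat_def length_Cons list.exhaust list.size(3))
  have part: "partition_on S (set (U # U1 # Us))"
    and srt: "sorted_wrt (\<lambda>U U'. \<forall>x\<in>U. \<forall>y\<in>U'. chi_less \<chi> x y) (U # U1 # Us)"
    and un: "\<exists>\<rho>\<subseteq>\<pi>. U = \<Union>\<rho>"
    using dec unfolding Us is_outer_decomp_def by auto
  define U' where "U' = \<Union>(set (U1 # Us))"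
  have S: "S = U \<union> U'" using part by (simp add: partition_on_def U'_def)
  have ne: "U \<noteq> {}" "U' \<noteq> {}" using part by (auto simp: partition_on_def U'_def)
  have less: "chi_less \<chi> x y" if "x \<in> U" "y \<in> U'" for x y
    using srt that by (auto simp: U'_def)
  obtain \<rho> where \<rho>: "\<rho> \<subseteq> \<pi>" "U = \<Union>\<rho>" using un by blast
  have "W \<subseteq> U \<or> W \<subseteq> U'" if W: "W \<in> \<pi>" for W
  proof (cases "W \<in> \<rho>")
    case False
    then have "W \<inter> U = {}" using BNC_disjoint[OF \<pi> W] \<rho> by blast
    then show ?thesis using BNC_block(1)[OF \<pi> W] S by blast
  qed (use \<rho> in blast)
  with less show thesis by (intro that[OF S ne]) blast+
qed

text \<open>If the decomposition is trivial, it is \<open>[S]\<close> and the product has the single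
  factor on the left-hand side; so the formula needs no case distinction.\<close>

lemma ccumulant_prod:
  assumes fin: "finite S" "S \<noteq> {}" and \<pi>: "\<pi> \<in> BNC \<chi> S"
  shows "ccumulant X \<chi> S Z \<pi> =
    prod_list (map (\<lambda>U. ccumulant X \<chi> U Z {W \<in> \<pi>. W \<subseteq> U}) (outer_decomp \<chi> S \<pi>))"
proof (cases "length (outer_decomp \<chi> S \<pi>) = 1")
  case True
  then obtain W where "W \<in> \<pi>" "chi_min \<chi> S \<in> W" "chi_max \<chi> S \<in> W"
    by (rule outer_decomp_length_one[OF assms])
  then have "outer_decomp \<chi> S \<pi> = [S]" by (rule outer_decomp_whole[OF assms])
  moreover have "{W \<in> \<pi>. W \<subseteq> S} = \<pi>" using BNC_block(1)[OF \<pi>] by blast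
  ultimately show ?thesis by simp
next
  case False
  have "\<pi> \<noteq> {S}"
    using False outer_decomp_whole[OF assms, of S] chi_min_in[OF fin] chi_max_in[OF fin] by auto
  then show ?thesis using False assms by (subst ccumulant.simps) simp
qed

lemma ccumulant_split:
  assumes fin: "finite S" and \<pi>: "\<pi> \<in> BNC \<chi> S" and S: "S = U \<union> U'" "U \<noteq> {}" "U' \<noteq> {}"
    and less: "\<And>x y. x \<in> U \<Longrightarrow> y \<in> U' \<Longrightarrow> chi_less \<chi> x y"
    and sat: "\<And>W. W \<in> \<pi> \<Longrightarrow> W \<subseteq> U \<or> W \<subseteq> U'"
  shows "ccumulant X \<chi> S Z \<pi> =
    ccumulant X \<chi> U Z {W \<in> \<pi>. W \<subseteq> U} * ccumulant X \<chi> U' Z {W \<in> \<pi>. W \<subseteq> U'}"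
proof -
  have disj: "U \<inter> U' = {}" using less chi_less_irrefl by blast
  have fins: "finite U" "finite U'" using fin S by auto
  let ?\<rho> = "{W \<in> \<pi>. W \<subseteq> U}" and ?\<rho>' = "{W \<in> \<pi>. W \<subseteq> U'}"
  have \<rho>: "?\<rho> \<in> BNC \<chi> U" by (rule BNC_restrict[OF \<pi> S(1) disj sat])
  have \<rho>': "?\<rho>' \<in> BNC \<chi> U'" using \<pi> S(1) disj sat by (intro BNC_restrict[of _ _ S _ U]) blast+
  let ?Us = "outer_decomp \<chi> U ?\<rho>" and ?Us' = "outer_decomp \<chi> U' ?\<rho>'"
  have dec: "is_outer_decomp \<chi> U ?\<rho> ?Us" and dec': "is_outer_decomp \<chi> U' ?\<rho>' ?Us'"
    using \<rho> \<rho>' fins by (simp_all add: outer_decomp_is_outer_decomp)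
  have part: "partition_on U (set ?Us)" "partition_on U' (set ?Us')"
    using dec dec' by (simp_all add: is_outer_decomp_def)
  have sub: "T \<subseteq> U" if "T \<in> set ?Us" for T using part(1) that by (auto simp: partition_on_def)
  have sub': "T \<subseteq> U'" if "T \<in> set ?Us'" for T using part(2) that by (auto simp: partition_on_def)
  have "is_outer_decomp \<chi> S \<pi> (?Us @ ?Us')"
    unfolding is_outer_decomp_def
  proof (intro conjI ballI)
    show "partition_on S (set (?Us @ ?Us'))"
      unfolding partition_on_def
    proof (intro conjI)
      show "\<Union> (set (?Us @ ?Us')) = S" "{} \<notin> set (?Us @ ?Us')"
        using part S(1) by (auto simp: partition_on_def)
      show "disjoint (set (?Us @ ?Us'))"
        using part disj unfolding set_append partition_on_def by (intro disjoint_union) auto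
    qed
    show "sorted_wrt (\<lambda>U U'. \<forall>x\<in>U. \<forall>y\<in>U'. chi_less \<chi> x y) (?Us @ ?Us')"
      unfolding sorted_wrt_append
    proof (intro conjI ballI)
      fix T T' x y assume "T \<in> set ?Us" "T' \<in> set ?Us'" "x \<in> T" "y \<in> T'"
      then show "chi_less \<chi> x y" using less[of x y] sub[of T] sub'[of T'] by auto
    qed (use dec dec' in \<open>simp_all add: is_outer_decomp_def\<close>)
    fix T assume T: "T \<in> set (?Us @ ?Us')"
    have T': "T \<in> set ?Us \<or> T \<in> set ?Us'" using T by simp
    have int: "chi_interval \<chi> U T \<or> chi_interval \<chi> U' T"
      using T' dec dec' by (auto simp: is_outer_decomp_def)
    have "(\<exists>\<rho>\<subseteq>?\<rho>. T = \<Union>\<rho>) \<or> (\<exists>\<rho>\<subseteq>?\<rho>'. T = \<Union>\<rho>)"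
      using T' dec dec' by (auto simp: is_outer_decomp_def)
    then have un: "\<exists>\<rho>\<subseteq>\<pi>. T = \<Union>\<rho>" by blast
    have "(\<exists>W\<in>?\<rho>. chi_min \<chi> T \<in> W \<and> chi_max \<chi> T \<in> W) \<or> (\<exists>W\<in>?\<rho>'. chi_min \<chi> T \<in> W \<and> chi_max \<chi> T \<in> W)"
      using T' dec dec' unfolding is_outer_decomp_def by meson
    then have W: "\<exists>W\<in>\<pi>. chi_min \<chi> T \<in> W \<and> chi_max \<chi> T \<in> W" by blast
    show "\<exists>\<rho>\<subseteq>\<pi>. T = \<Union>\<rho>" "\<exists>W\<in>\<pi>. chi_min \<chi> T \<in> W \<and> chi_max \<chi> T \<in> W" by (rule un, rule W)
    show "chi_interval \<chi> S T"
    proof (rule chi_intervalI)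
      show "T \<subseteq> S" using int S(1) chi_interval_sub[of \<chi> U T] chi_interval_sub[of \<chi> U' T] by blast
      fix a b c assume abc: "a \<in> T" "c \<in> T" "b \<in> S" "chi_less \<chi> a b" "chi_less \<chi> b c"
      from int show "b \<in> T"
      proof
        assume i: "chi_interval \<chi> U T"
        then have "b \<in> U" using abc S(1) less[of c b] chi_less_asym[of \<chi> b c] chi_interval_sub[OF i] by blast
        then show ?thesis using chi_intervalD[OF i] abc by blast
      next
        assume i: "chi_interval \<chi> U' T"
        then have "b \<in> U'" using abc S(1) less[of b a] chi_less_asym[of \<chi> a b] chi_interval_sub[OF i] by blast
        then show ?thesis using chi_intervalD[OF i] abc by blast
      qed
    qed
  qed
  then have eq: "outer_decomp \<chi> S \<pi> = ?Us @ ?Us'" by (rule outer_decomp_eqI[OF fin \<pi>])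
  have "{W \<in> ?\<rho>. W \<subseteq> T} = {W \<in> \<pi>. W \<subseteq> T}" if "T \<in> set ?Us" for T using sub[OF that] by blast
  then have m: "map (\<lambda>T. ccumulant X \<chi> T Z {W \<in> \<pi>. W \<subseteq> T}) ?Us =
      map (\<lambda>T. ccumulant X \<chi> T Z {W \<in> ?\<rho>. W \<subseteq> T}) ?Us" by (intro map_cong refl) simp
  have "{W \<in> ?\<rho>'. W \<subseteq> T} = {W \<in> \<pi>. W \<subseteq> T}" if "T \<in> set ?Us'" for T using sub'[OF that] by blast
  then have m': "map (\<lambda>T. ccumulant X \<chi> T Z {W \<in> \<pi>. W \<subseteq> T}) ?Us' =
      map (\<lambda>T. ccumulant X \<chi> T Z {W \<in> ?\<rho>'. W \<subseteq> T}) ?Us'" by (intro map_cong refl) simp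
  have "S \<noteq> {}" using S by blast
  from ccumulant_prod[OF fin this \<pi>, of X Z] show ?thesis
    unfolding eq map_append m m' prod_list.append
      ccumulant_prod[OF fins(1) S(2) \<rho>, of X Z, symmetric] ccumulant_prod[OF fins(2) S(3) \<rho>', of X Z, symmetric] .
qed

lemma ccumulant_sum:
  assumes "finite S" "S \<noteq> {}"
  shows "(\<Sum>\<pi>\<in>BNC \<chi> S. ccumulant X \<chi> S Z \<pi>) = FF X (oprod Z S)"
proof -
  have "(\<Sum>\<pi>\<in>BNC \<chi> S. ccumulant X \<chi> S Z \<pi>) =
      ccumulant X \<chi> S Z {S} + (\<Sum>\<pi>\<in>BNC \<chi> S - {{S}}. ccumulant X \<chi> S Z \<pi>)"
    by (intro sum.remove finite_BNC BNC_whole assms)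
  then show ?thesis using assms BNC_whole[OF assms(2), of \<chi>] by (simp add: ccumulant.simps[of X \<chi> S Z "{S}"])
qed

text \<open>The third branch of \<open>ccumulant\<close> in terms of intervals and
  \<open>ract\<close>. The least index lies in \<open>Q\<close> and hence below every other block,
  so the predecessor \<open>p\<close> exists.\<close>

lemma inner_block:
  assumes fin: "finite S" and \<pi>: "\<pi> \<in> BNC \<chi> S" "\<pi> \<noteq> {S}"
    and Q: "Q \<in> \<pi>" "chi_min \<chi> S \<in> Q" "chi_max \<chi> S \<in> Q"
  defines "V \<equiv> last_block (\<pi> - {Q})"
  defines "p \<equiv> chi_max \<chi> {j \<in> S. chi_less \<chi> j (chi_min \<chi> V)}"
  shows "V \<in> \<pi>" "V \<noteq> Q" "chi_interval \<chi> S V" "is_last \<chi> (chi_below \<chi> S V) p"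
    and "ccumulant X \<chi> S Z \<pi> =
      ccumulant X \<chi> (S - V) (Z(p := ract X (\<chi> p) (Z p) (cumulant X \<chi> V Z {V}))) (\<pi> - {V})"
proof -
  have "\<pi> - {Q} \<noteq> {}"
  proof
    assume "\<pi> - {Q} = {}"
    then have "\<pi> = {Q}" using Q by blast
    then show False using \<pi> by (simp add: BNC_def partition_on_def)
  qed
  moreover have fin\<pi>: "finite \<pi>" by (rule BNC_finite[OF \<pi>(1) fin])
  ultimately have "V \<in> \<pi> - {Q}" unfolding V_def by (intro last_block_in) simp_all
  then show V: "V \<in> \<pi>" "V \<noteq> Q" by simp_all
  have "Min W \<le> Min V \<or> chi_min \<chi> S \<in> W" if "W \<in> \<pi>" for W
    using last_block_max[of "\<pi> - {Q}" W] fin\<pi> that Q unfolding V_def by (cases "W = Q") auto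
  then show "chi_interval \<chi> S V" by (intro inner_block_interval[OF \<pi>(1) fin V(1)])
  note Vb = BNC_block[OF \<pi>(1) V(1)]
  have finV: "finite V" using finite_subset[OF Vb(1) fin] .
  have S: "S \<noteq> {}" using Vb by blast
  have eq: "{j \<in> S. chi_less \<chi> j (chi_min \<chi> V)} = chi_below \<chi> S V"
  proof (intro equalityI subsetI)
    fix j assume "j \<in> {j \<in> S. chi_less \<chi> j (chi_min \<chi> V)}"
    then show "j \<in> chi_below \<chi> S V"
      using chi_min_less[OF finV Vb(2), of _ \<chi>] chi_less_trans[of \<chi> j "chi_min \<chi> V"]
      by (fastforce simp: chi_below_def)
  qed (use chi_min_in[OF finV Vb(2)] in \<open>auto simp: chi_below_def\<close>)
  have "chi_min \<chi> S \<notin> V" using BNC_disjoint[OF \<pi>(1) V(1) Q(1)] V(2) Q(2) by blast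
  then have "chi_min \<chi> S \<in> chi_below \<chi> S V"
    using chi_min_in[OF fin S] chi_min_less[OF fin S, of _ \<chi>] Vb(1) by (auto simp: chi_below_def)
  then show "is_last \<chi> (chi_below \<chi> S V) p"
    unfolding p_def eq using fin by (intro chi_max_is_last) (auto simp: chi_below_def)
  have "length (outer_decomp \<chi> S \<pi>) = 1"
    by (simp add: outer_decomp_whole[OF fin S \<pi>(1) Q])
  moreover have "block_of \<pi> (chi_min \<chi> S) = Q" by (rule block_of_eq[OF \<pi>(1) Q(1,2)])
  ultimately show "ccumulant X \<chi> S Z \<pi> =
      ccumulant X \<chi> (S - V) (Z(p := ract X (\<chi> p) (Z p) (cumulant X \<chi> V Z {V}))) (\<pi> - {V})"
    using fin S \<pi> unfolding ract_def V_def p_def by (subst ccumulant.simps) (simp add: Let_def)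
qed

section \<open>Conditional cumulants: balance, deletion of a unit block, vanishing\<close>

context ncs_pair
begin

text \<open>At the cut \<open>b\<close> is a right factor of the first value or a left factor of the
  second, so balance there is associativity in \<D>.\<close>

lemma balanced_mult:
  assumes S: "S = U \<union> U'" "U \<noteq> {}" "U' \<noteq> {}"
    and less: "\<And>x y. x \<in> U \<Longrightarrow> y \<in> U' \<Longrightarrow> chi_less \<chi> x y"
    and \<Phi>: "balanced X \<chi> U \<Phi>" and \<Phi>': "balanced X \<chi> U' \<Phi>'"
  shows "balanced X \<chi> S (\<lambda>Z. \<Phi> Z * \<Phi>' Z)"
proof -
  have disj: "x \<notin> U'" if "x \<in> U" for x using less[OF that, of x] chi_less_irrefl by blast
  have fac: "Z \<in> faces X \<chi> U" "Z \<in> faces X \<chi> U'" if "Z \<in> faces X \<chi> S" for Z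
    using that S by (auto simp: faces_def)
  have sub: "U \<subseteq> S" "U' \<subseteq> S" using S by auto
  note up = balanced_upd[OF \<Phi> fac(1)] and up' = balanced_upd[OF \<Phi>' fac(2)]
  show ?thesis
  proof (rule balancedI)
    fix Z Z' assume Z: "Z \<in> faces X \<chi> S" and eq: "\<And>i. i \<in> S \<Longrightarrow> Z i = Z' i"
    show "\<Phi> Z * \<Phi>' Z = \<Phi> Z' * \<Phi>' Z'"
      by (intro arg_cong2[of _ _ _ _ "(*)"] balanced_cong[OF \<Phi> fac(1)[OF Z]] balanced_cong[OF \<Phi>' fac(2)[OF Z]])
        (use eq S in auto)
  next
    fix Z b p assume Z: "Z \<in> faces X \<chi> S" and b: "b \<in> B" and p: "is_first \<chi> S p"
    obtain u where u: "u \<in> U" using S by blast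
    have pU: "p \<in> U"
    proof (rule ccontr)
      assume "p \<notin> U"
      then have "p \<in> U'" "u \<noteq> p" using p u S(1) by (auto simp: is_first_def)
      then show False
        using p u less[of u p] chi_less_asym[of \<chi> p u] sub(1) by (auto simp: is_first_def)
    qed
    from balanced_first[OF \<Phi> fac(1)[OF Z] b is_first_subset[OF p sub(1) pU]]
    show "\<Phi> (Z(p := lact X (\<chi> p) b (Z p))) * \<Phi>' (Z(p := lact X (\<chi> p) b (Z p))) = b * (\<Phi> Z * \<Phi>' Z)"
      using up'[OF Z disj[OF pU]] by (simp add: mult.assoc)
  next
    fix Z b p assume Z: "Z \<in> faces X \<chi> S" and b: "b \<in> B" and p: "is_last \<chi> S p"
    obtain u where u: "u \<in> U'" using S by blast
    have pU: "p \<in> U'"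
    proof (rule ccontr)
      assume "p \<notin> U'"
      then have "p \<in> U" "u \<noteq> p" using p u S(1) by (auto simp: is_last_def)
      then show False
        using p u less[of p u] chi_less_asym[of \<chi> p u] sub(2) by (auto simp: is_last_def)
    qed
    then have "p \<notin> U" using disj by blast
    from balanced_last[OF \<Phi>' fac(2)[OF Z] b is_last_subset[OF p sub(2) pU]]
    show "\<Phi> (Z(p := ract X (\<chi> p) (Z p) b)) * \<Phi>' (Z(p := ract X (\<chi> p) (Z p) b)) = \<Phi> Z * \<Phi>' Z * b"
      using up[OF Z \<open>p \<notin> U\<close>] by (simp add: mult.assoc)
  next
    fix Z b p p' assume Z: "Z \<in> faces X \<chi> S" and b: "b \<in> B" and adj: "adjacent \<chi> S p p'"
    have p: "p \<in> S" "p' \<in> S" "chi_less \<chi> p p'"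
      and btw: "\<And>x. x \<in> S \<Longrightarrow> chi_less \<chi> p x \<Longrightarrow> \<not> chi_less \<chi> x p'"
      using adj by (auto simp: adjacent_def)
    let ?l = "Z(p := ract X (\<chi> p) (Z p) b)" and ?r = "Z(p' := lact X (\<chi> p') b (Z p'))"
    consider "p \<in> U" "p' \<in> U" | "p \<in> U'" "p' \<in> U'" | "p \<in> U" "p' \<in> U'"
      using p S(1) less[of p' p] chi_less_asym[of \<chi> p p'] by blast
    then show "\<Phi> ?l * \<Phi>' ?l = \<Phi> ?r * \<Phi>' ?r"
    proof cases
      case 1
      from balanced_adjacent[OF \<Phi> fac(1)[OF Z] b adjacent_subset[OF adj sub(1) 1]]
      show ?thesis using up'[OF Z disj[OF 1(1)]] up'[OF Z disj[OF 1(2)]] by simp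
    next
      case 2
      then have "p \<notin> U" "p' \<notin> U" using disj by blast+
      from balanced_adjacent[OF \<Phi>' fac(2)[OF Z] b adjacent_subset[OF adj sub(2) 2]]
      show ?thesis using up[OF Z \<open>p \<notin> U\<close>] up[OF Z \<open>p' \<notin> U\<close>] by simp
    next
      case 3
      have "chi_less \<chi> x p" if "x \<in> U" "x \<noteq> p" for x
        using less[OF that(1) 3(2)] btw[of x] chi_less_total[OF that(2), of \<chi>] that sub by blast
      then have l: "is_last \<chi> U p" using 3 by (simp add: is_last_def)
      have "chi_less \<chi> p' x" if "x \<in> U'" "x \<noteq> p'" for x
        using less[OF 3(1) that(1)] btw[of x] chi_less_total[OF that(2), of \<chi>] that sub by blast
      then have f: "is_first \<chi> U' p'" using 3 by (simp add: is_first_def)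
      have "p' \<notin> U" using 3 disj by blast
      then show ?thesis
        using balanced_last[OF \<Phi> fac(1)[OF Z] b l] balanced_first[OF \<Phi>' fac(2)[OF Z] b f]
          up[OF Z \<open>p' \<notin> U\<close>] up'[OF Z disj[OF 3(1)]] by (simp add: mult.assoc)
    qed
  qed
qed

lemma balanced_diff:
  assumes "balanced X \<chi> S \<Phi>" "balanced X \<chi> S \<Psi>"
  shows "balanced X \<chi> S (\<lambda>Z. \<Phi> Z - \<Psi> Z)"
proof (rule balancedI)
  fix Z Z' assume Z: "Z \<in> faces X \<chi> S" "\<And>i. i \<in> S \<Longrightarrow> Z i = Z' i"
  show "\<Phi> Z - \<Psi> Z = \<Phi> Z' - \<Psi> Z'"
    using balanced_cong[OF assms(1) Z] balanced_cong[OF assms(2) Z] by simp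
qed (simp_all add: balanced_adjacent[OF assms(1)] balanced_adjacent[OF assms(2)]
    balanced_first[OF assms(1)] balanced_first[OF assms(2)] balanced_last[OF assms(1)]
    balanced_last[OF assms(2)] right_diff_distrib left_diff_distrib)

text \<open>A zero entry equals its own right action by 0. This 0 turns the entry of the successor
  into zero, and so on upwards, until it leaves at the last index as a factor; the induction counts
  the indices above \<open>q\<close>.\<close>

lemma balanced_zero_entry:
  "balanced X \<chi> S \<Phi> \<Longrightarrow> finite S \<Longrightarrow> q \<in> S \<Longrightarrow> Z \<in> faces X \<chi> S \<Longrightarrow> Z q = 0 \<Longrightarrow> \<Phi> Z = 0"
proof (induction "card {x \<in> S. chi_less \<chi> q x}" arbitrary: q Z rule: less_induct)
  case less
  note \<Phi> = less.prems(1) and S = less.prems(2,3) and Z = less.prems(4,5)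
  have upd: "Z(q := ract X (\<chi> q) (Z q) 0) = Z"
    using Z(2) by (auto simp: ract_def split: side.split)
  show ?case
  proof (cases rule: successor_cases[OF S, of \<chi>])
    case 1
    from balanced_last[OF \<Phi> Z(1) B_zero this] show ?thesis using upd by simp
  next
    case (2 s)
    let ?Z = "Z(s := lact X (\<chi> s) 0 (Z s))"
    have s: "s \<in> S" "chi_less \<chi> q s" using 2 by (simp_all add: adjacent_def)
    have "\<Phi> ?Z = 0"
    proof (rule less.hyps[OF _ \<Phi> S(1) s(1)])
      have "{x \<in> S. chi_less \<chi> s x} \<subset> {x \<in> S. chi_less \<chi> q x}"
        using s chi_less_trans[OF s(2)] chi_less_irrefl[of \<chi> s] by blast
      then show "card {x \<in> S. chi_less \<chi> s x} < card {x \<in> S. chi_less \<chi> q x}"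
        using S(1) by (intro psubset_card_mono) auto
      show "?Z \<in> faces X \<chi> S" using Z(1) B_zero by (rule faces_lact)
      show "?Z s = 0" by (simp add: lact_def split: side.split)
    qed
    then show ?thesis using balanced_adjacent[OF \<Phi> Z(1) B_zero 2] upd by simp
  qed
qed

lemma balanced_ccumulant:
  "finite S \<Longrightarrow> S \<noteq> {} \<Longrightarrow> \<pi> \<in> BNC \<chi> S \<Longrightarrow> balanced X \<chi> S (\<lambda>Z. ccumulant X \<chi> S Z \<pi>)"
proof (induction "card S" arbitrary: S \<pi> rule: less_induct)
  case less
  note fin = less.prems(1) and S = less.prems(2)
  have IH: "balanced X \<chi> U (\<lambda>Z. ccumulant X \<chi> U Z \<rho>)" if "U \<subset> S" "U \<noteq> {}" "\<rho> \<in> BNC \<chi> U" for U \<rho>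
    using that fin finite_subset[of U S] by (intro less.hyps psubset_card_mono) auto
  \<comment> \<open>Proved for all partitions other than \<open>{S}\<close> beforehand: the value at
    \<open>{S}\<close> subtracts the values at these on the same \<open>S\<close>, where the
    induction hypothesis does not reach.\<close>
  have neq: "balanced X \<chi> S (\<lambda>Z. ccumulant X \<chi> S Z \<pi>)" if \<pi>: "\<pi> \<in> BNC \<chi> S" "\<pi> \<noteq> {S}" for \<pi>
  proof (cases "length (outer_decomp \<chi> S \<pi>) = 1")
    case True
    then obtain Q where Q: "Q \<in> \<pi>" "chi_min \<chi> S \<in> Q" "chi_max \<chi> S \<in> Q"
      by (rule outer_decomp_length_one[OF fin S \<pi>(1)])
    note inner = inner_block(1-4)[OF fin \<pi> Q] inner_block(5)[where X = X, OF fin \<pi> Q]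
    let ?V = "last_block (\<pi> - {Q})"
    note Vb = BNC_block[OF \<pi>(1) inner(1)]
    have finV: "finite ?V" using finite_subset[OF Vb(1) fin] .
    have SV: "S - ?V \<noteq> {}" using BNC_whole_iff[OF \<pi>(1)] inner(1) \<pi>(2) Vb(1) by auto
    have bal: "balanced X \<chi> (S - ?V) (\<lambda>Z. ccumulant X \<chi> (S - ?V) Z (\<pi> - {?V}))"
      using Vb SV by (intro IH BNC_remove[OF \<pi>(1) inner(1)]) auto
    have range: "cumulant X \<chi> ?V Z {?V} \<in> B" if "Z \<in> faces X \<chi> ?V" for Z
      using that by (intro cumulant_range finV Vb)
    have gr: "balanced X \<chi> S (graft X \<chi> S ?V (\<lambda>Z. cumulant X \<chi> ?V Z {?V})
        (\<lambda>Z. ccumulant X \<chi> (S - ?V) Z (\<pi> - {?V})))"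
      using SV by (intro balanced_graft fin inner(3) Vb balanced_cumulant finV range bal) auto
    show ?thesis
    proof (rule balanced_eq_on_faces[OF gr])
      fix Z assume Z: "Z \<in> faces X \<chi> S"
      have "cumulant X \<chi> ?V Z {?V} \<in> B" by (rule range[OF faces_mono[OF Z Vb(1)]])
      then show "ccumulant X \<chi> S Z \<pi> = graft X \<chi> S ?V (\<lambda>Z. cumulant X \<chi> ?V Z {?V})
        (\<lambda>Z. ccumulant X \<chi> (S - ?V) Z (\<pi> - {?V})) Z"
        by (subst graft_pred[OF fin inner(3) Vb(2) bal Z _ inner(4)]) (simp_all add: inner(5))
    qed (simp add: faces_lact faces_ract)
  next
    case False
    then obtain U U' where U: "S = U \<union> U'" "U \<noteq> {}" "U' \<noteq> {}"
      and lt: "\<forall>x\<in>U. \<forall>y\<in>U'. chi_less \<chi> x y" and st: "\<forall>W\<in>\<pi>. W \<subseteq> U \<or> W \<subseteq> U'"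
      by (rule outer_decomp_split[OF fin \<pi>(1) S])
    note less = lt[rule_format] and sat = st[rule_format]
    have disj: "U \<inter> U' = {}" using less chi_less_irrefl by blast
    have "{W \<in> \<pi>. W \<subseteq> U} \<in> BNC \<chi> U" by (rule BNC_restrict[OF \<pi>(1) U(1) disj sat])
    moreover have "{W \<in> \<pi>. W \<subseteq> U'} \<in> BNC \<chi> U'"
      using \<pi>(1) U(1) disj sat by (intro BNC_restrict[of _ _ S _ U]) blast+
    moreover have "U \<subset> S" "U' \<subset> S" using U disj by blast+
    ultimately have "balanced X \<chi> S (\<lambda>Z. ccumulant X \<chi> U Z {W \<in> \<pi>. W \<subseteq> U} *
        ccumulant X \<chi> U' Z {W \<in> \<pi>. W \<subseteq> U'})"
      using U(2,3) by (intro balanced_mult[OF U less] IH)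
    moreover have "ccumulant X \<chi> S Z \<pi> =
        ccumulant X \<chi> U Z {W \<in> \<pi>. W \<subseteq> U} * ccumulant X \<chi> U' Z {W \<in> \<pi>. W \<subseteq> U'}" for Z
      by (rule ccumulant_split[OF fin \<pi>(1) U less sat])
    ultimately show ?thesis by simp
  qed
  show ?case
  proof (cases "\<pi> = {S}")
    case True
    \<comment> \<open>The scalar 1 brings the sum into the shape of
      \<open>balanced_sum\<close>.\<close>
    have "(\<lambda>Z. ccumulant X \<chi> S Z \<pi>) =
        (\<lambda>Z. FF X (oprod Z S) - (\<Sum>\<sigma>\<in>BNC \<chi> S - {{S}}. scD X 1 (ccumulant X \<chi> S Z \<sigma>)))"
      using True fin S less.prems(3) by (intro ext, subst ccumulant.simps) simp
    moreover have "balanced X \<chi> S \<dots>"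
      by (intro balanced_diff balanced_F[OF fin] balanced_sum neq) simp_all
    ultimately show ?thesis by (simp only:)
  qed (rule neq[OF less.prems(3)])
qed

lemma ccumulant_one: "Z q = 1 \<Longrightarrow> ccumulant X \<chi> {q} Z {{q}} = 1"
  by (subst ccumulant.simps) (simp add: BNC_singleton F_one)

text \<open>The recursions for the two partitions run in parallel. They differ where
  \<open>{q}\<close> itself is split off, with value 1, and where \<open>q\<close> is the
  predecessor of a removed block: there the cumulant lands on the unit entry, and balance moves it
  on to the predecessor that remains when \<open>q\<close> is left out.\<close>

lemma ccumulant_remove_unit:
  "finite S \<Longrightarrow> S \<noteq> {q} \<Longrightarrow> \<pi> \<in> BNC \<chi> S \<Longrightarrow> {q} \<in> \<pi> \<Longrightarrow> Z \<in> faces X \<chi> S \<Longrightarrow> Z q = 1 \<Longrightarrow>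
    ccumulant X \<chi> S Z \<pi> = ccumulant X \<chi> (S - {q}) Z (\<pi> - {{q}})"
proof (induction "card S" arbitrary: S \<pi> Z rule: less_induct)
  case less
  note fin = less.prems(1) and \<pi> = less.prems(3) and q = less.prems(4) and Z = less.prems(5,6)
  have qS: "q \<in> S" using BNC_block(1)[OF \<pi> q] by simp
  have S: "S \<noteq> {}" using qS by blast
  have \<pi>S: "\<pi> \<noteq> {S}" using q less.prems(2) by auto
  have unique: "W = {q}" if "W \<in> \<pi>" "q \<in> W" for W using BNC_disjoint[OF \<pi> that(1) q that(2)] by simp
  show ?case
  proof (cases "length (outer_decomp \<chi> S \<pi>) = 1")
    case True
    then obtain Q where Q: "Q \<in> \<pi>" "chi_min \<chi> S \<in> Q" "chi_max \<chi> S \<in> Q"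
      by (rule outer_decomp_length_one[OF fin S \<pi>])
    have first: "is_first \<chi> S (chi_min \<chi> S)" and last: "is_last \<chi> S (chi_max \<chi> S)"
      using fin S by (simp_all add: chi_min_is_first chi_max_is_last)
    have Qq: "Q \<noteq> {q}"
    proof
      assume "Q = {q}"
      then have "is_first \<chi> S q" "is_last \<chi> S q" using Q first last by auto
      then have "x = q" if "x \<in> S" for x
        using that chi_less_asym[of \<chi> q x] by (auto simp: is_first_def is_last_def)
      then show False using qS less.prems(2) by blast
    qed
    then have qQ: "q \<notin> Q" using unique Q(1) by blast
    define V where "V = last_block (\<pi> - {Q})"
    define p where "p = chi_max \<chi> {j \<in> S. chi_less \<chi> j (chi_min \<chi> V)}"
    define c where "c = cumulant X \<chi> V Z {V}"
    note inner = inner_block(1-4)[OF fin \<pi> \<pi>S Q, folded V_def, folded p_def]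
    have step: "ccumulant X \<chi> S Z \<pi> = ccumulant X \<chi> (S - V) (Z(p := ract X (\<chi> p) (Z p) c)) (\<pi> - {V})"
      using inner_block(5)[where X = X and Z = Z, OF fin \<pi> \<pi>S Q] by (simp add: V_def p_def c_def)
    note Vb = BNC_block[OF \<pi> inner(1)]
    show ?thesis
    proof (cases "V = {q}")
      case True
      then have "c = 1" using cumulant_one[where Z = Z and q = q, OF Z(2)] by (simp add: c_def)
      then show ?thesis using step True by simp
    next
      case False
      have qV: "q \<notin> V" using unique inner(1) False by blast
      have finV: "finite V" using finite_subset[OF Vb(1) fin] .
      have cB: "c \<in> B" unfolding c_def by (rule cumulant_range[OF finV Vb(2) faces_mono[OF Z(1) Vb(1)]])
      have QV: "Q \<in> \<pi> - {V}" using Q inner(2) by blast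
      have QS: "Q \<subseteq> S - V" using BNC_block(1)[OF BNC_remove[OF \<pi> inner(1)] QV] .
      then have ne: "chi_min \<chi> S \<in> S - V - {q}" "chi_max \<chi> S \<in> S - V - {q}" using Q qQ by blast+
      have \<pi>': "\<pi> - {{q}} \<in> BNC \<chi> (S - {q})" by (rule BNC_remove[OF \<pi> q])
      have "S - {q} \<notin> \<pi> - {{q}}"
        using BNC_disjoint[OF \<pi> _ inner(1), of "S - {q}"] BNC_disjoint[OF \<pi> _ Q(1), of "S - {q}" "chi_min \<chi> S"]
          Vb qV inner(2) Q(2) ne by auto
      then have \<pi>'S: "\<pi> - {{q}} \<noteq> {S - {q}}" by blast
      \<comment> \<open>The extreme indices of \<open>S\<close> lie in \<open>Q\<close>, which does
        not contain \<open>q\<close>; so without \<open>q\<close> the outer block is still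
        \<open>Q\<close> and the decomposition stays trivial.\<close>
      have min: "chi_min \<chi> (S - {q}) = chi_min \<chi> S" and max: "chi_max \<chi> (S - {q}) = chi_max \<chi> S"
        using ne is_first_chi_min[OF is_first_subset[OF first, of "S - {q}"]]
          is_last_chi_max[OF is_last_subset[OF last, of "S - {q}"]] by auto
      have Q': "Q \<in> \<pi> - {{q}}" "chi_min \<chi> (S - {q}) \<in> Q" "chi_max \<chi> (S - {q}) \<in> Q"
        using Q Qq by (simp_all add: min max)
      have V': "last_block (\<pi> - {{q}} - {Q}) = V"
        unfolding V_def using inner(1,2) False
        by (intro last_block_subset[OF \<pi> fin]) (auto simp: V_def)
      have fin': "finite (S - {q})" using fin by simp
      define p' where "p' = chi_max \<chi> {j \<in> S - {q}. chi_less \<chi> j (chi_min \<chi> V)}"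
      have p': "is_last \<chi> (chi_below \<chi> (S - {q}) V) p'"
        using inner_block(4)[OF fin' \<pi>' \<pi>'S Q'] by (simp add: V' p'_def)
      have step': "ccumulant X \<chi> (S - {q}) Z (\<pi> - {{q}}) =
          ccumulant X \<chi> (S - {q} - V) (Z(p' := ract X (\<chi> p') (Z p') c)) (\<pi> - {{q}} - {V})"
        using inner_block(5)[where X = X and Z = Z, OF fin' \<pi>' \<pi>'S Q'] by (simp add: V' p'_def c_def)
      have comm: "S - {q} - V = S - V - {q}" "\<pi> - {{q}} - {V} = \<pi> - {V} - {{q}}" by blast+
      have card: "card (S - V) < card S" using Vb fin by (intro psubset_card_mono) auto
      have \<pi>V: "\<pi> - {V} \<in> BNC \<chi> (S - V)" by (rule BNC_remove[OF \<pi> inner(1)])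
      have ZV: "Z \<in> faces X \<chi> (S - V)" using Z(1) by (rule faces_mono) blast
      have IH: "ccumulant X \<chi> (S - V) Y (\<pi> - {V}) = ccumulant X \<chi> (S - V - {q}) Y (\<pi> - {V} - {{q}})"
        if "Y \<in> faces X \<chi> (S - V)" "Y q = 1" for Y
        using that fin \<pi>V q qV ne False by (intro less.hyps[OF card]) auto
      have below: "chi_below \<chi> (S - {q}) V = chi_below \<chi> S V - {q}" by (auto simp: chi_below_def)
      have pb: "p \<in> chi_below \<chi> S V" and pl: "\<And>x. x \<in> chi_below \<chi> S V \<Longrightarrow> x \<noteq> p \<Longrightarrow> chi_less \<chi> x p"
        using inner(4) by (auto simp: is_last_def)
      have pb': "p' \<in> chi_below \<chi> S V" "p' \<noteq> q"
        and pl': "\<And>x. x \<in> chi_below \<chi> S V \<Longrightarrow> x \<noteq> q \<Longrightarrow> x \<noteq> p' \<Longrightarrow> chi_less \<chi> x p'"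
        using p' by (auto simp: is_last_def below)
      show ?thesis
      proof (cases "p = q")
        case False
        then have "p = p'" using pl[OF pb'(1)] pl'[OF pb] chi_less_asym[of \<chi> p p'] by blast
        then show ?thesis
          using IH[OF faces_ract[OF ZV cB, of p]] False Z(2) by (simp add: step step' comm)
      next
        case True
        \<comment> \<open>With \<open>q\<close> directly below \<open>V\<close>, the predecessor
          \<open>p'\<close> of \<open>V\<close> in \<open>S - {q}\<close> is the index directly
          below \<open>q\<close>.\<close>
        have "adjacent \<chi> (S - V) p' q"
          unfolding adjacent_def
        proof (intro conjI ballI notI)
          obtain v where v: "v \<in> V" using Vb(2) by blast
          show "p' \<in> S - V" using pb'(1) chi_less_irrefl unfolding chi_below_def by blast
          show "q \<in> S - V" using qS qV by simp
          show "chi_less \<chi> p' q" using pl[OF pb'(1)] pb'(2) True by simp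
          fix x assume x: "x \<in> S - V" "chi_less \<chi> p' x \<and> chi_less \<chi> x q"
          have "chi_less \<chi> q v" using pb v True by (simp add: chi_below_def)
          then have "chi_less \<chi> x v" using x chi_less_trans by blast
          then have "x \<in> chi_below \<chi> S V"
            using chi_interval_cases[OF inner(3) x(1)] v chi_less_asym[of \<chi> x v] by (auto simp: chi_above_def)
          moreover have "x \<noteq> q" "x \<noteq> p'" using x by auto
          ultimately show False
            using pl'[of x] x chi_less_asym[of \<chi> p' x] by blast
        qed
        moreover have "balanced X \<chi> (S - V) (\<lambda>Z. ccumulant X \<chi> (S - V) Z (\<pi> - {V}))"
          using fin ne \<pi>V by (intro balanced_ccumulant) auto
        ultimately have "ccumulant X \<chi> (S - V) (Z(q := side_op X (\<chi> q) c)) (\<pi> - {V}) =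
            ccumulant X \<chi> (S - V) (Z(p' := ract X (\<chi> p') (Z p') c)) (\<pi> - {V})"
          using balanced_unit_pred[OF _ ZV Z(2) cB] by blast
        then show ?thesis
          using IH[OF faces_ract[OF ZV cB, of p']] pb'(2) Z(2) True
          by (simp add: step step' comm side_op_ract)
      qed
    qed
  next
    case False
    then obtain U U' where U: "S = U \<union> U'" "U \<noteq> {}" "U' \<noteq> {}"
      and lt: "\<forall>x\<in>U. \<forall>y\<in>U'. chi_less \<chi> x y" and st: "\<forall>W\<in>\<pi>. W \<subseteq> U \<or> W \<subseteq> U'"
      by (rule outer_decomp_split[OF fin \<pi> S])
    note less' = lt[rule_format] and sat = st[rule_format]
    have disj: "U \<inter> U' = {}" using less' chi_less_irrefl by blast
    have \<rho>: "{W \<in> \<pi>. W \<subseteq> U} \<in> BNC \<chi> U" by (rule BNC_restrict[OF \<pi> U(1) disj sat])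
    have \<rho>': "{W \<in> \<pi>. W \<subseteq> U'} \<in> BNC \<chi> U'"
      using \<pi> U(1) disj sat by (intro BNC_restrict[of _ _ S _ U]) blast+
    have fins: "finite U" "finite U'" using U fin by auto
    have card: "card U < card S" "card U' < card S"
      using U disj fin by (auto intro!: psubset_card_mono)
    have fac: "Z \<in> faces X \<chi> U" "Z \<in> faces X \<chi> U'" using Z(1) U(1) by (auto simp: faces_def)
    have \<pi>': "\<pi> - {{q}} \<in> BNC \<chi> (S - {q})" by (rule BNC_remove[OF \<pi> q])
    note split = ccumulant_split[OF fin \<pi> U less' sat, of X Z]
    from qS U(1) consider "q \<in> U" | "q \<in> U'" by blast
    then show ?thesis
    proof cases
      case 1
      then have q': "q \<notin> U'" using disj by blast
      have r': "{W \<in> \<pi> - {{q}}. W \<subseteq> U'} = {W \<in> \<pi>. W \<subseteq> U'}" using q' by blast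
      show ?thesis
      proof (cases "U = {q}")
        case True
        have "{W \<in> \<pi>. W \<subseteq> U} = {{q}}" using \<rho> BNC_singleton[of \<chi> q] True by simp
        moreover have "S - {q} = U'" "\<pi> - {{q}} = {W \<in> \<pi>. W \<subseteq> U'}"
          using U(1) q' True r' sat BNC_block(2)[OF \<pi>] by auto
        ultimately show ?thesis using split True ccumulant_one[where Z = Z and q = q, OF Z(2)] by simp
      next
        case False
        have "ccumulant X \<chi> (S - {q}) Z (\<pi> - {{q}}) =
          ccumulant X \<chi> (U - {q}) Z {W \<in> \<pi> - {{q}}. W \<subseteq> U - {q}} *
          ccumulant X \<chi> U' Z {W \<in> \<pi> - {{q}}. W \<subseteq> U'}"
        proof (rule ccumulant_split[OF _ \<pi>' _ _ U(3)])
          show "W \<subseteq> U - {q} \<or> W \<subseteq> U'" if "W \<in> \<pi> - {{q}}" for W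
            using sat[of W] unique[of W] that by blast
        qed (use fin U(1,2) q' 1 False less' in auto)
        moreover have "{W \<in> \<pi> - {{q}}. W \<subseteq> U - {q}} = {W \<in> \<pi>. W \<subseteq> U} - {{q}}"
          using unique by blast
        moreover have "ccumulant X \<chi> U Z {W \<in> \<pi>. W \<subseteq> U} =
            ccumulant X \<chi> (U - {q}) Z ({W \<in> \<pi>. W \<subseteq> U} - {{q}})"
          using fins 1 False q by (intro less.hyps[OF card(1) _ _ \<rho> _ fac(1) Z(2)]) auto
        ultimately show ?thesis using split r' by simp
      qed
    next
      case 2
      then have q': "q \<notin> U" using disj by blast
      have r': "{W \<in> \<pi> - {{q}}. W \<subseteq> U} = {W \<in> \<pi>. W \<subseteq> U}" using q' by blast
      show ?thesis
      proof (cases "U' = {q}")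
        case True
        have "{W \<in> \<pi>. W \<subseteq> U'} = {{q}}" using \<rho>' BNC_singleton[of \<chi> q] True by simp
        moreover have "S - {q} = U" "\<pi> - {{q}} = {W \<in> \<pi>. W \<subseteq> U}"
          using U(1) q' True r' sat BNC_block(2)[OF \<pi>] by auto
        ultimately show ?thesis using split True ccumulant_one[where Z = Z and q = q, OF Z(2)] by simp
      next
        case False
        have "ccumulant X \<chi> (S - {q}) Z (\<pi> - {{q}}) =
          ccumulant X \<chi> U Z {W \<in> \<pi> - {{q}}. W \<subseteq> U} *
          ccumulant X \<chi> (U' - {q}) Z {W \<in> \<pi> - {{q}}. W \<subseteq> U' - {q}}"
        proof (rule ccumulant_split[OF _ \<pi>' _ U(2)])
          show "W \<subseteq> U \<or> W \<subseteq> U' - {q}" if "W \<in> \<pi> - {{q}}" for W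
            using sat[of W] unique[of W] that by blast
        qed (use fin U(1,3) q' 2 False less' in auto)
        moreover have "{W \<in> \<pi> - {{q}}. W \<subseteq> U' - {q}} = {W \<in> \<pi>. W \<subseteq> U'} - {{q}}"
          using unique by blast
        moreover have "ccumulant X \<chi> U' Z {W \<in> \<pi>. W \<subseteq> U'} =
            ccumulant X \<chi> (U' - {q}) Z ({W \<in> \<pi>. W \<subseteq> U'} - {{q}})"
          using fins 2 False q by (intro less.hyps[OF card(2) _ _ \<rho>' _ fac(2) Z(2)]) auto
        ultimately show ?thesis using split r' by simp
      qed
    qed
  qed
qed

text \<open>The claim covers every partition in which the block of \<open>q\<close> is larger than
  \<open>{q}\<close>, and every \<open>b\<close>, because the recursion may multiply the entry at
  \<open>q\<close> by a further cumulant. Either the block of \<open>q\<close> is at some point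
  removed as an inner block, or the recursion ends at it as the only block left.\<close>

lemma ccumulant_vanishes:
  "finite S \<Longrightarrow> \<pi> \<in> BNC \<chi> S \<Longrightarrow> Q \<in> \<pi> \<Longrightarrow> q \<in> Q \<Longrightarrow> Q \<noteq> {q} \<Longrightarrow> Z \<in> faces X \<chi> S \<Longrightarrow>
    Z q = side_op X (\<chi> q) b \<Longrightarrow> b \<in> B \<Longrightarrow> ccumulant X \<chi> S Z \<pi> = 0"
proof (induction "card S" arbitrary: S \<pi> Q Z b rule: less_induct)
  case less
  note fin = less.prems(1)
  have S: "S \<noteq> {}" and qS: "q \<in> S" using BNC_block(1)[OF less.prems(2,3)] less.prems(4) by auto
  \<comment> \<open>Again separated from the case of \<open>{S}\<close>, which calls it on the same
    \<open>S\<close> for all other partitions, with a unit entry and hence a different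
    \<open>b\<close>.\<close>
  have neq: "ccumulant X \<chi> S Z \<pi> = 0"
    if \<pi>: "\<pi> \<in> BNC \<chi> S" "\<pi> \<noteq> {S}" and Q: "Q \<in> \<pi>" "q \<in> Q" "Q \<noteq> {q}"
      and Z: "Z \<in> faces X \<chi> S" "Z q = side_op X (\<chi> q) b" and b: "b \<in> B" for \<pi> Q Z b
  proof (cases "length (outer_decomp \<chi> S \<pi>) = 1")
    case True
    then obtain W where W: "W \<in> \<pi>" "chi_min \<chi> S \<in> W" "chi_max \<chi> S \<in> W"
      by (rule outer_decomp_length_one[OF fin S \<pi>(1)])
    define V where "V = last_block (\<pi> - {W})"
    define p where "p = chi_max \<chi> {j \<in> S. chi_less \<chi> j (chi_min \<chi> V)}"
    define c where "c = cumulant X \<chi> V Z {V}"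
    note inner = inner_block(1-4)[OF fin \<pi> W, folded V_def, folded p_def]
    have step: "ccumulant X \<chi> S Z \<pi> = ccumulant X \<chi> (S - V) (Z(p := ract X (\<chi> p) (Z p) c)) (\<pi> - {V})"
      using inner_block(5)[where X = X and Z = Z, OF fin \<pi> W] by (simp add: V_def p_def c_def)
    note Vb = BNC_block[OF \<pi>(1) inner(1)]
    have finV: "finite V" using finite_subset[OF Vb(1) fin] .
    have ZV: "Z \<in> faces X \<chi> V" using Z(1) Vb(1) by (rule faces_mono)
    have cB: "c \<in> B" unfolding c_def by (rule cumulant_range[OF finV Vb(2) ZV])
    have \<pi>V: "\<pi> - {V} \<in> BNC \<chi> (S - V)" by (rule BNC_remove[OF \<pi>(1) inner(1)])
    have Z': "Z(p := ract X (\<chi> p) (Z p) c) \<in> faces X \<chi> (S - V)"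
      using cB by (intro faces_ract faces_mono[OF Z(1)]) auto
    have pV: "p \<in> S - V" using inner(4) chi_less_irrefl unfolding is_last_def chi_below_def by blast
    show ?thesis
    proof (cases "V = Q")
      case True
      \<comment> \<open>The block of \<open>q\<close> has a vanishing bi-free cumulant, whose action
        makes the entry at its predecessor zero.\<close>
      then have "c = 0"
        unfolding c_def using Q by (intro cumulant_vanishes[OF finV _ _ ZV Z(2) b]) auto
      then have "(Z(p := ract X (\<chi> p) (Z p) c)) p = 0" by (simp add: ract_def split: side.split)
      moreover have "finite (S - V)" "S - V \<noteq> {}" using fin pV by auto
      ultimately show ?thesis
        unfolding step by (intro balanced_zero_entry[OF balanced_ccumulant[OF _ _ \<pi>V] _ pV Z'])
    next
      case False
      then have "q \<notin> V" using BNC_disjoint[OF \<pi>(1) inner(1) Q(1)] Q(2) by blast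
      have card: "card (S - V) < card S" using Vb fin by (intro psubset_card_mono) auto
      have QV: "Q \<in> \<pi> - {V}" using Q False by blast
      show ?thesis
      proof (cases "p = q")
        case True
        \<comment> \<open>The predecessor is \<open>q\<close> itself; its entry remains an operator
          from \<B>, now of \<open>b * c\<close>.\<close>
        then have "(Z(p := ract X (\<chi> p) (Z p) c)) q = side_op X (\<chi> q) (b * c)"
          using Z(2) ract_ract[OF b cB] by (simp add: side_op_ract)
        then show ?thesis
          unfolding step using fin by (intro less.hyps[OF card _ \<pi>V QV Q(2,3) Z' _ B_mult[OF b cB]]) auto
      next
        case False
        then have "(Z(p := ract X (\<chi> p) (Z p) c)) q = side_op X (\<chi> q) b" using Z(2) by simp
        then show ?thesis
          unfolding step using fin by (intro less.hyps[OF card _ \<pi>V QV Q(2,3) Z' _ b]) auto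
      qed
    qed
  next
    case False
    then obtain U U' where U: "S = U \<union> U'" "U \<noteq> {}" "U' \<noteq> {}"
      and lt: "\<forall>x\<in>U. \<forall>y\<in>U'. chi_less \<chi> x y" and st: "\<forall>W\<in>\<pi>. W \<subseteq> U \<or> W \<subseteq> U'"
      by (rule outer_decomp_split[OF fin \<pi>(1) S])
    note less' = lt[rule_format] and sat = st[rule_format]
    have disj: "U \<inter> U' = {}" using less' chi_less_irrefl by blast
    have \<rho>: "{W \<in> \<pi>. W \<subseteq> U} \<in> BNC \<chi> U" by (rule BNC_restrict[OF \<pi>(1) U(1) disj sat])
    have \<rho>': "{W \<in> \<pi>. W \<subseteq> U'} \<in> BNC \<chi> U'"
      using \<pi>(1) U(1) disj sat by (intro BNC_restrict[of _ _ S _ U]) blast+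
    have fins: "finite U" "finite U'" using U fin by auto
    have card: "card U < card S" "card U' < card S"
      using U disj fin by (auto intro!: psubset_card_mono)
    have fac: "Z \<in> faces X \<chi> U" "Z \<in> faces X \<chi> U'" using Z(1) U(1) by (auto simp: faces_def)
    have "ccumulant X \<chi> U Z {W \<in> \<pi>. W \<subseteq> U} = 0 \<or> ccumulant X \<chi> U' Z {W \<in> \<pi>. W \<subseteq> U'} = 0"
      using sat[OF Q(1)]
    proof
      assume "Q \<subseteq> U"
      then have "Q \<in> {W \<in> \<pi>. W \<subseteq> U}" using Q(1) by blast
      from less.hyps[OF card(1) fins(1) \<rho> this Q(2,3) fac(1) Z(2) b] show ?thesis by blast
    next
      assume "Q \<subseteq> U'"
      then have "Q \<in> {W \<in> \<pi>. W \<subseteq> U'}" using Q(1) by blast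
      from less.hyps[OF card(2) fins(2) \<rho>' this Q(2,3) fac(2) Z(2) b] show ?thesis by blast
    qed
    moreover have "ccumulant X \<chi> S Z \<pi> =
        ccumulant X \<chi> U Z {W \<in> \<pi>. W \<subseteq> U} * ccumulant X \<chi> U' Z {W \<in> \<pi>. W \<subseteq> U'}"
      by (rule ccumulant_split[OF fin \<pi>(1) U less' sat])
    ultimately show ?thesis by auto
  qed
  show ?case
  proof (cases "\<pi> = {S}")
    case False
    show ?thesis by (rule neq[OF less.prems(2) False less.prems(3-8)])
  next
    case True
    then have Sq: "S \<noteq> {q}" using less.prems by auto
    show ?thesis
    proof (rule balanced_side_op_zero[OF _ fin qS _ less.prems(6-8)])
      show "balanced X \<chi> S (\<lambda>Z. ccumulant X \<chi> S Z \<pi>)"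
        by (rule balanced_ccumulant[OF fin S less.prems(2)])
      fix Z assume Z: "Z \<in> faces X \<chi> S" "Z q = 1"
      let ?K = "\<lambda>\<sigma>. ccumulant X \<chi> S Z \<sigma>"
      \<comment> \<open>The unit is the operator of 1, so \<open>neq\<close> applies to the
        partitions in which \<open>q\<close> is not isolated.\<close>
      have op: "Z q = side_op X (\<chi> q) 1" using Z(2) by (simp add: side_op_lact)
      let ?P = "{\<sigma> \<in> BNC \<chi> S. {q} \<in> \<sigma>}"
      have finB: "finite (BNC \<chi> S)" by (rule finite_BNC[OF fin])
      have SP: "{S} \<in> BNC \<chi> S - ?P" using BNC_whole[OF S] Sq by simp
      have "?K \<sigma> = 0" if \<sigma>: "\<sigma> \<in> BNC \<chi> S - ?P - {{S}}" for \<sigma>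
      proof -
        obtain Q where "Q \<in> \<sigma>" "q \<in> Q" using BNC_cover[of \<sigma> \<chi> S q] \<sigma> qS by blast
        then show ?thesis using \<sigma> by (intro neq[OF _ _ _ _ _ Z(1) op B_one]) auto
      qed
      then have "(\<Sum>\<sigma>\<in>BNC \<chi> S - ?P. ?K \<sigma>) = ?K {S}"
        using sum.remove[OF _ SP, of ?K] finB by simp
      moreover have "(\<Sum>\<sigma>\<in>?P. ?K \<sigma>) = (\<Sum>\<sigma>\<in>BNC \<chi> (S - {q}). ccumulant X \<chi> (S - {q}) Z \<sigma>)"
      proof (rule sum.reindex_bij_witness[where i = "insert {q}" and j = "\<lambda>\<sigma>. \<sigma> - {{q}}"])
        fix \<sigma> assume \<sigma>: "\<sigma> \<in> ?P"
        show "insert {q} (\<sigma> - {{q}}) = \<sigma>" using \<sigma> by blast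
        show "\<sigma> - {{q}} \<in> BNC \<chi> (S - {q})" using \<sigma> by (intro BNC_remove) auto
        show "ccumulant X \<chi> (S - {q}) Z (\<sigma> - {{q}}) = ?K \<sigma>"
          using \<sigma> by (intro ccumulant_remove_unit[symmetric] fin Sq Z) auto
      next
        fix \<sigma> assume \<sigma>: "\<sigma> \<in> BNC \<chi> (S - {q})"
        show "insert {q} \<sigma> - {{q}} = \<sigma>" using BNC_block(1)[OF \<sigma>, of "{q}"] by auto
        show "insert {q} \<sigma> \<in> ?P" using BNC_insert_singleton[OF \<sigma> qS] by simp
      qed
      moreover have "S - {q} \<noteq> {}" using Sq qS by blast
      then have "(\<Sum>\<sigma>\<in>BNC \<chi> (S - {q}). ccumulant X \<chi> (S - {q}) Z \<sigma>) = FF X (oprod Z S)"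
        using ccumulant_sum[of "S - {q}" X \<chi> Z] oprod_remove_one[where Z = Z, OF fin qS Z(2)] fin by simp
      moreover have "FF X (oprod Z S) = (\<Sum>\<sigma>\<in>BNC \<chi> S - ?P. ?K \<sigma>) + (\<Sum>\<sigma>\<in>?P. ?K \<sigma>)"
        unfolding ccumulant_sum[OF fin S, of X \<chi> Z, symmetric]
        by (rule sum.subset_diff[OF _ finB]) blast
      ultimately show "ccumulant X \<chi> S Z \<pi> = 0" using True by simp
    qed
  qed
qed

end

theorem proposition7p2:
  fixes X :: "('a::{ring, monoid_mult}, 'd::{ring, monoid_mult}, 't::{ring, monoid_mult}) ncs"
    and \<chi> :: "nat \<Rightarrow> side" and Z :: "nat \<Rightarrow> 'a" and n :: nat
  assumes "ncs_pair X"
    and "n \<ge> 2"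
    and "\<And>k. k \<in> {1..n} \<Longrightarrow> Z k \<in> face X (\<chi> k)"
    and "\<exists>q\<in>{1..n}. \<exists>b\<in>ncs_B X.
           (\<chi> q = Lft \<longrightarrow> Z q = Lop X b) \<and> (\<chi> q = Rgt \<longrightarrow> Z q = Rop X b)"
  shows "cumulant X \<chi> {1..n} Z {{1..n}} = 0 \<and> ccumulant X \<chi> {1..n} Z {{1..n}} = 0"
proof -
  interpret ncs_pair X by (rule assms(1))
  obtain q b where q: "q \<in> {1..n}" and b: "b \<in> ncs_B X" and Zq: "Z q = side_op X (\<chi> q) b"
    using assms(4) by (auto simp: side_op_def split: side.split)
  have Z: "Z \<in> faces X \<chi> {1..n}" using assms(3) by (simp add: faces_def)
  have ne: "{1..n} \<noteq> {q}"
  proof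
    assume "{1..n} = {q}"
    then have "card {1..n} = card {q}" by (rule arg_cong)
    then show False using assms(2) by simp
  qed
  have "{{1..n}} \<in> BNC \<chi> {1..n}" using assms(2) by (intro BNC_whole) simp
  then show ?thesis
    using cumulant_vanishes[OF _ q ne Z Zq b] ccumulant_vanishes[OF _ _ _ q ne Z Zq b] by simp
qed

end
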